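(* Let $\Gamma$ be an ascending HNN-extension of a finitely generated free group, i.e. $\Gamma=\langle x_1,\dots,x_n,t\mid t^{-1}x_it=\phi(x_i),\ i=1,\dots,n\rangle$ where $\phi:F_n\to F_n$ is an endomorphism of the free group $F_n=\langle x_1,\dots,x_n\rangle$, $n\in\mathbb{N}$. Then $\Gamma$ is good.
   Context: Let $\widehat\Gamma$ be the profinite completion of a group $\Gamma$. For a prime $p$, $\Gamma$ is $p$-good if for every finite $p$-primary $\Gamma$-module $M$ and every $n\ge 0$ the homomorphism $H^n(\widehat\Gamma,M)\to H^n(\Gamma,M)$ induced by the natural homomorphism $\Gamma\to\widehat\Gamma$ is an isomorphism (continuous cohomology on the left). $\Gamma$ is good if it is $p$-good for every prime $p$. *)

theory Defs
  imports
    "HOL-Algebra.Bij"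
    "HOL-Algebra.FiniteProduct"
    "HOL-Algebra.Product_Groups"
    "HOL-Computational_Algebra.Primes"
    "HOL-Analysis.Function_Topology"
begin

section \<open>Group presentations\<close>

text \<open>The letter \<open>(x, True)\<close> stands for the generator \<open>x\<close> and \<open>(x, False)\<close> for its inverse.\<close>

type_synonym 'x word = "('x \<times> bool) list"

definition words :: "'x set \<Rightarrow> 'x word set" where
  "words X = lists (X \<times> UNIV)"

definition word_inv :: "'x word \<Rightarrow> 'x word" where
  "word_inv w = rev (map (\<lambda>(x, b). (x, \<not> b)) w)"

text \<open>Equality of words over \<open>X\<close> as elements of the group presented by the generators \<open>X\<close> and the
  relators \<open>R\<close>; meant for \<open>R \<subseteq> words X\<close>.\<close>

inductive word_eq :: "'x set \<Rightarrow> 'x word set \<Rightarrow> 'x word \<Rightarrow> 'x word \<Rightarrow> bool"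
  for X :: "'x set" and R :: "'x word set" where
  refl: "u \<in> words X \<Longrightarrow> word_eq X R u u"
| sym: "word_eq X R u v \<Longrightarrow> word_eq X R v u"
| trans: "word_eq X R u v \<Longrightarrow> word_eq X R v w \<Longrightarrow> word_eq X R u w"
| cancel: "u \<in> words X \<Longrightarrow> v \<in> words X \<Longrightarrow> x \<in> X \<Longrightarrow>
    word_eq X R (u @ [(x, b), (x, \<not> b)] @ v) (u @ v)"
| relator: "u \<in> words X \<Longrightarrow> v \<in> words X \<Longrightarrow> r \<in> R \<Longrightarrow> word_eq X R (u @ r @ v) (u @ v)"

definition word_class :: "'x set \<Rightarrow> 'x word set \<Rightarrow> 'x word \<Rightarrow> 'x word set" where
  "word_class X R w = {v. word_eq X R w v}"

definition presented_group :: "'x set \<Rightarrow> 'x word set \<Rightarrow> 'x word set monoid" where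
  "presented_group X R =
    \<lparr>carrier = word_class X R ` words X,
     monoid.mult = (\<lambda>U V. \<Union>u\<in>U. \<Union>v\<in>V. word_class X R (u @ v)),
     one = word_class X R []\<rparr>"

definition free_group :: "'x set \<Rightarrow> 'x word set monoid" where
  "free_group X = presented_group X {}"

definition free_generator :: "'x set \<Rightarrow> 'x \<Rightarrow> 'x word set" where
  "free_generator X x = word_class X {} [(x, True)]"

text \<open>The generator \<open>x\<^sub>i\<close> is encoded as \<open>Some i\<close> and \<open>t\<close> as \<open>None\<close>.  An element of the free group is
  the set of all words representing it, so for each \<open>i\<close> there is one relator
  \<open>t\<^sup>-\<^sup>1 x\<^sub>i t w\<^sup>-\<^sup>1\<close> for every word \<open>w\<close> that represents \<open>\<phi> x\<^sub>i\<close>; all of them are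
  consequences of any single one.\<close>

definition ascending_HNN ::
  "nat \<Rightarrow> (nat word set \<Rightarrow> nat word set) \<Rightarrow> nat option word set monoid" where
  "ascending_HNN n \<phi> =
    presented_group (insert None (Some ` {..<n}))
      {[(None, False), (Some i, True), (None, True)] @ word_inv (map (map_prod Some id) w) | i w.
         i < n \<and> w \<in> \<phi> (free_generator {..<n} i)}"


section \<open>Modules and cohomology\<close>

text \<open>A \<open>G\<close>-module is an abelian group \<open>M\<close>, written multiplicatively, with a left action of \<open>G\<close> by
  automorphisms.\<close>

definition group_module ::
  "('g, 'r) monoid_scheme \<Rightarrow> 'm monoid \<Rightarrow> ('g \<Rightarrow> 'm \<Rightarrow> 'm) \<Rightarrow> bool" where
  "group_module G M \<alpha> \<longleftrightarrow> comm_group M \<and> \<alpha> \<in> hom G (AutoGroup M)"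

definition primary_group :: "nat \<Rightarrow> 'm monoid \<Rightarrow> bool" where
  "primary_group p M \<longleftrightarrow> (\<forall>m\<in>carrier M. \<exists>k::nat. m [^]\<^bsub>M\<^esub> (p ^ k) = \<one>\<^bsub>M\<^esub>)"

text \<open>Inhomogeneous cochains; an element of \<open>G\<^sup>n\<close> is a function \<open>g\<close> with entries
  \<open>g 0, \<dots>, g (n - 1)\<close>.\<close>

definition tuples :: "nat \<Rightarrow> 'g set \<Rightarrow> (nat \<Rightarrow> 'g) set" where
  "tuples n A = ({..<n} \<rightarrow>\<^sub>E A)"

definition cochain_group ::
  "('g, 'r) monoid_scheme \<Rightarrow> 'm monoid \<Rightarrow> nat \<Rightarrow> ((nat \<Rightarrow> 'g) \<Rightarrow> 'm) monoid" where
  "cochain_group G M n = product_group (tuples n (carrier G)) (\<lambda>_. M)"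

definition merge :: "('g, 'r) monoid_scheme \<Rightarrow> nat \<Rightarrow> nat \<Rightarrow> (nat \<Rightarrow> 'g) \<Rightarrow> nat \<Rightarrow> 'g" where
  "merge G n i g =
    (\<lambda>j\<in>{..<n}. if j < i then g j else if j = i then g i \<otimes>\<^bsub>G\<^esub> g (Suc i) else g (Suc j))"

text \<open>In additive notation and with entries numbered from 0:
  \<open>(d f)(g\<^sub>0, \<dots>, g\<^sub>n) = g\<^sub>0 f(g\<^sub>1, \<dots>, g\<^sub>n) + (\<Sum>i<n. (-1)\<^bsup>i+1\<^esup> f(\<dots>, g\<^sub>i g\<^sub>i\<^sub>+\<^sub>1, \<dots>)) +
  (-1)\<^bsup>n+1\<^esup> f(g\<^sub>0, \<dots>, g\<^sub>n\<^sub>-\<^sub>1)\<close>.\<close>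

definition differential ::
  "('g, 'r) monoid_scheme \<Rightarrow> 'm monoid \<Rightarrow> ('g \<Rightarrow> 'm \<Rightarrow> 'm) \<Rightarrow> nat
    \<Rightarrow> ((nat \<Rightarrow> 'g) \<Rightarrow> 'm) \<Rightarrow> (nat \<Rightarrow> 'g) \<Rightarrow> 'm" where
  "differential G M \<alpha> n f =
    (\<lambda>g\<in>tuples (Suc n) (carrier G).
       \<alpha> (g 0) (f (\<lambda>j\<in>{..<n}. g (Suc j)))
       \<otimes>\<^bsub>M\<^esub> (\<Otimes>\<^bsub>M\<^esub>i\<in>{..<n}. f (merge G n i g) [^]\<^bsub>M\<^esub> ((- 1) ^ Suc i :: int))
       \<otimes>\<^bsub>M\<^esub> f (restrict g {..<n}) [^]\<^bsub>M\<^esub> ((- 1) ^ Suc n :: int))"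

text \<open>\<open>C n\<close> is the set of admissible \<open>n\<close>-cochains: all of them for the cohomology of an abstract group,
  the continuous ones for a topological group.\<close>

definition cocycles ::
  "('g, 'r) monoid_scheme \<Rightarrow> 'm monoid \<Rightarrow> ('g \<Rightarrow> 'm \<Rightarrow> 'm)
    \<Rightarrow> (nat \<Rightarrow> ((nat \<Rightarrow> 'g) \<Rightarrow> 'm) set) \<Rightarrow> nat \<Rightarrow> ((nat \<Rightarrow> 'g) \<Rightarrow> 'm) set" where
  "cocycles G M \<alpha> C n = {f \<in> C n. differential G M \<alpha> n f = \<one>\<^bsub>cochain_group G M (Suc n)\<^esub>}"

definition coboundaries ::
  "('g, 'r) monoid_scheme \<Rightarrow> 'm monoid \<Rightarrow> ('g \<Rightarrow> 'm \<Rightarrow> 'm)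
    \<Rightarrow> (nat \<Rightarrow> ((nat \<Rightarrow> 'g) \<Rightarrow> 'm) set) \<Rightarrow> nat \<Rightarrow> ((nat \<Rightarrow> 'g) \<Rightarrow> 'm) set" where
  "coboundaries G M \<alpha> C n =
    (case n of 0 \<Rightarrow> {\<one>\<^bsub>cochain_group G M 0\<^esub>} | Suc k \<Rightarrow> differential G M \<alpha> k ` C k)"

definition cochain_cohomology ::
  "('g, 'r) monoid_scheme \<Rightarrow> 'm monoid \<Rightarrow> ('g \<Rightarrow> 'm \<Rightarrow> 'm)
    \<Rightarrow> (nat \<Rightarrow> ((nat \<Rightarrow> 'g) \<Rightarrow> 'm) set) \<Rightarrow> nat \<Rightarrow> ((nat \<Rightarrow> 'g) \<Rightarrow> 'm) set monoid" where
  "cochain_cohomology G M \<alpha> C n =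
    (cochain_group G M n)\<lparr>carrier := cocycles G M \<alpha> C n\<rparr> Mod coboundaries G M \<alpha> C n"

definition cochains ::
  "('g, 'r) monoid_scheme \<Rightarrow> 'm monoid \<Rightarrow> nat \<Rightarrow> ((nat \<Rightarrow> 'g) \<Rightarrow> 'm) set" where
  "cochains G M n = carrier (cochain_group G M n)"

definition continuous_cochains ::
  "'g topology \<Rightarrow> ('g, 'r) monoid_scheme \<Rightarrow> 'm monoid \<Rightarrow> nat \<Rightarrow> ((nat \<Rightarrow> 'g) \<Rightarrow> 'm) set" where
  "continuous_cochains T G M n =
    {f \<in> cochains G M n.
       continuous_map (product_topology (\<lambda>_. T) {..<n}) (discrete_topology (carrier M)) f}"

definition group_cohomology ::
  "('g, 'r) monoid_scheme \<Rightarrow> 'm monoid \<Rightarrow> ('g \<Rightarrow> 'm \<Rightarrow> 'm) \<Rightarrow> nat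
    \<Rightarrow> ((nat \<Rightarrow> 'g) \<Rightarrow> 'm) set monoid" where
  "group_cohomology G M \<alpha> = cochain_cohomology G M \<alpha> (cochains G M)"

definition continuous_cohomology ::
  "'g topology \<Rightarrow> ('g, 'r) monoid_scheme \<Rightarrow> 'm monoid \<Rightarrow> ('g \<Rightarrow> 'm \<Rightarrow> 'm) \<Rightarrow> nat
    \<Rightarrow> ((nat \<Rightarrow> 'g) \<Rightarrow> 'm) set monoid" where
  "continuous_cohomology T G M \<alpha> = cochain_cohomology G M \<alpha> (continuous_cochains T G M)"


section \<open>Profinite completion\<close>

definition finite_index_normal :: "('g, 'r) monoid_scheme \<Rightarrow> 'g set set" where
  "finite_index_normal G = {N. N \<lhd> G \<and> finite (carrier (G Mod N))}"

text \<open>The inverse limit of the finite quotients \<open>G Mod N\<close>.  For \<open>N \<subseteq> K\<close> the transition map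
  \<open>G Mod N \<rightarrow> G Mod K\<close> sends a coset of \<open>N\<close> to the coset of \<open>K\<close> containing it.\<close>

definition profinite_completion :: "('g, 'r) monoid_scheme \<Rightarrow> ('g set \<Rightarrow> 'g set) monoid" where
  "profinite_completion G =
    (product_group (finite_index_normal G) (\<lambda>N. G Mod N))
      \<lparr>carrier := {x \<in> carrier (product_group (finite_index_normal G) (\<lambda>N. G Mod N)).
         \<forall>N\<in>finite_index_normal G. \<forall>K\<in>finite_index_normal G. N \<subseteq> K \<longrightarrow> x N \<subseteq> x K}\<rparr>"

definition profinite_topology :: "('g, 'r) monoid_scheme \<Rightarrow> ('g set \<Rightarrow> 'g set) topology" where
  "profinite_topology G =
    subtopology
      (product_topology (\<lambda>N. discrete_topology (carrier (G Mod N))) (finite_index_normal G))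
      (carrier (profinite_completion G))"

definition to_completion :: "('g, 'r) monoid_scheme \<Rightarrow> 'g \<Rightarrow> 'g set \<Rightarrow> 'g set" where
  "to_completion G g = (\<lambda>N\<in>finite_index_normal G. N #>\<^bsub>G\<^esub> g)"

text \<open>The continuous extension to the completion of an action \<open>\<alpha>\<close> on a finite \<open>M\<close>: the kernel of \<open>\<alpha>\<close> has
  finite index, and \<open>\<alpha>\<close> is constant on each of its cosets.\<close>

definition completion_action ::
  "('g, 'r) monoid_scheme \<Rightarrow> 'm monoid \<Rightarrow> ('g \<Rightarrow> 'm \<Rightarrow> 'm) \<Rightarrow> ('g set \<Rightarrow> 'g set) \<Rightarrow> 'm \<Rightarrow> 'm" where
  "completion_action G M \<alpha> x = the_elem (\<alpha> ` x (kernel G (AutoGroup M) \<alpha>))"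


section \<open>Goodness\<close>

definition cochain_pullback ::
  "('g, 'r) monoid_scheme \<Rightarrow> ('g \<Rightarrow> 'h) \<Rightarrow> nat \<Rightarrow> ((nat \<Rightarrow> 'h) \<Rightarrow> 'm) \<Rightarrow> (nat \<Rightarrow> 'g) \<Rightarrow> 'm" where
  "cochain_pullback G h n f = (\<lambda>g\<in>tuples n (carrier G). f (\<lambda>j\<in>{..<n}. h (g j)))"

text \<open>The map \<open>H\<^sup>n(completion, M) \<rightarrow> H\<^sup>n(G, M)\<close>.  A cohomology class is a coset of coboundaries; its
  pullback lies in a single coset of the coboundaries of \<open>G\<close>, which the product with these fills up.\<close>

definition completion_cohomology_map ::
  "('g, 'r) monoid_scheme \<Rightarrow> 'm monoid \<Rightarrow> ('g \<Rightarrow> 'm \<Rightarrow> 'm) \<Rightarrow> nat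
    \<Rightarrow> ((nat \<Rightarrow> 'g set \<Rightarrow> 'g set) \<Rightarrow> 'm) set \<Rightarrow> ((nat \<Rightarrow> 'g) \<Rightarrow> 'm) set" where
  "completion_cohomology_map G M \<alpha> n c =
    coboundaries G M \<alpha> (cochains G M) n
      <#>\<^bsub>cochain_group G M n\<^esub> cochain_pullback G (to_completion G) n ` c"

text \<open>The type argument is the type carrying the coefficient modules.  A statement about
  \<open>good TYPE('m) G\<close> for an arbitrary type \<open>'m\<close> thus covers all modules.\<close>

definition p_good :: "'m itself \<Rightarrow> nat \<Rightarrow> ('g, 'r) monoid_scheme \<Rightarrow> bool" where
  "p_good _ p G \<longleftrightarrow>
    (\<forall>(M :: 'm monoid) \<alpha> n.
       group_module G M \<alpha> \<and> finite (carrier M) \<and> primary_group p M \<longrightarrow>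
       completion_cohomology_map G M \<alpha> n \<in>
         iso (continuous_cohomology (profinite_topology G) (profinite_completion G) M
                (completion_action G M \<alpha>) n)
             (group_cohomology G M \<alpha> n))"

definition good :: "'m itself \<Rightarrow> ('g, 'r) monoid_scheme \<Rightarrow> bool" where
  "good m G \<longleftrightarrow> (\<forall>p. prime p \<longrightarrow> p_good m p G)"

end

theory Submission
  imports Defs "HOL-Library.Function_Algebras" "HOL-Algebra.Free_Abelian_Groups"
begin

text \<open>The argument works for every finite coefficient module \<open>A\<close>.  The continuous
  cochains of the completion are the locally constant cochains of \<open>G\<close>, those that factor
  through a finite quotient.  So goodness means that every cochain of positive degree with locally constant
  coboundary is the product of a locally constant cochain and a coboundary.  Consider the double complex of
  the cochains of \<open>G\<close> with values in the functions of \<open>q\<close> variables in \<open>G /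
  N\<close>, for varying \<open>N\<close> of finite index, and its subcomplex of locally constant cochains.
  Its rows are contractible, and a shift along it reduces the claim to the following, for \<open>q \<ge>
  1\<close>: every cocycle of positive degree becomes a coboundary when \<open>N\<close> is replaced by a
  smaller subgroup.

  In degree 1, a cocycle with finite coefficients factors through a finite quotient.  Degrees above 2 vanish
  by the same shift: let the height be the homomorphism to the integers with \<open>t \<mapsto> 1\<close>
  and \<open>x\<^sub>i \<mapsto> 0\<close>; the boundary map on the 2-cells of the presentation complex is
  injective, since in a 2-chain a cell of lowest height has an edge that no other cell of the chain
  contains.  In degree 2, a cocycle is a coboundary as soon as an equation \<open>u = \<rho> + T u\<close>
  is solvable, where \<open>T\<close> is an endomorphism of a finite group.  A periodic orbit of \<open>u
  \<mapsto> \<rho> + T u\<close>, spread out over the heights modulo its period, is a solution over a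
  smaller \<open>N\<close>.\<close>

text \<open>The endomorphism may have a kernel, so the \<open>x_i\<close> need not generate a free
  subgroup and the Mayer-Vietoris sequence of a splitting over a free group is not at hand. The
  presentation complex replaces it: the height argument only sees on which level the letters of a
  relator lie. \<Gamma> may also have few finite quotients, so the smaller subgroups on which
  classes die must be constructed. Apart from intersections they all come from
  \<open>finite_congruence\<close>, applied to maps with finite image: the action, the action
  together with a crossed homomorphism, and the height modulo an integer. Degree 2 works because
  \<open>x_i t = t w_i\<close> has a single letter on the lowest level and all of \<open>w_i\<close>
  one level higher. The equation \<open>u = \<rho> + T u\<close> may have no solution in a finite
  group, whereas the recursion \<open>v (z + 1) = \<rho> + T (v z)\<close> always has one, and by
  finiteness a periodic one. A function variable in the coefficients provides the height
  \<open>z\<close>. In the shift, exact columns alone correct a cochain at once; the work lies in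
  keeping the correction \<open>bd\<close>-closed, that is, with values in the module instead of the
  larger function modules.\<close>

section \<open>Double complexes of functions on lists\<close>

text \<open>The coboundary of the augmented simplicial cochain complex: the alternating sum over the
  deletions of one entry, with \<open>del F [x] = F []\<close>. The recursion splits off the
  deletion of the head, so that identities follow by induction on the list without index
  sums.\<close>

primrec del :: "('x list \<Rightarrow> 'a::ab_group_add) \<Rightarrow> 'x list \<Rightarrow> 'a" where
  "del F [] = 0"
| "del F (x # xs) = F xs - del (\<lambda>z. F (x # z)) xs"

declare del.simps(2) [simp del]
lemmas del_Cons = del.simps(2)

lemma del_hom:
  assumes "\<And>a b. h (a - b) = h a - h b"
  shows "del (\<lambda>z. h (F z)) xs = h (del F xs)"
proof (induction xs arbitrary: F)
  case Nil
  show ?case using assms[of 0 0] by simp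
qed (simp add: del_Cons assms)

lemma del_add: "del (\<lambda>z. F z + H z) xs = del F xs + del H xs"
  by (induction xs arbitrary: F H) (simp_all add: del_Cons)

lemma del_diff: "del (\<lambda>z. F z - H z) xs = del F xs - del H xs"
  by (induction xs arbitrary: F H) (simp_all add: del_Cons)

lemma del_zero: "del (\<lambda>z. 0) xs = 0"
  by (induction xs) (simp_all add: del_Cons)

lemma del_fun_add: "del (F + H) = del F + del H"
  using del_add by (auto simp: fun_eq_iff plus_fun_def)

lemma del_fun_diff: "del (F - H) = del F - del H"
  using del_diff by (auto simp: fun_eq_iff fun_diff_def)

lemma del_fun_zero: "del 0 = 0"
  using del_zero by (auto simp: fun_eq_iff zero_fun_def)

lemma del_apply: "del F xs y = del (\<lambda>z. F z y) xs"
  by (induction xs arbitrary: F) (simp_all add: del_Cons)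

lemma del_del: "del (del F) xs = 0"
proof (induction xs arbitrary: F)
  case (Cons x xs)
  have "del (del F) (x # xs) = del F xs - del (\<lambda>z. F z - del (\<lambda>v. F (x # v)) z) xs"
    by (simp add: del_Cons)
  also have "\<dots> = del (del (\<lambda>v. F (x # v))) xs"
    by (simp add: del_diff)
  finally show ?case
    using Cons.IH by simp
qed simp

lemma del_fun_del: "del (del F) = 0"
  by (simp add: fun_eq_iff del_del)

lemma del_commute: "del (\<lambda>v. del (\<lambda>w. H v w) ys) xs = del (\<lambda>w. del (\<lambda>v. H v w) xs) ys"
  by (induction xs arbitrary: H) (simp_all add: del_Cons del_diff del_zero)

lemma del_map: "del F (map f xs) = del (\<lambda>z. F (map f z)) xs"
  by (induction xs arbitrary: F) (simp_all add: del_Cons)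

lemma del_cong_length:
  "(\<And>z. Suc (length z) = length xs \<Longrightarrow> F z = H z) \<Longrightarrow> del F xs = del H xs"
proof (induction xs arbitrary: F H)
  case (Cons x xs)
  have "del (\<lambda>z. F (x # z)) xs = del (\<lambda>z. H (x # z)) xs"
    by (rule Cons.IH) (simp add: Cons.prems)
  then show ?case
    by (simp add: del_Cons Cons.prems)
qed simp

lemma del_supp:
  assumes "\<And>z. length z \<noteq> m \<Longrightarrow> F z = 0" "length xs \<noteq> Suc m"
  shows "del F xs = 0"
proof -
  have "del F xs = del (\<lambda>z. 0) xs"
    by (rule del_cong_length) (use assms in auto)
  then show ?thesis
    by (simp add: del_zero)
qed

lemma del_closed:
  assumes "0 \<in> A" "\<And>a b. a \<in> A \<Longrightarrow> b \<in> A \<Longrightarrow> a - b \<in> A" "\<And>z. F z \<in> A"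
  shows "del F xs \<in> A"
  using assms(3) by (induction xs arbitrary: F) (simp_all add: del_Cons assms)

lemma del_map_cong:
  assumes "\<And>zs zs'. map f zs = map f zs' \<Longrightarrow> F zs = F zs'" "map f xs = map f xs'"
  shows "del F xs = del F xs'"
  using assms
proof (induction xs arbitrary: F xs')
  case (Cons x xs)
  obtain x' ys where xs': "xs' = x' # ys" and x': "f x = f x'" and ys: "map f xs = map f ys"
    using Cons.prems(2) by (cases xs') auto
  have "F xs = F ys"
    by (rule Cons.prems(1) [OF ys])
  moreover have "del (\<lambda>z. F (x # z)) xs = del (\<lambda>z. F (x # z)) ys"
  proof (rule Cons.IH [OF _ ys])
    fix zs zs' :: "'a list"
    assume "map f zs = map f zs'"
    then show "F (x # zs) = F (x # zs')"
      by (intro Cons.prems(1)) simp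
  qed
  moreover have "(\<lambda>z. F (x # z)) = (\<lambda>z. F (x' # z))"
    by (rule ext, rule Cons.prems(1)) (simp add: x')
  ultimately show ?case
    by (simp add: xs' del_Cons)
qed simp

text \<open>Since \<open>del\<close> is polymorphic in its values, \<open>del F\<close> for a
  cochain \<open>F\<close> with function values already acts on the first list; \<open>bd\<close>
  acts on the second. The two differentials commute, without the usual sign twist.\<close>

definition bd :: "('x list \<Rightarrow> 'y list \<Rightarrow> 'a::ab_group_add) \<Rightarrow> 'x list \<Rightarrow> 'y list \<Rightarrow> 'a" where
  "bd F gs = del (F gs)"

lemma bd_diff: "bd (F - H) = bd F - bd H"
  by (simp add: fun_eq_iff bd_def del_fun_diff)

lemma bd_zero: "bd 0 = 0"
  by (simp add: fun_eq_iff bd_def del_fun_zero)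

lemma bd_bd: "bd (bd F) = 0"
  by (simp add: fun_eq_iff bd_def del_del)

lemma bd_del: "bd (del F) = del (bd F)"
proof (intro ext)
  fix gs ys
  have "bd (del F) gs ys = del (\<lambda>v. del (\<lambda>w. F w v) gs) ys"
  proof -
    have "del F gs = (\<lambda>v. del (\<lambda>w. F w v) gs)"
      by (rule ext) (rule del_apply)
    then show ?thesis
      by (simp only: bd_def)
  qed
  also have "\<dots> = del (\<lambda>w. del (\<lambda>v. F w v) ys) gs"
    by (rule del_commute)
  also have "\<dots> = del (bd F) gs ys"
    unfolding del_apply [of "bd F"] by (simp only: bd_def)
  finally show "bd (del F) gs ys = del (bd F) gs ys" .
qed

text \<open>\<open>K\<close> is the full double complex and \<open>L\<close> the subcomplex;
  \<open>del\<close> lowers to exactness in the columns, \<open>bd\<close> in the rows. Without the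
  clause \<open>bd H = 0\<close> the two column hypotheses would suffice. The defect of closedness
  is an element of the same kind with one variable less in the first list and one more in the
  second, so the induction runs over \<open>m\<close> with \<open>q\<close> arbitrary and ends at
  \<open>m0\<close>.\<close>

lemma double_complex_shift:
  fixes K L :: "nat \<Rightarrow> nat \<Rightarrow> ('x list \<Rightarrow> 'y list \<Rightarrow> 'a::ab_group_add) \<Rightarrow> bool"
  assumes LK: "\<And>m q F. L m q F \<Longrightarrow> K m q F"
    and K_diff: "\<And>m q F H. K m q F \<Longrightarrow> K m q H \<Longrightarrow> K m q (F - H)"
    and L_diff: "\<And>m q F H. L m q F \<Longrightarrow> L m q H \<Longrightarrow> L m q (F - H)"
    and L_zero: "\<And>m q. L m q 0"
    and K_del: "\<And>m q F. K m q F \<Longrightarrow> K (Suc m) q (del F)"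
    and L_del: "\<And>m q F. L m q F \<Longrightarrow> L (Suc m) q (del F)"
    and K_bd: "\<And>m q F. K m q F \<Longrightarrow> K m (Suc q) (bd F)"
    and L_bd: "\<And>m q F. L m q F \<Longrightarrow> L m (Suc q) (bd F)"
    and K_fill: "\<And>m q F. K m (Suc q) F \<Longrightarrow> bd F = 0 \<Longrightarrow> \<exists>H. K m q H \<and> bd H = F"
    and L_fill: "\<And>m q F. L m (Suc q) F \<Longrightarrow> bd F = 0 \<Longrightarrow> \<exists>H. L m q H \<and> bd H = F"
    and L_exact: "\<And>m q F. q \<ge> 1 \<Longrightarrow> m \<ge> 1 \<Longrightarrow> L (Suc m) q F \<Longrightarrow> del F = 0 \<Longrightarrow> \<exists>H. L m q H \<and> del H = F"
    and K_exact: "\<And>m q F. q \<ge> 1 \<Longrightarrow> m > m0 \<Longrightarrow> K m q F \<Longrightarrow> del F = 0 \<Longrightarrow> \<exists>H. K (m - 1) q H \<and> del H = F"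
    and m0: "m0 \<ge> 1"
    and base: "\<And>q F. q \<ge> 2 \<Longrightarrow> K m0 q F \<Longrightarrow> bd F = 0 \<Longrightarrow> L (Suc m0) q (del F) \<Longrightarrow>
      \<exists>H. K (m0 - 1) q H \<and> bd H = 0 \<and> L m0 q (F - del H)"
  shows "m > m0 \<Longrightarrow> q \<ge> 1 \<Longrightarrow> K m q F \<Longrightarrow> bd F = 0 \<Longrightarrow> L (Suc m) q (del F) \<Longrightarrow>
      \<exists>H. K (m - 1) q H \<and> bd H = 0 \<and> L m q (F - del H)"
proof (induction m arbitrary: q F)
  case (Suc m)
  obtain e where e: "L (Suc m) q e" "del e = del F"
    using L_exact [OF \<open>q \<ge> 1\<close> _ Suc.prems(5) del_fun_del] by auto
  have Fe: "K (Suc m) q (F - e)"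
    by (rule K_diff [OF Suc.prems(3) LK [OF e(1)]])
  have "del (F - e) = 0"
    unfolding del_fun_diff e(2) by (rule diff_self)
  from K_exact [OF \<open>q \<ge> 1\<close> \<open>Suc m > m0\<close> Fe this]
  obtain g where g: "K m q g" "del g = F - e"
    unfolding diff_Suc_1 by (elim exE conjE)
  \<comment> \<open>Already \<open>F - del g = e\<close> lies in \<open>L\<close>, but
    \<open>g\<close> need not be closed. Its defect \<open>bd g\<close> meets the hypotheses one row
    further: as \<open>bd F = 0\<close>, its \<open>del\<close> is \<open>- bd e\<close>, which lies
    in \<open>L\<close>.\<close>
  have 1: "K m (Suc q) (bd g)" and 2: "bd (bd g) = 0"
    by (rule K_bd [OF g(1)]) (rule bd_bd)
  have "L (Suc m) (Suc q) (0 - bd e)"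
    by (intro L_diff L_zero L_bd e)
  moreover have "0 - bd e = del (bd g)"
    unfolding bd_del [symmetric] g bd_diff Suc.prems(4) ..
  ultimately have 3: "L (Suc m) (Suc q) (del (bd g))"
    by (simp only:)
  have "\<exists>h. K (m - 1) (Suc q) h \<and> bd h = 0 \<and> L m (Suc q) (bd g - del h)"
  proof (cases "m = m0")
    case True
    show ?thesis
      unfolding True
      by (rule base [OF _ 1 [unfolded True] 2 3 [unfolded True]]) (use \<open>q \<ge> 1\<close> in linarith)
  next
    case False
    then have "m > m0"
      using \<open>Suc m > m0\<close> by linarith
    then show ?thesis
      by (rule Suc.IH [OF _ _ 1 2 3]) linarith
  qed
  then obtain h where h: "K (m - 1) (Suc q) h" "bd h = 0" "L m (Suc q) (bd g - del h)"
    by blast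
  obtain h' where h': "K (m - 1) q h'" "bd h' = h"
    using K_fill [OF h(1,2)] by blast
  have "bd (bd g - del h) = 0"
    unfolding bd_diff bd_bd bd_del h del_fun_zero by simp
  then obtain l where l: "L m q l" "bd l = bd g - del h"
    using L_fill [OF h(3)] by blast
  have m: "Suc (m - 1) = m"
    using \<open>Suc m > m0\<close> m0 by linarith
  \<comment> \<open>The correction \<open>l + del h'\<close> has the same \<open>bd\<close> as
    \<open>g\<close>. Subtracting it changes \<open>del g\<close> only by \<open>del l\<close>,
    which lies in \<open>L\<close>, because \<open>del (del h') = 0\<close>.\<close>
  have "K m q (del h')"
    using K_del [OF h'(1)] m by simp
  then have "K m q (g - l - del h')"
    using K_diff [OF K_diff [OF g(1) LK [OF l(1)]]] by blast
  moreover have "bd (g - l - del h') = 0"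
    unfolding bd_diff l bd_del h' by simp
  moreover have "F - del (g - l - del h') = e - (0 - del l)"
    unfolding del_fun_diff g del_fun_del by simp
  moreover have "L (Suc m) q (e - (0 - del l))"
    using L_diff [OF e(1) L_diff [OF L_zero L_del [OF l(1)]]] .
  ultimately have "K m q (g - l - del h') \<and> bd (g - l - del h') = 0 \<and>
      L (Suc m) q (F - del (g - l - del h'))"
    by (simp only: simp_thms)
  then show ?case
    unfolding diff_Suc_1 by (rule exI [where x = "g - l - del h'"])
qed simp

section \<open>Groups and modules with total operations\<close>

context group
begin

text \<open>Elements of the type outside the carrier are identified with the identity, so that
  multiplication becomes total and associative and identities of cochains hold for all lists.\<close>

definition rr :: "'a \<Rightarrow> 'a" where
  "rr x = (if x \<in> carrier G then x else \<one>)"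

definition mul :: "'a \<Rightarrow> 'a \<Rightarrow> 'a" (infixl "\<odot>" 70) where
  "x \<odot> y = rr x \<otimes> rr y"

definition iv :: "'a \<Rightarrow> 'a" where
  "iv x = inv (rr x)"

definition cl :: "'a set \<Rightarrow> 'a \<Rightarrow> 'a set" where
  "cl N x = N #> rr x"

lemma rr_closed [simp]: "rr x \<in> carrier G"
  by (simp add: rr_def)

lemma rr_id [simp]: "x \<in> carrier G \<Longrightarrow> rr x = x"
  by (simp add: rr_def)

lemma mul_closed [simp]: "x \<odot> y \<in> carrier G"
  by (simp add: mul_def)

lemma iv_closed [simp]: "iv x \<in> carrier G"
  by (simp add: iv_def)

lemma mul_rr [simp]: "rr x \<odot> y = x \<odot> y" "x \<odot> rr y = x \<odot> y"
  by (simp_all add: mul_def)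

lemma iv_rr [simp]: "iv (rr x) = iv x"
  by (simp add: iv_def)

lemma mul_assoc: "x \<odot> y \<odot> z = x \<odot> (y \<odot> z)"
  by (simp add: mul_def m_assoc)

lemma mul_one [simp]: "\<one> \<odot> x = rr x" "x \<odot> \<one> = rr x"
  by (simp_all add: mul_def)

lemma mul_iv [simp]: "iv x \<odot> x = \<one>" "x \<odot> iv x = \<one>"
  by (simp_all add: mul_def iv_def)

lemma mul_iv_cancel [simp]: "iv x \<odot> (x \<odot> y) = rr y" "x \<odot> (iv x \<odot> y) = rr y"
  by (simp_all add: mul_assoc [symmetric])

lemma mul_comp: "(\<odot>) x \<circ> (\<odot>) y = (\<odot>) (x \<odot> y)"
  by (simp add: fun_eq_iff mul_assoc)

lemma iv_mul: "iv (x \<odot> y) = iv y \<odot> iv x"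
  by (simp add: iv_def mul_def inv_mult_group)

lemma iv_one [simp]: "iv \<one> = \<one>"
  by (simp add: iv_def)

lemma iv_iv [simp]: "iv (iv x) = rr x"
  by (simp add: iv_def)

lemma cl_rr [simp]: "cl N (rr x) = cl N x"
  by (simp add: cl_def)

lemma cl_mul:
  assumes "N \<lhd> G" "cl N x = cl N x'" "cl N y = cl N y'"
  shows "cl N (x \<odot> y) = cl N (x' \<odot> y')"
proof -
  interpret normal N G by fact
  have "cl N (x \<odot> y) = cl N x <#> cl N y" for x y
    by (simp add: cl_def mul_def rcos_sum)
  then show ?thesis
    using assms by simp
qed

lemma cl_iv:
  assumes "N \<lhd> G" "cl N x = cl N x'"
  shows "cl N (iv x) = cl N (iv x')"
proof -
  interpret normal N G by fact
  have "cl N (iv x) = set_inv (cl N x)" for x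
    by (simp add: cl_def iv_def rcos_inv)
  then show ?thesis
    using assms by simp
qed

lemma cl_mono:
  assumes "subgroup N G" "subgroup N' G" "N \<subseteq> N'" "cl N x = cl N y"
  shows "cl N' x = cl N' y"
proof -
  have "rr x \<in> N #> rr y"
    using assms rcos_self [OF rr_closed assms(1), of x] by (simp add: cl_def)
  then have "rr x \<in> N' #> rr y"
    using assms(3) by (auto simp: r_coset_def)
  then show ?thesis
    using repr_independence [OF _ _ assms(2)] by (simp add: cl_def)
qed

lemma cl_eq_iff:
  assumes "subgroup N G"
  shows "cl N x = cl N y \<longleftrightarrow> x \<odot> iv y \<in> N"
proof
  assume "cl N x = cl N y"
  then have "rr x \<in> N #> rr y"
    using rcos_self [OF rr_closed assms, of x] by (simp add: cl_def)
  then obtain n where n: "n \<in> N" "rr x = n \<otimes> rr y"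
    by (auto simp: r_coset_def)
  have "n \<in> carrier G"
    using n assms subgroup.mem_carrier by fast
  with n show "x \<odot> iv y \<in> N"
    by (simp add: mul_def iv_def m_assoc)
next
  assume *: "x \<odot> iv y \<in> N"
  have "rr x = x \<odot> iv y \<otimes> rr y"
    by (simp add: mul_def iv_def m_assoc)
  with * have "rr x \<in> N #> rr y"
    by (auto simp: r_coset_def)
  then show "cl N x = cl N y"
    using repr_independence [OF _ _ assms] by (simp add: cl_def)
qed

lemma cl_trivial: "cl {\<one>} x = cl {\<one>} y \<longleftrightarrow> rr x = rr y"
  by (auto simp: cl_def r_coset_def)

lemma finite_index_normal_normal: "N \<in> finite_index_normal G \<Longrightarrow> N \<lhd> G"
  by (simp add: finite_index_normal_def)

lemma finite_index_normal_subgroup: "N \<in> finite_index_normal G \<Longrightarrow> subgroup N G"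
  using finite_index_normal_normal normal_imp_subgroup by blast

text \<open>\<open>f\<close> need not be a homomorphism: if elements with the same value lie in the
  same coset, the number of values bounds the number of cosets.\<close>

lemma finite_index_normalI:
  assumes N: "N \<lhd> G" and fin: "finite (f ` carrier G)"
    and f: "\<And>x y. x \<in> carrier G \<Longrightarrow> y \<in> carrier G \<Longrightarrow> f x = f y \<Longrightarrow> x \<odot> iv y \<in> N"
  shows "N \<in> finite_index_normal G"
proof -
  have sub: "subgroup N G"
    using N by (rule normal_imp_subgroup)
  define r where "r v = (SOME x. x \<in> carrier G \<and> f x = v)" for v
  have "N #> x = N #> r (f x)" if "x \<in> carrier G" for x
  proof -
    have *: "r (f x) \<in> carrier G \<and> f (r (f x)) = f x"
      unfolding r_def by (rule someI [where x = x]) (use that in simp)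
    then have "x \<odot> iv (r (f x)) \<in> N"
      by (intro f) (simp_all add: that)
    then have "cl N x = cl N (r (f x))"
      by (simp only: cl_eq_iff [OF sub])
    then show ?thesis
      using that * by (simp add: cl_def)
  qed
  then have "carrier (G Mod N) \<subseteq> (\<lambda>v. N #> r v) ` (f ` carrier G)"
    by (auto simp: FactGroup_def RCOSETS_def)
  then have "finite (carrier (G Mod N))"
    using fin finite_surj by blast
  with N show ?thesis
    by (simp add: finite_index_normal_def)
qed

lemma finite_cl:
  assumes "N \<in> finite_index_normal G"
  shows "finite (range (cl N))"
proof -
  have "range (cl N) \<subseteq> carrier (G Mod N)"
    by (auto simp: cl_def FactGroup_def RCOSETS_def intro: bexI [OF _ rr_closed])
  then show ?thesis
    using assms finite_subset by (auto simp: finite_index_normal_def)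
qed

lemma finite_index_normal_Int:
  assumes "N \<in> finite_index_normal G" "N' \<in> finite_index_normal G"
  shows "N \<inter> N' \<in> finite_index_normal G"
proof (rule finite_index_normalI)
  show "N \<inter> N' \<lhd> G"
    by (intro normal_subgroup_intersect finite_index_normal_normal assms)
  show "finite ((\<lambda>x. (cl N x, cl N' x)) ` carrier G)"
  proof (rule finite_subset)
    show "(\<lambda>x. (cl N x, cl N' x)) ` carrier G \<subseteq> range (cl N) \<times> range (cl N')"
      by auto
    show "finite (range (cl N) \<times> range (cl N'))"
      by (intro finite_cartesian_product finite_cl assms)
  qed
  show "x \<odot> iv y \<in> N \<inter> N'" if "(cl N x, cl N' x) = (cl N y, cl N' y)" for x y
    using that by (simp add: cl_eq_iff [OF finite_index_normal_subgroup] assms)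
qed

lemma finite_index_normal_UNIV: "carrier G \<in> finite_index_normal G"
  by (rule finite_index_normalI [where f = "\<lambda>_. ()"]) (auto simp: normal_self)

lemma map_cl_mono:
  assumes "subgroup N G" "subgroup N' G" "N \<subseteq> N'" "map (cl N) xs = map (cl N) ys"
  shows "map (cl N') xs = map (cl N') ys"
  using assms(4) by (auto simp: list_eq_iff_nth_eq intro!: cl_mono [OF assms(1-3)])

lemma map_cl_mul:
  assumes "N \<lhd> G" "map (cl N) xs = map (cl N) ys" "cl N g = cl N h"
  shows "map (cl N) (map ((\<odot>) g) xs) = map (cl N) (map ((\<odot>) h) ys)"
  using assms(2) by (auto simp: list_eq_iff_nth_eq intro!: cl_mul [OF assms(1,3)])

lemma map_mul_one: "map ((\<odot>) \<one>) ys = map rr ys"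
  by simp

end

text \<open>The laws hold on the whole type where possible, to avoid membership conditions. Only
  \<open>act_one\<close> is restricted to \<open>A\<close>: in the application the action on the
  ambient type first projects to the module, so the identity element acts as that
  projection.\<close>

locale gmod = group G for G :: "('g, 'r) monoid_scheme" (structure) +
  fixes A :: "'a::ab_group_add set" and act :: "'g \<Rightarrow> 'a \<Rightarrow> 'a"
  assumes A_zero [simp]: "0 \<in> A"
    and A_diff: "a \<in> A \<Longrightarrow> b \<in> A \<Longrightarrow> a - b \<in> A"
    and act_closed: "a \<in> A \<Longrightarrow> act g a \<in> A"
    and act_diff: "act g (a - b) = act g a - act g b"
    and act_mul: "act (g \<odot> h) a = act g (act h a)"
    and act_one: "a \<in> A \<Longrightarrow> act \<one> a = a"
begin

lemma act_zero [simp]: "act g 0 = 0"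
  using act_diff [of g 0 0] by simp

lemma act_minus: "act g (- a) = - act g a"
  using act_diff [of g 0 a] by simp

lemma act_add: "act g (a + b) = act g a + act g b"
  using act_diff [of g a "- b"] by (simp add: act_minus)

lemma A_minus: "a \<in> A \<Longrightarrow> - a \<in> A"
  using A_diff [of 0 a] by simp

lemma A_add: "a \<in> A \<Longrightarrow> b \<in> A \<Longrightarrow> a + b \<in> A"
  using A_diff [of a "- b"] A_minus by simp

lemma act_rr: "a \<in> A \<Longrightarrow> act (rr g) a = act g a"
  using act_mul [of g \<one> a] act_one by simp

lemma act_iv [simp]: "a \<in> A \<Longrightarrow> act (iv g) (act g a) = a" "a \<in> A \<Longrightarrow> act g (act (iv g) a) = a"
  by (simp_all add: act_mul [symmetric] act_one)

lemma del_A: "(\<And>z. F z \<in> A) \<Longrightarrow> del F xs \<in> A"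
  by (rule del_closed) (auto intro: A_diff)

lemma del_act: "del (\<lambda>z. act g (F z)) xs = act g (del F xs)"
  by (rule del_hom) (rule act_diff)

end

text \<open>Homogeneous cochains; those in \<open>m\<close> variables have degree \<open>m - 1\<close>.\<close>

definition (in group) coch ::
  "'m set \<Rightarrow> ('a \<Rightarrow> 'm \<Rightarrow> 'm) \<Rightarrow> nat \<Rightarrow> ('a list \<Rightarrow> 'm::ab_group_add) \<Rightarrow> bool" where
  "coch A act m F \<longleftrightarrow> (\<forall>gs. length gs \<noteq> m \<longrightarrow> F gs = 0) \<and> (\<forall>gs. F gs \<in> A) \<and>
    (\<forall>g gs. F (map ((\<odot>) g) gs) = act g (F gs))"

definition factors_through :: "('x \<Rightarrow> 'y) \<Rightarrow> ('x \<Rightarrow> 'z) \<Rightarrow> bool" where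
  "factors_through f h \<longleftrightarrow> (\<forall>x y. f x = f y \<longrightarrow> h x = h y)"

lemma factors_throughI: "(\<And>x y. f x = f y \<Longrightarrow> h x = h y) \<Longrightarrow> factors_through f h"
  unfolding factors_through_def by (intro allI impI)

lemma factors_throughD: "factors_through f h \<Longrightarrow> f x = f y \<Longrightarrow> h x = h y"
  unfolding factors_through_def by (elim allE impE)

context group
begin

lemma coch_supp: "coch A act m F \<Longrightarrow> length gs \<noteq> m \<Longrightarrow> F gs = 0"
  by (simp add: coch_def)

lemma coch_A: "coch A act m F \<Longrightarrow> F gs \<in> A"
  by (simp add: coch_def)

lemma coch_equiv: "coch A act m F \<Longrightarrow> F (map ((\<odot>) g) gs) = act g (F gs)"
  by (simp add: coch_def)

text \<open>With the action \<open>actf\<close> the set \<open>fm A q N\<close> of functions of \<open>q\<close> variables is a coinduced module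
  for \<open>q \<ge> 1\<close>.\<close>

definition fm :: "'m set \<Rightarrow> nat \<Rightarrow> 'a set \<Rightarrow> ('a list \<Rightarrow> 'm::ab_group_add) set" where
  "fm A q N = {\<phi>. (\<forall>ys. length ys \<noteq> q \<longrightarrow> \<phi> ys = 0) \<and> (\<forall>ys. \<phi> ys \<in> A) \<and>
     factors_through (map (cl N)) \<phi>}"

definition actf :: "('a \<Rightarrow> 'm \<Rightarrow> 'm) \<Rightarrow> 'a \<Rightarrow> ('a list \<Rightarrow> 'm) \<Rightarrow> 'a list \<Rightarrow> 'm" where
  "actf act g \<phi> ys = act g (\<phi> (map ((\<odot>) (iv g)) ys))"

lemma fm_supp: "\<phi> \<in> fm A q N \<Longrightarrow> length ys \<noteq> q \<Longrightarrow> \<phi> ys = 0"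
  by (simp add: fm_def)

lemma fm_A: "\<phi> \<in> fm A q N \<Longrightarrow> \<phi> ys \<in> A"
  by (simp add: fm_def)

lemma fm_cl: "\<phi> \<in> fm A q N \<Longrightarrow> map (cl N) ys = map (cl N) ys' \<Longrightarrow> \<phi> ys = \<phi> ys'"
  by (rule factors_throughD [of "map (cl N)" \<phi>]) (simp_all add: fm_def)

lemma fmI:
  assumes "\<And>ys. length ys \<noteq> q \<Longrightarrow> \<phi> ys = 0" "\<And>ys. \<phi> ys \<in> A"
    "\<And>ys ys'. map (cl N) ys = map (cl N) ys' \<Longrightarrow> \<phi> ys = \<phi> ys'"
  shows "\<phi> \<in> fm A q N"
proof -
  have "factors_through (map (cl N)) \<phi>"
    using assms(3) by (rule factors_throughI)
  then show ?thesis
    by (simp add: fm_def assms(1,2))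
qed

lemma fm_rr: "\<phi> \<in> fm A q N \<Longrightarrow> \<phi> (map rr ys) = \<phi> ys"
  by (erule fm_cl) simp

lemma fm_mono:
  assumes "subgroup N G" "subgroup N' G" "N' \<subseteq> N" "\<phi> \<in> fm A q N"
  shows "\<phi> \<in> fm A q N'"
proof (rule fmI)
  show "\<phi> ys = \<phi> ys'" if "map (cl N') ys = map (cl N') ys'" for ys ys'
    by (rule fm_cl [OF assms(4) map_cl_mono [OF assms(2,1,3) that]])
qed (simp_all add: fm_supp [OF assms(4)] fm_A [OF assms(4)])

lemma actf_equiv: "actf act g \<phi> (map ((\<odot>) g) ys) = act g (\<phi> (map rr ys))"
  by (simp add: actf_def o_def)

end

context gmod
begin

lemma coch_0: "coch A act m 0"
  unfolding coch_def zero_fun_apply by simp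

lemma coch_diff: "coch A act m F \<Longrightarrow> coch A act m H \<Longrightarrow> coch A act m (F - H)"
  unfolding coch_def fun_diff_def by (simp add: A_diff act_diff)

lemma coch_del:
  assumes "coch A act m F"
  shows "coch A act (Suc m) (del F)"
  unfolding coch_def
proof (intro conjI allI impI)
  show "del F gs = 0" if "length gs \<noteq> Suc m" for gs
    using coch_supp [OF assms] that by (rule del_supp)
  show "del F gs \<in> A" for gs
    using coch_A [OF assms] by (rule del_A)
  show "del F (map ((\<odot>) g) gs) = act g (del F gs)" for g gs
    by (simp add: del_map coch_equiv [OF assms] del_act)
qed

lemma coch_rr:
  assumes "coch A act m F"
  shows "F (map rr gs) = F gs"
  using coch_equiv [OF assms, of \<one> gs] act_one [OF coch_A [OF assms], of gs]
  unfolding map_mul_one by (rule HOL.trans)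

lemma coch_cong:
  assumes "coch A act m F" "map rr gs = map rr gs'"
  shows "F gs = F gs'"
proof -
  have "F gs = F (map rr gs)" "F (map rr gs') = F gs'"
    by (simp_all only: coch_rr [OF assms(1)])
  then show ?thesis
    unfolding assms(2) by (rule HOL.trans)
qed

text \<open>The action is diagonal, on the values and on the variables. Normality of
  \<open>N\<close> makes left translation compatible with the right cosets through which the
  functions factor.\<close>

lemma gmod_fm:
  assumes N: "N \<lhd> G"
  shows "gmod G (fm A q N) (actf act)"
proof (intro gmod.intro gmod_axioms.intro group_axioms)
  show "0 \<in> fm A q N"
    by (rule fmI) simp_all
  show "a - b \<in> fm A q N" if "a \<in> fm A q N" "b \<in> fm A q N" for a b
  proof (rule fmI)
    show "(a - b) ys = (a - b) ys'" if "map (cl N) ys = map (cl N) ys'" for ys ys'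
      using fm_cl [OF \<open>a \<in> _\<close> that] fm_cl [OF \<open>b \<in> _\<close> that] by simp
  qed (simp_all add: fm_supp [OF that(1)] fm_supp [OF that(2)] fm_A [OF that(1)] fm_A [OF that(2)] A_diff)
  show "actf act g a \<in> fm A q N" if "a \<in> fm A q N" for g a
  proof (rule fmI)
    show "actf act g a ys = actf act g a ys'" if "map (cl N) ys = map (cl N) ys'" for ys ys'
      unfolding actf_def
      by (rule arg_cong [where f = "act g"], rule fm_cl [OF \<open>a \<in> _\<close>], rule map_cl_mul [OF N that HOL.refl])
  qed (simp_all add: actf_def fm_supp [OF \<open>a \<in> _\<close>] act_closed fm_A [OF \<open>a \<in> _\<close>])
  show "actf act g (a - b) = actf act g a - actf act g b" for g a b
    by (simp add: fun_eq_iff actf_def act_diff)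
  show "actf act (g \<odot> h) a = actf act g (actf act h a)" for g h a
    by (simp add: fun_eq_iff actf_def act_mul iv_mul mul_comp)
  show "actf act \<one> a = a" if "a \<in> fm A q N" for a
    using act_one [OF fm_A [OF that]] fm_rr [OF that] by (simp add: fun_eq_iff actf_def map_mul_one)
qed

lemma actf_del: "actf act g (del \<phi>) = del (actf act g \<phi>)"
  by (simp add: fun_eq_iff actf_def [abs_def] del_map del_act o_def)

lemma del_fm:
  assumes "\<phi> \<in> fm A q N"
  shows "del \<phi> \<in> fm A (Suc q) N"
proof (rule fmI)
  show "del \<phi> ys = 0" if "length ys \<noteq> Suc q" for ys
    using fm_supp [OF assms] that by (rule del_supp)
  show "del \<phi> ys \<in> A" for ys
    using fm_A [OF assms] by (rule del_A)
  show "del \<phi> ys = del \<phi> ys'" if "map (cl N) ys = map (cl N) ys'" for ys ys'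
    using fm_cl [OF assms] that by (rule del_map_cong)
qed

lemma coch_bd:
  assumes "coch (fm A q N) (actf act) m F"
  shows "coch (fm A (Suc q) N) (actf act) m (bd F)"
  unfolding coch_def
proof (intro conjI allI impI)
  show "bd F gs = 0" if "length gs \<noteq> m" for gs
    using coch_supp [OF assms that] by (simp add: bd_def del_fun_zero)
  show "bd F gs \<in> fm A (Suc q) N" for gs
    unfolding bd_def by (rule del_fm, rule coch_A [OF assms])
  show "bd F (map ((\<odot>) g) gs) = actf act g (bd F gs)" for g gs
    by (simp add: bd_def coch_equiv [OF assms] actf_del)
qed

lemma coch_fm_mono:
  assumes "subgroup N G" "subgroup N' G" "N' \<subseteq> N" "coch (fm A q N) (actf act) m F"
  shows "coch (fm A q N') (actf act) m F"
  using assms(4) by (auto simp: coch_def intro: fm_mono [OF assms(1-3)])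

text \<open>In this form the group variables and the function variables are on an equal footing,
  which is what allows a variable to be copied from one list to the other.\<close>

lemma coch_fm_equiv:
  assumes "coch (fm A q N) (actf act) m F"
  shows "F (map ((\<odot>) g) gs) (map ((\<odot>) g) ys) = act g (F gs ys)"
  using fm_rr [OF coch_A [OF assms]] by (simp add: coch_equiv [OF assms] actf_equiv)

end

section \<open>Path sums in the Cayley graph\<close>

locale gens = group G for G :: "('g, 'r) monoid_scheme" (structure) +
  fixes a :: "'x \<Rightarrow> 'g"
  assumes a_closed [simp]: "a x \<in> carrier G"
begin

definition step :: "'g \<Rightarrow> 'x \<times> bool \<Rightarrow> 'g" where
  "step p l = p \<odot> (if snd l then a (fst l) else iv (a (fst l)))"

primrec walk :: "'g \<Rightarrow> 'x word \<Rightarrow> 'g" where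
  "walk p [] = p"
| "walk p (l # w) = walk (step p l) w"

text \<open>The sum of the edge weights \<open>e\<close> along the path in the Cayley graph that starts at \<open>p\<close> and
  reads the word; the edge of the generator \<open>x\<close> starting at \<open>p\<close> has weight \<open>e p x\<close>.\<close>

primrec psum :: "('g \<Rightarrow> 'x \<Rightarrow> 'a::ab_group_add) \<Rightarrow> 'g \<Rightarrow> 'x word \<Rightarrow> 'a" where
  "psum e p [] = 0"
| "psum e p (l # w) = (if snd l then e p (fst l) else - e (step p l) (fst l)) + psum e (step p l) w"

lemma step_closed [simp]: "step p l \<in> carrier G"
  by (simp add: step_def)

lemma walk_closed [simp]: "p \<in> carrier G \<Longrightarrow> walk p w \<in> carrier G"
  by (induction w arbitrary: p) simp_all

lemma walk_append: "walk p (u @ v) = walk (walk p u) v"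
  by (induction u arbitrary: p) simp_all

lemma psum_append: "psum e p (u @ v) = psum e p u + psum e (walk p u) v"
  by (induction u arbitrary: p) (simp_all add: add.assoc)

lemma step_mul: "step (g \<odot> p) l = g \<odot> step p l"
  by (simp add: step_def mul_assoc)

lemma walk_mul: "walk (g \<odot> p) w = g \<odot> walk p w"
  by (induction w arbitrary: p) (simp_all add: step_mul)

lemma walk_one:
  assumes "p \<in> carrier G"
  shows "walk p w = p \<odot> walk \<one> w"
  using walk_mul [of p \<one> w] assms by simp

lemma psum_mul: "psum e (g \<odot> p) w = psum (\<lambda>p x. e (g \<odot> p) x) p w"
  by (induction w arbitrary: p) (simp_all add: step_mul)

lemma psum_hom:
  assumes h: "\<And>u v. h (u - v) = h u - h v"
  shows "psum (\<lambda>p x. h (e p x)) p w = h (psum e p w)"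
proof -
  have h0: "h 0 = 0"
    using h [of 0 0] by simp
  have hm: "h (- u) = - h u" for u
    using h [of 0 u] by (simp add: h0)
  have ha: "h (u + v) = h u + h v" for u v
    using h [of u "- v"] by (simp add: hm)
  show ?thesis
    by (induction w arbitrary: p) (simp_all add: h0 hm ha)
qed

lemma psum_diff: "psum (\<lambda>p x. e p x - f p x) p w = psum e p w - psum f p w"
  by (induction w arbitrary: p) simp_all

lemma psum_apply: "psum e p w y = psum (\<lambda>p x. e p x y) p w"
  by (induction w arbitrary: p) simp_all

lemma psum_closed:
  assumes "0 \<in> A" "\<And>u v. u \<in> A \<Longrightarrow> v \<in> A \<Longrightarrow> u - v \<in> A" "\<And>p x. e p x \<in> A"
  shows "psum e p w \<in> A"
proof -
  have minus: "- u \<in> A" if "u \<in> A" for u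
    using assms(2) [OF assms(1) that] by simp
  have add: "u + v \<in> A" if "u \<in> A" "v \<in> A" for u v
    using assms(2) [OF that(1) minus [OF that(2)]] by simp
  show ?thesis
    by (induction w arbitrary: p) (simp_all add: assms(1,3) add minus)
qed

lemma psum_grad:
  assumes "p \<in> carrier G"
  shows "psum (\<lambda>p x. u p - u (p \<odot> a x)) p w = u p - u (walk p w)"
  using assms by (induction w arbitrary: p) (simp_all add: step_def mul_assoc)

lemma word_inv_Nil [simp]: "word_inv [] = []"
  by (simp add: word_inv_def)

lemma word_inv_Cons: "word_inv (l # w) = word_inv w @ [(fst l, \<not> snd l)]"
  by (simp add: word_inv_def split_beta)

lemma walk_inv: "p \<in> carrier G \<Longrightarrow> walk (walk p w) (word_inv w) = p"
  by (induction w arbitrary: p) (simp_all add: word_inv_Cons walk_append step_def mul_assoc)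

lemma psum_inv: "p \<in> carrier G \<Longrightarrow> psum e (walk p w) (word_inv w) = - psum e p w"
proof (induction w arbitrary: p)
  case (Cons l w)
  obtain x b where l: "l = (x, b)"
    by (cases l)
  have "step (step p (x, b)) (x, \<not> b) = p"
    using Cons.prems by (simp add: step_def mul_assoc)
  then show ?case
    using Cons.IH [of "step p l"] by (cases b) (simp_all add: l word_inv_Cons psum_append walk_inv)
qed simp

text \<open>\<open>S\<close> is a subgroup of the values, and path sums are compared modulo
  \<open>S\<close>. With \<open>S = {0}\<close> this is path independence; with \<open>S\<close> the
  group of boundaries of 2-cells it says that a null-homotopic loop bounds.\<close>

lemma word_eq_psum:
  assumes S0: "0 \<in> S" and S: "\<And>u v. u \<in> S \<Longrightarrow> v \<in> S \<Longrightarrow> u - v \<in> S"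
    and R: "\<And>r p. r \<in> R \<Longrightarrow> p \<in> carrier G \<Longrightarrow> walk p r = p \<and> psum e p r \<in> S"
    and "word_eq X R u v" "p \<in> carrier G"
  shows "walk p u = walk p v \<and> psum e p u - psum e p v \<in> S"
  using assms(4,5)
proof (induction arbitrary: p rule: word_eq.induct)
  case (refl u)
  then show ?case by (simp add: S0)
next
  case (sym u v)
  then have "0 - (psum e p u - psum e p v) \<in> S"
    using S S0 by blast
  with sym show ?case by simp
next
  case (trans u v w)
  then have "(psum e p u - psum e p v) - (0 - (psum e p v - psum e p w)) \<in> S"
    using S S0 by metis
  with trans show ?case by simp
next
  case (cancel u v x b)
  then show ?case
    by (cases b) (simp_all add: walk_append psum_append step_def mul_assoc S0)
next
  case (relator u v r)
  then show ?case
    using R [of r "walk p u"] by (simp add: walk_append psum_append)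
qed

end

section \<open>The cells of an ascending HNN extension\<close>

text \<open>\<open>W i\<close> is a word for the image of \<open>x\<^sub>i\<close> under the endomorphism, and \<open>walk \<one> w\<close> is the element
  that the word \<open>w\<close> represents.\<close>

locale hnn = gens G a for G :: "('g, 'r) monoid_scheme" (structure) and a :: "nat option \<Rightarrow> 'g" +
  fixes n :: nat and W :: "nat \<Rightarrow> nat option word" and R :: "nat option word set"
  assumes W_words: "i < n \<Longrightarrow> W i \<in> words (Some ` {..<n})"
    and R_form: "r \<in> R \<Longrightarrow> \<exists>i w. i < n \<and> r = [(None, False), (Some i, True), (None, True)] @ word_inv w \<and>
      word_eq (insert None (Some ` {..<n})) {} w (W i)"
    and rel: "i < n \<Longrightarrow> a (Some i) \<odot> a None = a None \<odot> walk \<one> (W i)"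
    and gen: "p \<in> carrier G \<Longrightarrow> \<exists>w \<in> words (insert None (Some ` {..<n})). walk \<one> w = p"
    and complete: "u \<in> words (insert None (Some ` {..<n})) \<Longrightarrow> v \<in> words (insert None (Some ` {..<n})) \<Longrightarrow>
      walk \<one> u = walk \<one> v \<Longrightarrow> word_eq (insert None (Some ` {..<n})) R u v"
begin

abbreviation X :: "nat option set" where
  "X \<equiv> insert None (Some ` {..<n})"

text \<open>The boundary of the 2-cell of the \<open>i\<close>-th relator \<open>x\<^sub>i t = t w\<^sub>i\<close> at the vertex \<open>p\<close>.\<close>

definition cb :: "('g \<Rightarrow> nat option \<Rightarrow> 'a::ab_group_add) \<Rightarrow> 'g \<Rightarrow> nat \<Rightarrow> 'a" where
  "cb e p i = e p (Some i) + e (p \<odot> a (Some i)) None - e p None - psum e (p \<odot> a None) (W i)"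

lemma rel_walk:
  assumes "i < n"
  shows "walk (p \<odot> a None) (W i) = p \<odot> (a (Some i) \<odot> a None)"
  by (simp add: walk_one [of "p \<odot> a None"] mul_assoc rel [OF assms])

lemma relator_psum:
  assumes S0: "0 \<in> S" and S: "\<And>u v. u \<in> S \<Longrightarrow> v \<in> S \<Longrightarrow> u - v \<in> S"
    and cb: "\<And>i p. i < n \<Longrightarrow> p \<in> carrier G \<Longrightarrow> cb e p i \<in> S"
    and r: "r \<in> R" and p: "p \<in> carrier G"
  shows "walk p r = p \<and> psum e p r \<in> S"
proof -
  obtain i w where i: "i < n" and r: "r = [(None, False), (Some i, True), (None, True)] @ word_inv w"
    and w: "word_eq X {} w (W i)"
    using R_form [OF r] by blast
  \<comment> \<open>The relator begins with the inverse of \<open>t\<close>, so the loop at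
    \<open>p\<close> is the boundary of the cell based at \<open>q\<close>, one level lower.\<close>
  define q where "q = p \<odot> iv (a None)"
  have q: "q \<in> carrier G" "q \<odot> a None = p"
    using p by (simp_all add: q_def mul_assoc)
  \<comment> \<open>The relator may carry any word \<open>w\<close> freely equal to
    \<open>W i\<close>; free reduction changes neither endpoint nor path sum, so one cell per
    generator is enough.\<close>
  have *: "walk p w = walk p (W i)" "psum e p w = psum e p (W i)"
    using word_eq_psum [of "{0}" "{}" e X w "W i" p] w p by simp_all
  have inv: "psum e (walk p (W i)) (word_inv w) = - psum e p (W i)"
    using psum_inv [OF p, of e w] by (simp only: *)
  have end_w: "q \<odot> a (Some i) \<odot> a None = walk p w"
    using rel_walk [OF i, of q] q by (simp add: * mul_assoc)
  have "walk p r = walk (walk p w) (word_inv w)"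
    by (simp add: r walk_append step_def q_def [symmetric] end_w)
  moreover have "psum e p r = cb e q i"
    by (simp add: r psum_append step_def q_def [symmetric] end_w inv cb_def q *)
  ultimately show ?thesis
    using cb [OF i q(1)] p by (simp add: walk_inv)
qed

lemma path_independent:
  assumes S0: "0 \<in> S" and S: "\<And>u v. u \<in> S \<Longrightarrow> v \<in> S \<Longrightarrow> u - v \<in> S"
    and cb: "\<And>i p. i < n \<Longrightarrow> p \<in> carrier G \<Longrightarrow> cb e p i \<in> S"
    and uv: "u \<in> words X" "v \<in> words X" "walk p u = walk p v" and p: "p \<in> carrier G"
  shows "psum e p u - psum e p v \<in> S"
proof -
  have "iv p \<odot> walk p u = iv p \<odot> walk p v"
    by (simp only: uv)
  then have "walk \<one> u = walk \<one> v"
    by (simp add: walk_one [OF p])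
  then have *: "word_eq X R u v"
    by (intro complete uv)
  show ?thesis
    by (rule conjunct2 [OF word_eq_psum [OF S0 S relator_psum [OF S0 S cb] * p]])
qed

lemma path_independent_zero:
  assumes "\<And>i p. i < n \<Longrightarrow> p \<in> carrier G \<Longrightarrow> cb e p i = 0"
    and "u \<in> words X" "v \<in> words X" "walk p u = walk p v" "p \<in> carrier G"
  shows "psum e p u = psum e p v"
  using path_independent [of "{0}" e u v p] assms by simp

definition wd :: "'g \<Rightarrow> nat option word" where
  "wd p = (SOME w. w \<in> words X \<and> walk \<one> w = rr p)"

lemma wd: "wd p \<in> words X" "walk \<one> (wd p) = rr p"
proof -
  have "wd p \<in> words X \<and> walk \<one> (wd p) = rr p"
    unfolding wd_def by (rule someI_ex) (use gen [OF rr_closed, of p] in blast)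
  then show "wd p \<in> words X" "walk \<one> (wd p) = rr p"
    by simp_all
qed

lemma wd_rr [simp]: "wd (rr p) = wd p"
  by (simp add: wd_def)

lemma walk_wd: "p \<in> carrier G \<Longrightarrow> walk p (wd q) = p \<odot> q"
  by (simp add: walk_one [of p] wd)

lemma words_append: "u \<in> words Y \<Longrightarrow> v \<in> words Y \<Longrightarrow> u @ v \<in> words Y"
  by (simp add: words_def)

section \<open>The height homomorphism to the integers\<close>

definition ht :: "'g \<Rightarrow> int" where
  "ht p = psum (\<lambda>_ x. if x = None then 1 else 0) \<one> (wd p)"

lemma psum_ht_W:
  assumes "w \<in> words (Some ` {..<n})"
  shows "psum (\<lambda>_ x. if x = None then 1 else 0 :: int) p w = 0"
  using assms by (induction w arbitrary: p) (auto simp: words_def)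

text \<open>The signed count of \<open>t\<close> is well defined because it vanishes on cell
  boundaries: the two \<open>t\<close>-edges of a cell cancel and \<open>W i\<close> has no letter
  \<open>t\<close>.\<close>

lemma ht_walk:
  assumes "w \<in> words X"
  shows "ht (walk \<one> w) = psum (\<lambda>_ x. if x = None then 1 else 0) \<one> w"
  unfolding ht_def
proof (rule path_independent_zero)
  show "cb (\<lambda>_ x. if x = None then 1 else 0 :: int) p i = 0" if "i < n" for p i
    by (simp add: cb_def psum_ht_W [OF W_words [OF that]])
qed (simp_all add: assms wd)

lemma ht_mul: "ht (p \<odot> q) = ht p + ht q"
proof -
  have "ht (p \<odot> q) = ht (walk \<one> (wd p @ wd q))"
    by (simp add: walk_append wd walk_wd)
  also have "\<dots> = ht p + psum (\<lambda>_ x. if x = None then 1 else 0) (rr p \<odot> \<one>) (wd q)"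
    by (subst ht_walk) (simp_all add: words_append wd psum_append ht_def)
  also have "psum (\<lambda>_ x. if x = None then 1 else 0) (rr p \<odot> \<one>) (wd q) = ht q"
    unfolding ht_def by (rule psum_mul)
  finally show ?thesis .
qed

lemma ht_rr [simp]: "ht (rr p) = ht p"
  by (simp add: ht_def)

lemma ht_a: "x \<in> X \<Longrightarrow> ht (a x) = (if x = None then 1 else 0)"
  using ht_walk [of "[(x, True)]"] by (simp add: step_def words_def)

lemma ht_one [simp]: "ht \<one> = 0"
  using ht_mul [of \<one> \<one>] by simp

lemma ht_iv: "ht (iv p) = - ht p"
  using ht_mul [of p "iv p"] by simp

lemma cb_hom:
  assumes "\<And>u v. h (u - v) = h u - h v"
  shows "cb (\<lambda>p x. h (e p x)) p i = h (cb e p i)"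
proof -
  have hm: "h (- u) = - h u" for u
    using assms [of 0 u] assms [of 0 0] by simp
  have "h (u + v) = h u + h v" for u v
    using assms [of u "- v"] by (simp add: hm)
  then show ?thesis
    by (simp add: cb_def psum_hom [of h, OF assms] assms)
qed

lemma cb_diff: "cb (\<lambda>p x. e p x - f p x) p i = cb e p i - cb f p i"
  by (simp add: cb_def psum_diff)

lemma cb_apply: "cb e p i y = cb (\<lambda>p x. e p x y) p i"
  by (simp add: cb_def psum_apply)

lemma cb_closed:
  assumes "0 \<in> A" "\<And>u v. u \<in> A \<Longrightarrow> v \<in> A \<Longrightarrow> u - v \<in> A" "\<And>p x. e p x \<in> A"
  shows "cb e p i \<in> A"
proof -
  have "- u \<in> A" if "u \<in> A" for u
    using assms(2) [OF assms(1) that] by simp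
  then have add: "u + v \<in> A" if "u \<in> A" "v \<in> A" for u v
    using assms(2) [of u "- v"] that by simp
  show ?thesis
    unfolding cb_def by (intro assms(2) add assms(3) psum_closed [OF assms])
qed

lemma cb_equiv:
  assumes "\<And>u v. h (u - v) = h u - h v" "\<And>p x. e' (g \<odot> p) x = h (e p x)" "g \<in> carrier G"
  shows "cb e' g i = h (cb e \<one> i)"
proof -
  have g: "g \<odot> \<one> = g"
    using assms(3) by simp
  have *: "e' g x = h (e \<one> x)" for x
    using assms(2) [of \<one> x] by (simp only: g)
  have "psum e' (g \<odot> a None) (W i) = psum (\<lambda>p x. h (e p x)) (a None) (W i)"
    unfolding psum_mul assms(2) ..
  then have "cb e' g i = cb (\<lambda>p x. h (e p x)) \<one> i"
    by (simp add: cb_def assms(2) *)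
  then show ?thesis
    by (simp add: cb_hom [of h, OF assms(1)])
qed

lemma cb_grad:
  assumes "i < n" "p \<in> carrier G"
  shows "cb (\<lambda>p x. u p - u (p \<odot> a x)) p i = 0"
  by (simp add: cb_def psum_grad rel_walk [OF assms(1)] mul_assoc)

text \<open>A 2-cocycle is a group extension; it splits if the generators can be lifted so that the
  relators hold.  Here the lifts are given by \<open>\<kappa>\<close>, and the splitting is the path sum of the
  weights that \<open>\<kappa>\<close> and the cocycle put on the edges of the Cayley graph.\<close>

lemma coboundary_if_cells:
  fixes A :: "'m::ab_group_add set" and act :: "'g \<Rightarrow> 'm \<Rightarrow> 'm"
  assumes "gmod G A act" and f: "coch A act 3 f" "del f = 0" and \<kappa>: "\<And>x. \<kappa> x \<in> A"
    and cells: "\<And>i. i < n \<Longrightarrow>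
      cb (\<lambda>p x. act p (\<kappa> x)) \<one> i = cb (\<lambda>p x. f [\<one>, p, p \<odot> a x]) \<one> i"
  shows "\<exists>h. coch A act 2 h \<and> del h = f"
proof -
  interpret gmod G A act by fact
  have coc: "f [y, z, w] = f [x, z, w] - f [x, y, w] + f [x, y, z]" for x y z w
    using fun_cong [OF f(2), of "[x, y, z, w]"] by (simp add: del_Cons algebra_simps)
  have f_rr: "f [rr x, rr y, rr z] = f [x, y, z]" for x y z
    using coch_rr [OF f(1), of "[x, y, z]"] by simp
  have f_mul: "f [g \<odot> x, g \<odot> y, g \<odot> z] = act g (f [x, y, z])" for g x y z
    using coch_equiv [OF f(1), of g "[x, y, z]"] by simp
  \<comment> \<open>The base vertex \<open>b\<close> turns the homogeneous 2-cochain
    \<open>f\<close> into edge weights: the triangle from \<open>b\<close> over the edge. If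
    \<open>del f = 0\<close>, these weights become closed on cells after subtraction from the lifts
    \<kappa>.\<close>
  define e where "e b p x = act p (\<kappa> x) - f [b, p, p \<odot> a x]" for b p x
  have e_A: "e b p x \<in> A" for b p x
    unfolding e_def by (intro A_diff act_closed \<kappa> coch_A [OF f(1)])
  have e_mul: "e (g \<odot> b) (g \<odot> p) x = act g (e b p x)" for g b p x
    by (simp add: e_def act_diff act_mul mul_assoc f_mul)
  \<comment> \<open>By the cocycle identity on a tetrahedron, a change of the base vertex alters the
    weights by a gradient. Gradients vanish on cells, so \<open>cells\<close>, assumed only at the
    identity, holds at every vertex and for every base.\<close>
  have e_base: "e b = (\<lambda>q x. e c q x - (- f [b, c, q] - - f [b, c, q \<odot> a x]))" for b c
    by (simp add: fun_eq_iff e_def coc [of c _ _ b])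
  have cb_e: "cb (e b) p i = 0" if i: "i < n" and p: "p \<in> carrier G" for b p i
  proof -
    have "cb (e b) p i = cb (\<lambda>q x. e p q x - (- f [b, p, q] - - f [b, p, q \<odot> a x])) p i"
      by (subst e_base [of b p]) (rule HOL.refl)
    also have "\<dots> = cb (e p) p i - 0"
      by (simp only: cb_diff [of "e p"] cb_grad [OF i p, of "\<lambda>q. - f [b, p, q]"])
    also have "cb (e p) p i = act p (cb (e \<one>) \<one> i)"
    proof (rule cb_equiv [OF act_diff _ p])
      show "e p (p \<odot> q) x = act p (e \<one> q x)" for q x
        using e_mul [of p \<one> q x] p by simp
    qed
    also have "cb (e \<one>) \<one> i = 0"
      unfolding e_def cb_diff by (simp add: cells [OF i])
    finally show ?thesis
      by simp
  qed
  define J where "J b p w = psum (e b) p w" for b p w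
  have J_ind: "J b p u = J b p v"
    if "u \<in> words X" "v \<in> words X" "walk p u = walk p v" "p \<in> carrier G" for b p u v
    unfolding J_def using cb_e that by (rule path_independent_zero)
  have J_mul: "J (g \<odot> b) (g \<odot> p) w = act g (J b p w)" for g b p w
    unfolding J_def psum_mul e_mul by (rule psum_hom) (rule act_diff)
  have J_base: "J b p w = J c p w + f [b, c, p] - f [b, c, walk p w]" if "p \<in> carrier G" for b c p w
  proof -
    have "J b p w = psum (\<lambda>q x. e c q x - (- f [b, c, q] - - f [b, c, q \<odot> a x])) p w"
      unfolding J_def by (subst e_base [of b c]) (rule HOL.refl)
    also have "\<dots> = J c p w - (- f [b, c, p] - - f [b, c, walk p w])"
      unfolding J_def by (simp only: psum_diff [of "e c"] psum_grad [OF that, of "\<lambda>q. - f [b, c, q]"])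
    finally show ?thesis
      by simp
  qed
  \<comment> \<open>The cocycle need not be normalized. The term \<open>f [x, x, x]\<close> absorbs
    the degenerate value \<open>f [x, y, y]\<close>, which appears when the base vertex is moved
    from \<open>x\<close> to \<open>y\<close> halfway along a path and equals
    \<open>f [y, y, y]\<close>.\<close>
  define h2 where "h2 x y = f [x, x, x] + J x (rr x) (wd (iv x \<odot> y))" for x y
  define h where "h gs = (if length gs = 2 then h2 (gs ! 0) (gs ! 1) else 0)" for gs
  have h2_A: "h2 x y \<in> A" for x y
    unfolding h2_def J_def by (intro A_add coch_A [OF f(1)] psum_closed A_zero A_diff e_A)
  have h2_mul: "h2 (g \<odot> x) (g \<odot> y) = act g (h2 x y)" for g x y
  proof -
    have "iv (g \<odot> x) \<odot> (g \<odot> y) = iv x \<odot> y"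
      by (simp add: iv_mul mul_assoc)
    moreover have "rr (g \<odot> x) = g \<odot> rr x"
      by simp
    ultimately show ?thesis
      unfolding h2_def f_mul act_add J_mul [symmetric] by (simp only:)
  qed
  have coch_h: "coch A act 2 h"
    unfolding coch_def
  proof (intro conjI allI impI)
    show "h gs = 0" if "length gs \<noteq> 2" for gs
      using that by (simp add: h_def)
    show "h gs \<in> A" for gs
      by (simp add: h_def h2_A)
    show "h (map ((\<odot>) g) gs) = act g (h gs)" for g gs
      by (simp add: h_def h2_mul)
  qed
  have "del h [x, y, z] = f [x, y, z]" for x y z
  proof -
    let ?u = "wd (iv x \<odot> y)" and ?v = "wd (iv y \<odot> z)"
    have u: "walk (rr x) ?u = rr y" and v: "walk (rr y) ?v = rr z"
      by (simp_all add: walk_wd)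
    have "J x (rr x) (wd (iv x \<odot> z)) = J x (rr x) (?u @ ?v)"
      by (rule J_ind) (simp_all add: wd words_append walk_append u v walk_wd)
    also have "\<dots> = J x (rr x) ?u + J x (rr y) ?v"
      unfolding J_def psum_append u ..
    also have "J x (rr y) ?v = J y (rr y) ?v + f [x, y, rr y] - f [x, y, rr z]"
      using J_base [of "rr y" x ?v y] by (simp add: v)
    also have "f [x, y, rr y] = f [x, y, y]"
      using f_rr [of x y "rr y"] f_rr [of x y y] by simp
    also have "f [x, y, rr z] = f [x, y, z]"
      using f_rr [of x y "rr z"] f_rr [of x y z] by simp
    finally have 1: "J x (rr x) (wd (iv x \<odot> z)) =
        J x (rr x) ?u + (J y (rr y) ?v + f [x, y, y] - f [x, y, z])" .
    have "f [y, y, y] = f [x, y, y]"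
      using coc [of y y y x] by simp
    then show ?thesis
      by (simp add: del_Cons h_def h2_def 1)
  qed
  moreover have "coch A act 3 (del h)"
    using coch_del [OF coch_h] by (simp add: numeral_3_eq_3 numeral_2_eq_2)
  ultimately have "del h gs = f gs" for gs
  proof (cases "length gs = 3")
    case True
    then obtain x y z where "gs = [x, y, z]"
      by (auto simp: numeral_3_eq_3 length_Suc_conv)
    then show ?thesis
      using \<open>\<And>x y z. del h [x, y, z] = f [x, y, z]\<close> by simp
  next
    case False
    then show ?thesis
      using coch_supp [OF \<open>coch A act 3 (del h)\<close>] coch_supp [OF f(1)] by simp
  qed
  then have "del h = f" ..
  with coch_h show ?thesis
    by blast
qed

section \<open>The cellular boundary map on 2-chains over the integers\<close>

definition edge :: "'g \<Rightarrow> nat option \<Rightarrow> 'g \<times> nat option \<Rightarrow>\<^sub>0 int" where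
  "edge p x = frag_of (p, x)"

lemma lookup_edge: "Poly_Mapping.lookup (edge q y) (p, x) = (if q = p \<and> y = x then 1 else 0)"
  by (auto simp: edge_def)

text \<open>The type has further basis elements, with \<open>p\<close> outside the carrier or
  \<open>i\<close> not below \<open>n\<close>. They are no cells of the complex, and the words
  \<open>W i\<close> and the relations are known only for \<open>i < n\<close>.\<close>

definition cells :: "('g \<times> nat \<Rightarrow>\<^sub>0 int) set" where
  "cells = {b. Poly_Mapping.keys b \<subseteq> carrier G \<times> {..<n}}"

definition d2 :: "('g \<times> nat \<Rightarrow>\<^sub>0 int) \<Rightarrow> 'g \<times> nat option \<Rightarrow>\<^sub>0 int" where
  "d2 = frag_extend (\<lambda>(p, i). cb edge p i)"

lemma d2_diff: "d2 (b - c) = d2 b - d2 c"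
  by (simp add: d2_def frag_extend_diff)

lemma cells_zero: "0 \<in> cells"
  by (simp add: cells_def)

lemma cells_diff: "b \<in> cells \<Longrightarrow> c \<in> cells \<Longrightarrow> b - c \<in> cells"
  unfolding cells_def using keys_diff by fast

lemma lookup_psum_edge:
  assumes "w \<in> words (Some ` {..<n})" "ht p \<noteq> ht q"
  shows "Poly_Mapping.lookup (psum edge q w) (p, x) = 0"
  using assms
proof (induction w arbitrary: q)
  case (Cons l w)
  obtain y b where l: "l = (y, b)"
    by (cases l)
  have y: "y \<in> Some ` {..<n}" and w: "w \<in> words (Some ` {..<n})"
    using Cons.prems by (auto simp: words_def l)
  have "ht (a y) = 0"
    using y by (subst ht_a) auto
  then have "ht (step q l) = ht q"
    by (simp add: step_def l ht_mul ht_iv)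
  then have "Poly_Mapping.lookup (psum edge (step q l) w) (p, x) = 0" "p \<noteq> q" "p \<noteq> step q l"
    using Cons.IH [OF w] Cons.prems(2) by auto
  then show ?case
    by (simp add: lookup_add lookup_edge)
qed simp

text \<open>A 2-cell of lowest height in a chain is not cancelled: the edge \<open>x\<^sub>i\<close> at its base vertex
  lies on no other cell, since the paths \<open>w\<^sub>j\<close> on the boundaries run one level higher.\<close>

lemma d2_injective:
  assumes b: "b \<in> cells" and "d2 b = 0"
  shows "b = 0"
proof (rule ccontr)
  assume "b \<noteq> 0"
  then have "Poly_Mapping.keys b \<noteq> {}"
    by simp
  then obtain c where c: "c \<in> Poly_Mapping.keys b"
    and min: "\<And>c'. c' \<in> Poly_Mapping.keys b \<Longrightarrow> ht (fst c) \<le> ht (fst c')"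
    using ex_min_if_finite [of "(\<lambda>c. ht (fst c)) ` Poly_Mapping.keys b"] by fastforce
  obtain p i where pi: "c = (p, i)"
    by (cases c)
  have *: "Poly_Mapping.lookup (cb edge q j) (p, Some i) = (if (q, j) = (p, i) then 1 else 0)"
    if "(q, j) \<in> Poly_Mapping.keys b" for q j
  proof -
    have j: "j < n"
      using that b by (auto simp: cells_def)
    have "ht p \<noteq> ht (q \<odot> a None)"
      using min [OF that] by (simp add: pi ht_mul ht_a)
    then have "Poly_Mapping.lookup (psum edge (q \<odot> a None) (W j)) (p, Some i) = 0"
      using lookup_psum_edge [OF W_words [OF j]] by blast
    then show ?thesis
      by (auto simp: cb_def lookup_minus lookup_add lookup_edge)
  qed
  have "0 = Poly_Mapping.lookup (d2 b) (p, Some i)"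
    by (simp add: assms(2))
  also have "\<dots> = (\<Sum>c'\<in>Poly_Mapping.keys b. Poly_Mapping.lookup b c' *
      Poly_Mapping.lookup (cb edge (fst c') (snd c')) (p, Some i))"
    by (simp add: d2_def frag_extend_def lookup_sum split_beta)
  also have "\<dots> = (\<Sum>c'\<in>Poly_Mapping.keys b. if c' = c then Poly_Mapping.lookup b c' else 0)"
  proof (rule sum.cong)
    fix c' assume "c' \<in> Poly_Mapping.keys b"
    then show "Poly_Mapping.lookup b c' * Poly_Mapping.lookup (cb edge (fst c') (snd c')) (p, Some i) =
        (if c' = c then Poly_Mapping.lookup b c' else 0)"
      using * [of "fst c'" "snd c'"] by (simp add: pi)
  qed simp
  also have "\<dots> = Poly_Mapping.lookup b c"
    using c by simp
  finally show False
    using c by (simp add: in_keys_iff)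
qed

text \<open>The universal property of free abelian groups, transferred to type class notation, with
  control over the subgroup in which the values lie.\<close>

lemma free_extension:
  fixes \<rho> :: "'c \<Rightarrow> 'm::ab_group_add"
  assumes A: "0 \<in> A" "\<And>u v. u \<in> A \<Longrightarrow> v \<in> A \<Longrightarrow> u - v \<in> A" and \<rho>: "\<And>c. \<rho> c \<in> A"
  shows "\<exists>h. (\<forall>b c. h (b - c) = h b - h c) \<and> (\<forall>b. h b \<in> A) \<and> (\<forall>c. h (frag_of c) = \<rho> c)"
proof -
  have minus: "- u \<in> A" if "u \<in> A" for u
    using A(2) [OF A(1) that] by simp
  have add: "u + v \<in> A" if "u \<in> A" "v \<in> A" for u v
    using A(2) [OF that(1) minus [OF that(2)]] by simp
  define H :: "'m monoid" where "H = \<lparr>carrier = A, monoid.mult = (+), one = 0\<rparr>"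
  have "comm_group H"
  proof (rule comm_groupI)
    show "\<exists>y\<in>carrier H. y \<otimes>\<^bsub>H\<^esub> x = \<one>\<^bsub>H\<^esub>" if "x \<in> carrier H" for x
      using that minus by (intro bexI [of _ "- x"]) (simp_all add: H_def)
  qed (simp_all add: H_def A add algebra_simps)
  then obtain h where h: "h \<in> hom (free_Abelian_group UNIV) H" "\<And>c. h (frag_of c) = \<rho> c"
    using comm_group.free_Abelian_group_universal [of H \<rho> UNIV] \<rho> by (auto simp: H_def image_subset_iff)
  have add: "h (b + c) = h b + h c" for b c
    using h(1) by (simp add: hom_def H_def)
  have "h (b - c) = h b - h c" for b c
    using add [of "b - c" c] by (simp add: algebra_simps)
  moreover have "h b \<in> A" for b
    using h(1) by (auto simp: hom_def H_def Pi_iff)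
  ultimately show ?thesis
    using h(2) by blast
qed

text \<open>The chosen words \<open>wd p\<close> split the cellular chain complex of the universal cover over the
  integers, hence every 2-cochain without equivariance condition is a coboundary.\<close>

lemma fill_cells:
  fixes \<rho> :: "'g \<Rightarrow> nat \<Rightarrow> 'm::ab_group_add"
  assumes A: "0 \<in> A" "\<And>u v. u \<in> A \<Longrightarrow> v \<in> A \<Longrightarrow> u - v \<in> A" and \<rho>: "\<And>p i. \<rho> p i \<in> A"
  shows "\<exists>\<kappa>. (\<forall>p x. \<kappa> p x \<in> A) \<and> (\<forall>p\<in>carrier G. \<forall>i<n. cb \<kappa> p i = \<rho> p i)"
proof -
  \<comment> \<open>\<open>S p\<close> is the chosen path to \<open>p\<close>. Each edge closes up
    with the chosen paths to its ends to a loop, which bounds a chain \<open>b p x\<close> by path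
    independence modulo boundaries.\<close>
  define S where "S p = psum edge \<one> (wd p)" for p
  have "\<exists>b. b \<in> cells \<and> (p \<in> carrier G \<and> x \<in> X \<longrightarrow> d2 b = edge p x + S p - S (p \<odot> a x))" for p x
  proof (cases "p \<in> carrier G \<and> x \<in> X")
    case True
    have "psum edge \<one> (wd p @ [(x, True)]) - psum edge \<one> (wd (p \<odot> a x)) \<in> d2 ` cells"
    proof (rule path_independent)
      show "0 \<in> d2 ` cells"
        using cells_zero d2_diff [of 0 0] by (intro image_eqI [of _ _ 0]) simp_all
      show "u - v \<in> d2 ` cells" if "u \<in> d2 ` cells" "v \<in> d2 ` cells" for u v
        using that cells_diff by (auto simp: d2_diff [symmetric])
      show "cb edge q i \<in> d2 ` cells" if "i < n" "q \<in> carrier G" for i q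
        by (rule image_eqI [of _ _ "frag_of (q, i)"]) (use that in \<open>simp_all add: d2_def cells_def\<close>)
      show "wd p @ [(x, True)] \<in> words X"
        using True wd(1) [of p] by (simp add: words_def)
      show "walk \<one> (wd p @ [(x, True)]) = walk \<one> (wd (p \<odot> a x))"
        using True by (simp add: walk_append wd step_def)
    qed (simp_all add: wd)
    then obtain b where "b \<in> cells" "d2 b = psum edge \<one> (wd p @ [(x, True)]) - S (p \<odot> a x)"
      unfolding S_def by auto
    then show ?thesis
      using True by (intro exI [of _ b]) (simp add: psum_append wd S_def algebra_simps)
  next
    case False
    then show ?thesis
      using cells_zero by blast
  qed
  then obtain b where b: "\<And>p x. b p x \<in> cells"
    and d2_b: "\<And>p x. p \<in> carrier G \<Longrightarrow> x \<in> X \<Longrightarrow> d2 (b p x) = edge p x + S p - S (p \<odot> a x)"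
    by metis
  have d2_add: "d2 (u + v) = d2 u + d2 v" and d2_minus: "d2 (- u) = - d2 u" for u v
    by (simp_all add: d2_def frag_extend_add frag_extend_minus)
  have d2_psum: "d2 (psum b p w) = psum edge p w + S p - S (walk p w)"
    if "w \<in> words X" "p \<in> carrier G" for p w
    using that
  proof (induction w arbitrary: p)
    case (Cons l w)
    obtain x t where l: "l = (x, t)"
      by (cases l)
    have x: "x \<in> X" and w: "w \<in> words X"
      using Cons.prems by (auto simp: words_def l)
    show ?case
      using Cons.IH [OF w, of "step p l"] d2_b [OF _ x, of p] d2_b [OF _ x, of "step p l"] Cons.prems(2)
      by (cases t) (simp_all add: d2_add d2_minus d2_diff l step_def mul_assoc algebra_simps)
  qed (simp add: d2_def)
  have W: "W i \<in> words X" if "i < n" for i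
    using W_words [OF that] by (auto simp: words_def)
  \<comment> \<open>Along a closed path the contributions of \<open>S\<close> telescope, so this
    chain and the single cell have the same boundary; \<open>d2_injective\<close> identifies them.
    Thus \<open>b\<close> gives a left inverse of the boundary map, and a cochain \<rho> is filled
    by composing it with \<open>b\<close>.\<close>
  have cb_b: "cb b p i = frag_of (p, i)" if "p \<in> carrier G" "i < n" for p i
  proof -
    have "d2 (cb b p i) = cb edge p i"
      using that by (simp add: cb_def d2_add d2_diff d2_b d2_psum W rel_walk mul_assoc)
    also have "\<dots> = d2 (frag_of (p, i))"
      by (simp add: d2_def)
    finally have "d2 (cb b p i - frag_of (p, i)) = 0"
      by (simp add: d2_diff)
    moreover have "cb b p i \<in> cells"
      by (rule cb_closed) (auto intro: cells_zero cells_diff b)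
    moreover have "frag_of (p, i) \<in> cells"
      using that by (simp add: cells_def)
    ultimately show ?thesis
      using d2_injective cells_diff by fastforce
  qed
  have c: "(case c of (p, i) \<Rightarrow> \<rho> p i) \<in> A" for c
    by (simp add: \<rho> split_beta)
  have "\<exists>h. (\<forall>b c. h (b - c) = h b - h c) \<and> (\<forall>b. h b \<in> A) \<and>
      (\<forall>c. h (frag_of c) = (case c of (p, i) \<Rightarrow> \<rho> p i))"
    by (rule free_extension [OF A(1) A(2) c])
  then obtain h where h: "\<And>b c. h (b - c) = h b - h c" "\<And>b. h b \<in> A"
    "\<And>c. h (frag_of c) = (case c of (p, i) \<Rightarrow> \<rho> p i)"
    by blast
  have "cb (\<lambda>p x. h (b p x)) p i = \<rho> p i" if "p \<in> carrier G" "i < n" for p i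
  proof -
    have "cb (\<lambda>p x. h (b p x)) p i = h (cb b p i)"
      by (rule cb_hom) (rule h(1))
    then show ?thesis
      by (simp add: cb_b [OF that] h(3))
  qed
  then show ?thesis
    by (intro exI [of _ "\<lambda>p x. h (b p x)"]) (simp add: h(2))
qed

end

section \<open>Coinduced coefficients\<close>

context group
begin

lemma trivial_normal: "{\<one>} \<lhd> G"
  by (rule one_is_normal)

lemma map_cl_trivial: "map (cl {\<one>}) xs = map (cl {\<one>}) ys \<longleftrightarrow> map rr xs = map rr ys"
  by (simp add: list_eq_iff_nth_eq cl_trivial cong: conj_cong)

lemma mul_comp_rr: "(\<odot>) x \<circ> rr = (\<odot>) x"
  by (simp add: fun_eq_iff)

end

text \<open>Cochains of the module \<open>A\<close> are identified with the cochains with values in functions of one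
  further variable that are constant in that variable.\<close>

definition const1 :: "('x list \<Rightarrow> 'a::zero) \<Rightarrow> 'x list \<Rightarrow> 'y list \<Rightarrow> 'a" where
  "const1 F gs ys = (if length ys = 1 then F gs else 0)"

context gmod
begin

lemma coch_const1:
  assumes "coch A act m F"
  shows "coch (fm A 1 N) (actf act) m (const1 F)"
  unfolding coch_def
proof (intro conjI allI impI)
  show "const1 F gs = 0" if "length gs \<noteq> m" for gs
    using coch_supp [OF assms that] by (simp add: fun_eq_iff const1_def)
  show "const1 F gs \<in> fm A 1 N" for gs
  proof (rule fmI)
    show "const1 F gs ys = const1 F gs ys'" if "map (cl N) ys = map (cl N) ys'" for ys ys'
      using map_eq_imp_length_eq [OF that] by (simp add: const1_def)
  qed (simp_all add: const1_def coch_A [OF assms])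
  show "const1 F (map ((\<odot>) g) gs) = actf act g (const1 F gs)" for g gs
    by (simp add: fun_eq_iff const1_def actf_def coch_equiv [OF assms])
qed

lemma bd_const1: "bd (const1 F) = 0"
proof (intro ext)
  fix gs ys
  show "bd (const1 F) gs ys = 0 gs ys"
  proof (cases "length ys = 2")
    case True
    then obtain y z where "ys = [y, z]"
      by (auto simp: numeral_2_eq_2 length_Suc_conv)
    then show ?thesis
      by (simp add: bd_def del_Cons const1_def)
  next
    case False
    then have "del (const1 F gs) ys = 0"
      by (intro del_supp [of 1]) (simp_all add: const1_def)
    then show ?thesis
      by (simp add: bd_def)
  qed
qed

text \<open>For one function variable, \<open>bd H = 0\<close> says that the values of
  \<open>H\<close> are constant functions, so evaluation at the identity is equivariant. It undoes
  \<open>const1\<close>.\<close>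

lemma coch_eval:
  assumes H: "coch (fm A 1 N) (actf act) m H" and "bd H = 0"
  shows "coch A act m (\<lambda>gs. H gs [\<one>])"
  unfolding coch_def
proof (intro conjI allI impI)
  show "H gs [\<one>] = 0" if "length gs \<noteq> m" for gs
    using coch_supp [OF H that] by simp
  show "H gs [\<one>] \<in> A" for gs
    by (rule fm_A, rule coch_A [OF H])
  have const: "H gs [y] = H gs [z]" for gs y z
    using fun_cong [OF fun_cong [OF \<open>bd H = 0\<close>, of gs], of "[y, z]"] by (simp add: bd_def del_Cons)
  show "H (map ((\<odot>) g) gs) [\<one>] = act g (H gs [\<one>])" for g gs
    using coch_fm_equiv [OF H, of g gs "[\<one>]"] const [of "map ((\<odot>) g) gs" "g \<odot> \<one>" \<one>]
    by (simp only: list.map)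
qed

lemma del_eval: "del (\<lambda>gs. H gs ys) gs = del H gs ys"
  by (rule del_apply [symmetric])

lemma coch_eqI:
  assumes "coch A act m F" "coch A act m H" "\<And>gs. length gs = m \<Longrightarrow> F gs = H gs"
  shows "F = H"
proof
  show "F gs = H gs" for gs
    using assms(3) [of gs] coch_supp [OF assms(1)] coch_supp [OF assms(2)] by (cases "length gs = m") simp_all
qed

text \<open>Copying the first variable of one list to the other one contracts the rows, and for coefficients
  in all functions also the columns, of the double complex.\<close>

lemma coch_insert_y:
  assumes F: "coch (fm A (Suc q) N) (actf act) m F" and N: "N \<lhd> G" and m: "m = 0 \<Longrightarrow> F = 0"
  shows "coch (fm A q N) (actf act) m (\<lambda>gs ys. F gs (hd gs # ys))"
  unfolding coch_def
proof (intro conjI allI impI)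
  show "(\<lambda>ys. F gs (hd gs # ys)) = 0" if "length gs \<noteq> m" for gs
    using coch_supp [OF F that] by (simp add: fun_eq_iff)
  show "(\<lambda>ys. F gs (hd gs # ys)) \<in> fm A q N" for gs
  proof (rule fmI)
    show "F gs (hd gs # ys) = F gs (hd gs # ys')" if "map (cl N) ys = map (cl N) ys'" for ys ys'
      by (rule fm_cl [OF coch_A [OF F]]) (simp add: that)
  qed (simp_all add: fm_supp [OF coch_A [OF F]] fm_A [OF coch_A [OF F]])
  show "(\<lambda>ys. F (map ((\<odot>) g) gs) (hd (map ((\<odot>) g) gs) # ys)) = actf act g (\<lambda>ys. F gs (hd gs # ys))"
    for g gs
  proof (cases "gs = []")
    case True
    have "F [] ys = 0" for ys
      using m coch_supp [OF F, of "[]"] by (cases "m = 0") simp_all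
    then show ?thesis
      by (simp add: True fun_eq_iff actf_def)
  next
    case False
    have "F (map ((\<odot>) g) gs) (hd (map ((\<odot>) g) gs) # ys) =
        act g (F gs (hd gs # map ((\<odot>) (iv g)) ys))" for ys
    proof -
      have "F (map ((\<odot>) g) gs) (map ((\<odot>) g) (hd gs # map ((\<odot>) (iv g)) ys)) =
          act g (F gs (hd gs # map ((\<odot>) (iv g)) ys))"
        by (rule coch_fm_equiv [OF F])
      moreover have "F (map ((\<odot>) g) gs) (map ((\<odot>) g) (hd gs # map ((\<odot>) (iv g)) ys)) =
          F (map ((\<odot>) g) gs) (hd (map ((\<odot>) g) gs) # ys)"
        by (rule fm_cl [OF coch_A [OF F]]) (simp add: hd_map [OF False] mul_comp)
      ultimately show ?thesis
        by simp
    qed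
    then show ?thesis
      by (simp add: fun_eq_iff actf_def)
  qed
qed

lemma bd_insert_y:
  assumes "bd F = 0"
  shows "bd (\<lambda>gs ys. F gs (hd gs # ys)) = F"
proof (intro ext)
  fix gs ys
  have "del (F gs) (hd gs # ys) = 0"
    using fun_cong [OF fun_cong [OF assms, of gs], of "hd gs # ys"] by (simp add: bd_def)
  then show "bd (\<lambda>gs ys. F gs (hd gs # ys)) gs ys = F gs ys"
    by (simp add: bd_def del_Cons)
qed

text \<open>The copied variable \<open>hd ys\<close> takes the place of a group variable, so the new
  values factor through \<open>N'\<close> only if \<open>F\<close> depends on its first group
  variable through the coset of \<open>N'\<close>; this is the hypothesis \<open>cl\<close>. For
  \<open>N' = {\<one>}\<close> it costs nothing; in general it is the reason for shrinking
  \<open>N\<close>.\<close>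

lemma coch_insert_g:
  assumes F: "coch (fm A q N) (actf act) (Suc m) F" and q: "q \<ge> 1" and N: "N' \<lhd> G" "subgroup N G" "N' \<subseteq> N"
    and cl: "\<And>y y' gs. cl N' y = cl N' y' \<Longrightarrow> F (y # gs) = F (y' # gs)"
  shows "coch (fm A q N') (actf act) m (\<lambda>gs ys. F (hd ys # gs) ys)"
  unfolding coch_def
proof (intro conjI allI impI)
  show "(\<lambda>ys. F (hd ys # gs) ys) = 0" if "length gs \<noteq> m" for gs
    using coch_supp [OF F] that by (simp add: fun_eq_iff)
  have supp: "F xs [] = 0" for xs
    using fm_supp [OF coch_A [OF F], of "[]"] q by simp
  show "(\<lambda>ys. F (hd ys # gs) ys) \<in> fm A q N'" for gs
  proof (rule fmI)
    show "F (hd ys # gs) ys = F (hd ys' # gs) ys'" if *: "map (cl N') ys = map (cl N') ys'" for ys ys'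
    proof (cases "ys = []")
      case True
      then show ?thesis
        using * by (simp add: supp)
    next
      case False
      then have "cl N' (hd ys) = cl N' (hd ys')"
        using * by (metis Nil_is_map_conv hd_map)
      then have "F (hd ys # gs) = F (hd ys' # gs)"
        by (rule cl)
      moreover have "F (hd ys' # gs) ys = F (hd ys' # gs) ys'"
        by (rule fm_cl [OF coch_A [OF F]], rule map_cl_mono [OF normal_imp_subgroup [OF N(1)] N(2,3) *])
      ultimately show ?thesis
        by simp
    qed
  qed (simp_all add: fm_supp [OF coch_A [OF F]] fm_A [OF coch_A [OF F]])
  show "(\<lambda>ys. F (hd ys # map ((\<odot>) g) gs) ys) = actf act g (\<lambda>ys. F (hd ys # gs) ys)" for g gs
  proof
    fix ys
    show "F (hd ys # map ((\<odot>) g) gs) ys = actf act g (\<lambda>ys. F (hd ys # gs) ys) ys"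
    proof (cases "ys = []")
      case True
      then show ?thesis
        by (simp add: actf_def supp)
    next
      case False
      have hd: "hd (map ((\<odot>) (iv g)) ys) = iv g \<odot> hd ys"
        by (rule hd_map [OF False])
      have "act g (F ((iv g \<odot> hd ys) # gs) (map ((\<odot>) (iv g)) ys)) =
          F (map ((\<odot>) g) ((iv g \<odot> hd ys) # gs)) (map ((\<odot>) g) (map ((\<odot>) (iv g)) ys))"
        by (rule coch_fm_equiv [OF F, symmetric])
      also have "\<dots> = F (map ((\<odot>) g) ((iv g \<odot> hd ys) # gs)) ys"
        by (rule fm_cl [OF coch_A [OF F]]) (simp add: mul_comp)
      also have "F (map ((\<odot>) g) ((iv g \<odot> hd ys) # gs)) = F (hd ys # map ((\<odot>) g) gs)"
        unfolding list.map by (rule cl) simp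
      finally show ?thesis
        by (simp only: actf_def hd)
    qed
  qed
qed

lemma del_insert_g:
  assumes F: "coch (fm A q N) (actf act) (Suc m) F" and "del F = 0"
  shows "del (\<lambda>gs ys. F (hd ys # gs) ys) = F"
proof (intro ext)
  fix gs ys
  have "del F (hd ys # gs) ys = 0"
    using fun_cong [OF assms(2), of "hd ys # gs"] by simp
  then have "F gs ys = del (\<lambda>z. F (hd ys # z)) gs ys"
    by (simp add: del_Cons)
  also have "\<dots> = del (\<lambda>z. F (hd ys # z) ys) gs"
    by (rule del_apply)
  also have "\<dots> = del (\<lambda>gs ys. F (hd ys # gs) ys) gs ys"
    by (rule del_apply [symmetric])
  finally show "del (\<lambda>gs ys. F (hd ys # gs) ys) gs ys = F gs ys" ..
qed

end

context hnn
begin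

text \<open>Functions that may depend on the full first variable form a module coinduced from the
  trivial subgroup. Equivariant cochains with such values correspond, by evaluating the first
  variable at the identity, to cochains without equivariance, and these are filled by
  \<open>fill_cells\<close>, separately for each list \<open>zs\<close> of the other
  variables.\<close>

lemma coinduced_fill:
  fixes A :: "'m::ab_group_add set" and act :: "'g \<Rightarrow> 'm \<Rightarrow> 'm"
  assumes "gmod G A act" and s: "s \<ge> 1" and \<rho>: "\<And>i. \<rho> i \<in> fm A s {\<one>}"
  shows "\<exists>\<kappa>. (\<forall>x. \<kappa> x \<in> fm A s {\<one>}) \<and>
    (\<forall>i<n. cb (\<lambda>p x. actf act p (\<kappa> x)) \<one> i = \<rho> i)"
proof -
  interpret gmod G A act by fact
  have "\<exists>k. (\<forall>p x. k p x \<in> A) \<and> (\<forall>p\<in>carrier G. \<forall>i<n. cb k p i = act p (\<rho> i (map ((\<odot>) (iv p)) (\<one> # zs))))"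
    for zs
  proof -
    have *: "act p (\<rho> i (map ((\<odot>) (iv p)) (\<one> # zs))) \<in> A" for p i
      by (intro act_closed fm_A [OF \<rho>])
    show ?thesis
      by (rule fill_cells [OF A_zero A_diff *])
  qed
  then obtain k where k_A: "\<And>zs p x. k zs p x \<in> A"
    and cb_k: "\<And>zs p i. p \<in> carrier G \<Longrightarrow> i < n \<Longrightarrow>
      cb (k zs) p i = act p (\<rho> i (map ((\<odot>) (iv p)) (\<one> # zs)))"
    by metis
  \<comment> \<open>The inverse of that correspondence: translate \<open>ys\<close> by the inverse
    of its head \<open>y\<close>, so that the head becomes the identity, read off the solution at
    the vertex \<open>iv y\<close>, and act by \<open>y\<close>.\<close>
  define \<kappa> where "\<kappa> x ys = (if length ys = s
    then act (hd ys) (k (map ((\<odot>) (iv (hd ys))) (tl ys)) (iv (hd ys)) x) else 0)" for x ys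
  have \<kappa>_fm: "\<kappa> x \<in> fm A s {\<one>}" for x
  proof (rule fmI)
    fix ys ys' :: "'g list"
    assume *: "map (cl {\<one>}) ys = map (cl {\<one>}) ys'"
    then have len: "length ys = length ys'"
      by (rule map_eq_imp_length_eq)
    show "\<kappa> x ys = \<kappa> x ys'"
    proof (cases "length ys = s")
      case True
      then obtain y zs where ys: "ys = y # zs"
        using s by (cases ys) auto
      then obtain y' zs' where ys': "ys' = y' # zs'" "rr y = rr y'" and zs: "map rr zs = map rr zs'"
        using * by (cases ys') (auto simp: map_cl_trivial cl_trivial)
      have "iv y = iv y'"
        using iv_rr [of y] iv_rr [of y'] ys' by simp
      moreover have "map ((\<odot>) (iv y)) zs = map ((\<odot>) (iv y)) zs'"
      proof -
        have "map ((\<odot>) (iv y)) (map rr zs) = map ((\<odot>) (iv y)) (map rr zs')"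
          by (simp only: zs)
        then show ?thesis
          by (simp add: mul_comp_rr)
      qed
      ultimately have "\<kappa> x ys' = act y' (k (map ((\<odot>) (iv y)) zs) (iv y) x)"
        using True len by (simp add: \<kappa>_def ys ys')
      also have "\<dots> = act y (k (map ((\<odot>) (iv y)) zs) (iv y) x)"
        using act_rr [OF k_A, of y] act_rr [OF k_A, of y'] ys' by metis
      also have "\<dots> = \<kappa> x ys"
        using True by (simp add: \<kappa>_def ys)
      finally show ?thesis ..
    qed (simp add: \<kappa>_def len)
  qed (simp_all add: \<kappa>_def act_closed k_A)
  have "cb (\<lambda>p x. actf act p (\<kappa> x)) \<one> i ys = \<rho> i ys" if i: "i < n" for i ys
  proof (cases "length ys = s")
    case True
    then obtain y zs where ys: "ys = y # zs"
      using s by (cases ys) auto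
    let ?zs = "map ((\<odot>) (iv y)) zs"
    have "actf act p (\<kappa> x) ys = act y (k ?zs (iv y \<odot> p) x)" for p x
    proof -
      have "map ((\<odot>) (iv (iv p \<odot> y))) (map ((\<odot>) (iv p)) zs) = ?zs"
        by (simp add: mul_comp iv_mul mul_assoc)
      then have "actf act p (\<kappa> x) ys = act p (act (iv p \<odot> y) (k ?zs (iv y \<odot> p) x))"
        using True by (simp add: actf_def \<kappa>_def ys iv_mul del: map_map)
      also have "\<dots> = act y (k ?zs (iv y \<odot> p) x)"
        using act_rr [OF k_A] by (simp add: act_mul [symmetric])
      finally show ?thesis .
    qed
    then have "cb (\<lambda>p x. actf act p (\<kappa> x)) \<one> i ys = cb (\<lambda>p x. act y (k ?zs (iv y \<odot> p) x)) \<one> i"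
      by (simp add: cb_apply [of "\<lambda>p x. actf act p (\<kappa> x)"])
    also have "\<dots> = act y (cb (\<lambda>p x. k ?zs (iv y \<odot> p) x) \<one> i)"
      by (rule cb_hom) (rule act_diff)
    also have "cb (\<lambda>p x. k ?zs (iv y \<odot> p) x) \<one> i = cb (k ?zs) (iv y) i"
      by (rule cb_equiv [symmetric, of "\<lambda>x. x"]) simp_all
    also have "\<dots> = act (iv y) (\<rho> i (map ((\<odot>) (iv (iv y))) (\<one> # ?zs)))"
      by (rule cb_k [OF _ i]) simp
    also have "act y \<dots> = \<rho> i (map ((\<odot>) (iv (iv y))) (\<one> # ?zs))"
      by (simp add: fm_A [OF \<rho>])
    also have "\<dots> = \<rho> i ys"
      by (rule fm_cl [OF \<rho>]) (simp add: ys mul_comp)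
    finally show ?thesis .
  next
    case False
    interpret F: gmod G "fm A s {\<one>}" "actf act"
      by (rule gmod_fm [OF trivial_normal])
    have "cb (\<lambda>p x. actf act p (\<kappa> x)) \<one> i \<in> fm A s {\<one>}"
      by (intro cb_closed F.A_zero F.A_diff F.act_closed \<kappa>_fm)
    then show ?thesis
      using fm_supp [OF _ False] fm_supp [OF \<rho> False] by metis
  qed
  then show ?thesis
    using \<kappa>_fm by (intro exI [of _ \<kappa>]) (simp add: fun_eq_iff)
qed

text \<open>With the zero subcomplex in the place of \<open>L\<close>, the shift is ordinary
  dimension shifting and ends at 2-cocycles. Their coefficients form a quotient of a coinduced
  module, and second cohomology passes to quotients because there are no 3-cells: the values on the
  2-cells can be lifted arbitrarily.\<close>

lemma vanishing_ge_3:
  fixes A :: "'m::ab_group_add set" and act :: "'g \<Rightarrow> 'm \<Rightarrow> 'm"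
  assumes "gmod G A act" and F: "coch A act m F" "del F = 0" and m: "m \<ge> 4"
  shows "\<exists>H. coch A act (m - 1) H \<and> del H = F"
proof -
  interpret gmod G A act by fact
  let ?I = "{\<one>}"
  have sub: "subgroup ?I G"
    by (rule normal_imp_subgroup [OF trivial_normal])
  have gm: "gmod G (fm A q ?I) (actf act)" for q
    by (rule gmod_fm [OF trivial_normal])
  \<comment> \<open>A cochain without group variables has no head to copy, so the column
    \<open>m = 0\<close> is taken to be zero; the contraction of the rows then works in every
    column.\<close>
  define K where "K m q F \<longleftrightarrow> coch (fm A q ?I) (actf act) m F \<and> (m = 0 \<longrightarrow> F = 0)" for m q F
  define L :: "nat \<Rightarrow> nat \<Rightarrow> ('g list \<Rightarrow> 'g list \<Rightarrow> 'm) \<Rightarrow> bool" where "L m q F \<longleftrightarrow> F = 0" for m q F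
  have "\<exists>H. K (m - 1) 1 H \<and> bd H = 0 \<and> L m 1 (const1 F - del H)"
  proof (rule double_complex_shift [of L K 3])
    show "K m q F" if "L m q F" for m q F
      using that gmod.coch_0 [OF gm] by (simp add: K_def L_def)
    show "K m q (F - H)" if "K m q F" "K m q H" for m q F H
      using that gmod.coch_diff [OF gm] by (simp add: K_def)
    show "K (Suc m) q (del F)" if "K m q F" for m q F
      using that gmod.coch_del [OF gm] by (simp add: K_def)
    show "K m (Suc q) (bd F)" if "K m q F" for m q F
      using that coch_bd by (auto simp: K_def bd_zero)
    show "L (Suc m) q (del F)" if "L m q F" for m q F
      using that by (simp add: L_def del_fun_zero)
    show "L m (Suc q) (bd F)" if "L m q F" for m q F
      using that by (simp add: L_def bd_zero)
    show "\<exists>H. K m q H \<and> bd H = F" if "K m (Suc q) F" "bd F = 0" for m q F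
    proof (intro exI conjI)
      show "bd (\<lambda>gs ys. F gs (hd gs # ys)) = F"
        by (rule bd_insert_y) fact
      show "K m q (\<lambda>gs ys. F gs (hd gs # ys))"
        using that(1) coch_insert_y [OF _ trivial_normal, of q m F] by (auto simp: K_def fun_eq_iff)
    qed
    show "\<exists>H. L m q H \<and> bd H = F" if "L m (Suc q) F" for m q F
      using that bd_zero by (auto simp: L_def)
    show "\<exists>H. L m q H \<and> del H = F" if "L (Suc m) q F" for m q F
      using that del_fun_zero by (auto simp: L_def)
    show "\<exists>H. K (m - 1) q H \<and> del H = F" if "q \<ge> 1" "m > 3" "K m q F" "del F = 0" for m q F
    proof -
      obtain l where l: "m = Suc l" "l \<noteq> 0"
        using \<open>m > 3\<close> by (cases m) auto
      have F: "coch (fm A q ?I) (actf act) (Suc l) F"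
        using that(3) by (simp add: K_def l)
      have "coch (fm A q ?I) (actf act) l (\<lambda>gs ys. F (hd ys # gs) ys)"
      proof (rule coch_insert_g [OF F \<open>q \<ge> 1\<close> trivial_normal sub subset_refl])
        show "F (y # gs) = F (y' # gs)" if "cl ?I y = cl ?I y'" for y y' gs
          using that by (intro gmod.coch_cong [OF gm F]) (simp add: cl_trivial)
      qed
      moreover have "del (\<lambda>gs ys. F (hd ys # gs) ys) = F"
        by (rule del_insert_g [OF F \<open>del F = 0\<close>])
      ultimately show ?thesis
        by (intro exI [of _ "\<lambda>gs ys. F (hd ys # gs) ys"]) (simp add: K_def l)
    qed
    show "\<exists>H. K (3 - 1) q H \<and> bd H = 0 \<and> L 3 q (F - del H)"
      if q: "q \<ge> 2" and F: "K 3 q F" "bd F = 0" "L (Suc 3) q (del F)" for q F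
    proof -
      \<comment> \<open>At least one shift has happened, hence \<open>q \<ge> 2\<close>, and
        functions of the remaining \<open>s \<ge> 1\<close> variables are still coinduced.\<close>
      obtain s where s: "q = Suc s" "s \<ge> 1"
        using q by (cases q) auto
      interpret S: gmod G "fm A s ?I" "actf act"
        by (rule gm)
      interpret Q: gmod G "fm A q ?I" "actf act"
        by (rule gm)
      \<comment> \<open>As \<open>bd F = 0\<close>, the cochain takes its values in the closed
        functions. Solving inside \<open>C\<close>, and not just in \<open>fm A q {\<one>}\<close>,
        is what makes the solution \<open>bd\<close>-closed.\<close>
      define C where "C = {\<phi> \<in> fm A q ?I. del \<phi> = 0}"
      have C: "gmod G C (actf act)"
        by (intro gmod.intro gmod_axioms.intro group_axioms)
          (simp_all add: C_def Q.A_diff Q.act_closed Q.act_diff Q.act_mul Q.act_one del_fun_zero del_fun_diff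
            actf_del [symmetric])
      interpret C: gmod G C "actf act"
        by (rule C)
      have cF: "coch C (actf act) 3 F"
        using F(1) fun_cong [OF F(2)] by (auto simp: coch_def K_def C_def bd_def)
      have dF: "del F = 0"
        using F(3) by (simp add: L_def)
      define \<rho> where "\<rho> i = cb (\<lambda>p x. F [\<one>, p, p \<odot> a x]) \<one> i" for i
      have \<rho>: "\<rho> i \<in> C" for i
        unfolding \<rho>_def by (intro cb_closed C.A_zero C.A_diff coch_A [OF cF])
      \<comment> \<open>The row contraction with vertex \<open>\<one>\<close> lifts \<rho> along
        \<open>del\<close>. It is not equivariant, and need not be: the values on the cells at one
        vertex can be prescribed freely.\<close>
      define \<rho>' where "\<rho>' i ys = \<rho> i (\<one> # ys)" for i ys
      have \<rho>': "\<rho>' i \<in> fm A s ?I" for i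
      proof (rule fmI)
        have *: "\<rho> i \<in> fm A q ?I"
          using \<rho> by (simp add: C_def)
        show "\<rho>' i ys = 0" if "length ys \<noteq> s" for ys
          unfolding \<rho>'_def by (rule fm_supp [OF *]) (simp add: that s)
        show "\<rho>' i ys \<in> A" for ys
          unfolding \<rho>'_def by (rule fm_A [OF *])
        show "\<rho>' i ys = \<rho>' i ys'" if "map (cl ?I) ys = map (cl ?I) ys'" for ys ys'
          unfolding \<rho>'_def by (rule fm_cl [OF *]) (simp add: that)
      qed
      have del_\<rho>': "del (\<rho>' i) = \<rho> i" for i
      proof
        fix ys
        have "del (\<rho> i) = 0"
          using \<rho> by (simp add: C_def)
        then have "del (\<rho> i) (\<one> # ys) = 0"
          by simp
        then show "del (\<rho>' i) ys = \<rho> i ys"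
          by (simp add: del_Cons \<rho>'_def [abs_def])
      qed
      from coinduced_fill [where \<rho> = \<rho>', OF \<open>gmod G A act\<close> s(2) \<rho>'] obtain k where k': "\<forall>x. k x \<in> fm A s ?I"
        and cb_k: "\<forall>i<n. cb (\<lambda>p x. actf act p (k x)) \<one> i = \<rho>' i"
        by (elim exE conjE)
      have k: "k x \<in> fm A s ?I" for x
        using k' by (rule spec)
      have "\<exists>h. coch C (actf act) 2 h \<and> del h = F"
      proof (rule coboundary_if_cells [OF C cF dF])
        show "del (k x) \<in> C" for x
          using del_fm [OF k] by (simp add: C_def s del_fun_del)
        show "cb (\<lambda>p x. actf act p (del (k x))) \<one> i = cb (\<lambda>p x. F [\<one>, p, p \<odot> a x]) \<one> i"
          if "i < n" for i
        proof -
          have "cb (\<lambda>p x. actf act p (del (k x))) \<one> i = cb (\<lambda>p x. del (actf act p (k x))) \<one> i"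
            by (simp only: actf_del)
          also have "\<dots> = del (\<rho>' i)"
            unfolding cb_k [rule_format, OF that, symmetric] by (rule cb_hom [of del]) (rule del_fun_diff)
          finally show ?thesis
            by (simp add: del_\<rho>' \<rho>_def)
        qed
      qed
      then obtain h where h: "coch C (actf act) 2 h" "del h = F"
        by blast
      have "K 2 q h" "bd h = 0"
        using h(1) by (auto simp: K_def coch_def C_def bd_def fun_eq_iff)
      then show ?thesis
        using h(2) by (intro exI [of _ h]) (simp add: L_def)
    qed
    show "K m 1 (const1 F)"
      using coch_const1 [OF F(1), of ?I] m by (simp add: K_def)
    have "del (const1 F) = 0"
    proof (intro ext)
      show "del (const1 F) gs ys = 0 gs ys" for gs ys
        using fun_cong [OF F(2), of gs]
        by (cases "length ys = 1") (simp_all add: del_apply [of "const1 F"] const1_def del_zero)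
    qed
    then show "L (Suc m) 1 (del (const1 F))"
      by (simp add: L_def)
  qed (use m in \<open>simp_all add: L_def bd_const1\<close>)
  then obtain H where H: "coch (fm A 1 ?I) (actf act) (m - 1) H" "bd H = 0" "const1 F = del H"
    by (auto simp: K_def L_def)
  have "del (\<lambda>gs. H gs [\<one>]) = F"
    by (simp add: fun_eq_iff del_eval H(3) [symmetric] const1_def)
  with coch_eval [OF H(1,2)] show ?thesis
    by blast
qed

end

section \<open>Finite coefficients\<close>

context group
begin

text \<open>\<open>cong\<close> makes the level sets of \<open>f\<close> the classes of a two-sided
  congruence; the class of the identity is then a normal subgroup, and finiteness of the image
  bounds its index.\<close>

lemma finite_congruence:
  assumes fin: "finite (f ` carrier G)" and cong: "\<And>x y g h. f x = f y \<Longrightarrow> f (g \<odot> x \<odot> h) = f (g \<odot> y \<odot> h)"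
  shows "\<exists>N\<in>finite_index_normal G. \<forall>x y. cl N x = cl N y \<longrightarrow> f (rr x) = f (rr y)"
proof -
  define N where "N = {x \<in> carrier G. f x = f \<one>}"
  have mult: "f (x \<odot> y) = f (rr y)" if "f x = f \<one>" for x y
    using cong [OF that, of \<one> y] by simp
  have N: "subgroup N G"
  proof (rule subgroupI)
    show "N \<subseteq> carrier G" "N \<noteq> {}"
      by (auto simp: N_def)
    show "inv x \<in> N" if "x \<in> N" for x
      using that cong [of x \<one> "inv x" \<one>] by (simp add: N_def mul_def)
    show "x \<otimes> y \<in> N" if "x \<in> N" "y \<in> N" for x y
      using that mult [of x y] by (simp add: N_def mul_def)
  qed
  have normal: "N \<lhd> G"
  proof (rule normal_invI [OF N])
    show "x \<otimes> h \<otimes> inv x \<in> N" if "x \<in> carrier G" "h \<in> N" for x h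
      using that cong [of h \<one> x "inv x"] by (simp add: N_def mul_def)
  qed
  have "N \<in> finite_index_normal G"
  proof (rule finite_index_normalI [OF normal fin])
    show "x \<odot> iv y \<in> N" if "x \<in> carrier G" "y \<in> carrier G" "f x = f y" for x y
      using that cong [OF that(3), of \<one> "iv y"] by (simp add: N_def)
  qed
  moreover have "f (rr x) = f (rr y)" if "cl N x = cl N y" for x y
  proof -
    have "f (x \<odot> iv y) = f \<one>"
      using that unfolding cl_eq_iff [OF N] by (simp add: N_def)
    from mult [OF this, of y] show ?thesis
      by (simp add: mul_assoc)
  qed
  ultimately show ?thesis
    by blast
qed

lemma finite_fm:
  assumes "finite A" "N \<in> finite_index_normal G"
  shows "finite (fm A q N)"
proof -
  define L where "L = {v. set v \<subseteq> range (cl N) \<and> length v = q}"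
  let ?h = "\<lambda>\<psi> ys. if length ys = q then \<psi> (map (cl N) ys) else 0"
  have "fm A q N \<subseteq> ?h ` (L \<rightarrow>\<^sub>E A)"
  proof
    fix \<phi>
    assume \<phi>: "\<phi> \<in> fm A q N"
    define \<psi> where "\<psi> = (\<lambda>v\<in>L. \<phi> (SOME ys. map (cl N) ys = v))"
    have "\<phi> ys = ?h \<psi> ys" for ys
    proof (cases "length ys = q")
      case True
      have "map (cl N) (SOME zs. map (cl N) zs = map (cl N) ys) = map (cl N) ys"
        by (rule someI [where x = ys]) (rule HOL.refl)
      then have "\<phi> (SOME zs. map (cl N) zs = map (cl N) ys) = \<phi> ys"
        by (rule fm_cl [OF \<phi>])
      moreover have "map (cl N) ys \<in> L"
        using True by (auto simp: L_def)
      ultimately show ?thesis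
        using True by (simp add: \<psi>_def)
    qed (simp add: fm_supp [OF \<phi>])
    then have "\<phi> = ?h \<psi>" ..
    moreover have "\<psi> \<in> L \<rightarrow>\<^sub>E A"
      using fm_A [OF \<phi>] by (auto simp: \<psi>_def)
    ultimately show "\<phi> \<in> ?h ` (L \<rightarrow>\<^sub>E A)"
      by (rule image_eqI)
  qed
  moreover have "finite (L \<rightarrow>\<^sub>E A)"
    unfolding L_def by (intro finite_PiE finite_lists_length_eq finite_cl assms)
  ultimately show ?thesis
    using finite_surj by blast
qed

end

context gmod
begin

lemma finite_action_kernel:
  assumes "finite A"
  shows "\<exists>N\<in>finite_index_normal G. \<forall>g h. cl N g = cl N h \<longrightarrow> (\<forall>a\<in>A. act g a = act h a)"
proof -
  define f where "f g = restrict (act g) A" for g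
  have f_eq: "f g = f h \<longleftrightarrow> (\<forall>a\<in>A. act g a = act h a)" for g h
    by (auto simp: f_def fun_eq_iff restrict_def)
  have "\<exists>N\<in>finite_index_normal G. \<forall>x y. cl N x = cl N y \<longrightarrow> f (rr x) = f (rr y)"
  proof (rule finite_congruence)
    have "f ` carrier G \<subseteq> A \<rightarrow>\<^sub>E A"
      by (auto simp: f_def act_closed)
    then show "finite (f ` carrier G)"
      using finite_PiE [of A "\<lambda>_. A"] assms finite_subset by blast
    show "f (g \<odot> x \<odot> h) = f (g \<odot> y \<odot> h)" if "f x = f y" for x y g h
      using that by (simp add: f_eq act_mul act_closed)
  qed
  then obtain N where N: "N \<in> finite_index_normal G"
    and *: "\<And>x y. cl N x = cl N y \<Longrightarrow> f (rr x) = f (rr y)"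
    by blast
  have "act x b = act y b" if "cl N x = cl N y" "b \<in> A" for x y b
    using * [OF that(1)] that(2) act_rr [OF that(2)] unfolding f_eq by metis
  with N show ?thesis
    by blast
qed

text \<open>Over the finite module \<open>?B\<close>, the action together with the crossed
  homomorphism \<open>b\<close> amounts to a homomorphism to a finite semidirect product. So
  \<open>b\<close> factors through a finite quotient \<open>K\<close>, and over
  \<open>N \<inter> K\<close> the copying of a function variable is permitted.\<close>

lemma coinduced_exact_1:
  assumes fin: "finite A" and N: "N \<in> finite_index_normal G" and q: "q \<ge> 1"
    and c: "coch (fm A q N) (actf act) 2 c" "del c = 0"
  shows "\<exists>N'\<in>finite_index_normal G. \<exists>H. coch (fm A q N') (actf act) 1 H \<and> del H = c"
proof -
  let ?B = "fm A q N"
  interpret B: gmod G ?B "actf act"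
    by (rule gmod_fm [OF finite_index_normal_normal [OF N]])
  define b where "b y = c [\<one>, y]" for y
  have coc: "c [x, z] = c [x, y] + c [y, z]" for x y z
    using fun_cong [OF c(2), of "[x, y, z]"] by (simp add: del_Cons algebra_simps)
  have b_B: "b y \<in> ?B" for y
    unfolding b_def by (rule coch_A [OF c(1)])
  have b_rr: "b (rr y) = b y" for y
    using B.coch_rr [OF c(1), of "[\<one>, y]"] by (simp add: b_def)
  have b_mul: "b (g \<odot> x) = b g + actf act g (b x)" for g x
  proof -
    have "c [g \<odot> \<one>, g \<odot> x] = actf act g (b x)"
      using coch_equiv [OF c(1), of g "[\<one>, x]"] by (simp add: b_def)
    moreover have "c [g \<odot> \<one>, g \<odot> x] = c [g, g \<odot> x]"
      by (rule B.coch_cong [OF c(1)]) simp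
    ultimately show ?thesis
      using coc [of \<one> "g \<odot> x" g] by (simp add: b_def)
  qed
  \<comment> \<open>The value of \<open>b\<close> on a product involves the action, so only the pair
    has level sets that form a congruence.\<close>
  define f where "f g = (restrict (actf act g) ?B, b g)" for g
  have f_eq: "f g = f h \<longleftrightarrow> (\<forall>\<phi>\<in>?B. actf act g \<phi> = actf act h \<phi>) \<and> b g = b h" for g h
    by (auto simp: f_def fun_eq_iff restrict_def)
  have "\<exists>N\<in>finite_index_normal G. \<forall>x y. cl N x = cl N y \<longrightarrow> f (rr x) = f (rr y)"
  proof (rule finite_congruence)
    have "f ` carrier G \<subseteq> (?B \<rightarrow>\<^sub>E ?B) \<times> ?B"
      using b_B B.act_closed by (auto simp: f_def)
    then show "finite (f ` carrier G)"
      using finite_PiE [of ?B "\<lambda>_. ?B"] finite_fm [OF fin N] finite_subset by blast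
    show "f (g \<odot> x \<odot> h) = f (g \<odot> y \<odot> h)" if "f x = f y" for x y g h
      using that by (simp add: f_eq B.act_mul B.act_closed b_mul b_B)
  qed
  then obtain K where K: "K \<in> finite_index_normal G"
    and *: "\<And>x y. cl K x = cl K y \<Longrightarrow> f (rr x) = f (rr y)"
    by blast
  have NK: "N \<inter> K \<in> finite_index_normal G"
    by (rule finite_index_normal_Int [OF N K])
  have c': "coch ?B (actf act) (Suc 1) c"
    using c(1) by (simp add: numeral_2_eq_2)
  have "coch (fm A q (N \<inter> K)) (actf act) 1 (\<lambda>gs ys. c (hd ys # gs) ys)"
  proof (rule coch_insert_g [OF c' q finite_index_normal_normal [OF NK] finite_index_normal_subgroup [OF N]])
    fix y y' gs
    assume "cl (N \<inter> K) y = cl (N \<inter> K) y'"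
    then have "cl K y = cl K y'"
      using cl_mono [OF finite_index_normal_subgroup [OF NK] finite_index_normal_subgroup [OF K]] by blast
    from * [OF this] have b_eq: "b y = b y'"
      by (simp add: f_eq b_rr)
    show "c (y # gs) = c (y' # gs)"
    proof (cases "length gs = 1")
      case True
      then obtain x where "gs = [x]"
        by (auto simp: length_Suc_conv)
      then show ?thesis
        \<comment> \<open>Here \<open>c [y, x] = b x - b y\<close>, so the first variable enters
          only through \<open>b\<close>.\<close>
        using coc [of \<one> x y] coc [of \<one> x y'] b_eq by (simp add: b_def)
    qed (simp add: coch_supp [OF c(1)])
  qed simp
  then show ?thesis
    using NK del_insert_g [OF c' c(2)] by blast
qed

end

context hnn
begin

section \<open>Degree 2: the recursion along the height\<close>

lemma psum_W_cong:
  assumes "\<And>p j. ht p = h \<Longrightarrow> j < n \<Longrightarrow> e p (Some j) = f p (Some j)"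
    and "w \<in> words (Some ` {..<n})" "ht p = h"
  shows "psum e p w = psum f p w"
  using assms(2,3)
proof (induction w arbitrary: p)
  case (Cons l w)
  obtain y b where l: "l = (y, b)"
    by (cases l)
  obtain j where j: "y = Some j" "j < n"
    using Cons.prems by (auto simp: words_def l)
  have w: "w \<in> words (Some ` {..<n})"
    using Cons.prems by (auto simp: words_def l)
  have "ht (a y) = 0"
    using j by (subst ht_a) auto
  then have ht: "ht (step p l) = h"
    using Cons.prems by (simp add: step_def l ht_mul ht_iv)
  show ?case
    using Cons.IH [OF w ht] assms(1) [OF Cons.prems(2) j(2)] assms(1) [OF ht j(2)] by (cases b) (simp_all add: l j)
qed simp

lemma periodic_point:
  assumes "finite S" "f ` S \<subseteq> S" "s \<in> S"
  obtains u m where "u \<in> S" "m > 0" "(f ^^ m) u = u"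
proof -
  have S: "(f ^^ k) s \<in> S" for k
    using assms(2,3) by (induction k) auto
  then have "\<not> inj (\<lambda>k. (f ^^ k) s)"
    using assms(1) finite_subset [of "range (\<lambda>k. (f ^^ k) s)" S] range_inj_infinite by blast
  then obtain i j where ij: "(f ^^ i) s = (f ^^ j) s" "i < j"
    unfolding inj_def by (metis nat_neq_iff)
  have "(f ^^ (j - i)) ((f ^^ i) s) = (f ^^ (j - i + i)) s"
    by (simp only: funpow_add o_apply)
  also have "\<dots> = (f ^^ i) s"
    using ij by simp
  finally show ?thesis
    using that [of "(f ^^ i) s" "j - i"] S ij(2) by simp
qed

text \<open>Here the generator \<open>x\<^sub>i\<close> is lifted by \<open>u i\<close> and \<open>t\<close> by 0; the relators then say
  \<open>u = \<rho> + T u\<close>.\<close>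

lemma coinduced_exact_2:
  fixes A :: "'m::ab_group_add set" and act :: "'g \<Rightarrow> 'm \<Rightarrow> 'm"
  assumes "gmod G A act" and fin: "finite A" and N: "N \<in> finite_index_normal G" and q: "q \<ge> 1"
    and c: "coch (fm A q N) (actf act) 3 c" "del c = 0"
  shows "\<exists>N'\<in>finite_index_normal G. \<exists>H. coch (fm A q N') (actf act) 2 H \<and> del H = c"
proof -
  interpret gmod G A act by fact
  let ?B = "fm A q N"
  interpret B: gmod G ?B "actf act"
    by (rule gmod_fm [OF finite_index_normal_normal [OF N]])
  define \<rho> where "\<rho> i = cb (\<lambda>p x. c [\<one>, p, p \<odot> a x]) \<one> i" for i
  have \<rho>: "\<rho> i \<in> ?B" for i
    unfolding \<rho>_def by (intro cb_closed B.A_zero B.A_diff coch_A [OF c(1)])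
  define ext where "ext u x = (case x of Some j \<Rightarrow> if j < n then u j else 0 | None \<Rightarrow> 0)"
    for u :: "nat \<Rightarrow> 'g list \<Rightarrow> 'm" and x :: "nat option"
  \<comment> \<open>The linear part of the \<open>i\<close>-th relation: the path sum of the lifts
    along \<open>W i\<close>, starting after \<open>t\<close>. With \<open>u\<close> as values this
    is the Fox derivative of the word \<open>w_i\<close>, moved by \<open>t\<close>.\<close>
  define T where "T u i = psum (\<lambda>p x. actf act p (ext u x)) (a None) (W i)" for u i
  define S where "S = ({..<n} \<rightarrow>\<^sub>E ?B)"
  define \<Phi> where "\<Phi> u = (\<lambda>i\<in>{..<n}. \<rho> i + T u i)" for u
  have ext_B: "ext u x \<in> ?B" if "u \<in> S" for u x
    using that by (auto simp: ext_def S_def split: option.split)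
  have T_B: "T u i \<in> ?B" if "u \<in> S" for u i
    unfolding T_def by (intro psum_closed B.A_zero B.A_diff B.act_closed ext_B that)
  have \<Phi>_S: "\<Phi> ` S \<subseteq> S"
    unfolding \<Phi>_def using T_B \<rho> B.A_add by (auto simp: S_def)
  have "finite S"
    unfolding S_def by (intro finite_PiE finite_fm fin N) simp
  moreover have "(\<lambda>i\<in>{..<n}. 0) \<in> S"
    by (simp add: S_def)
  ultimately obtain u0 m where u0: "u0 \<in> S" "m > 0" "(\<Phi> ^^ m) u0 = u0"
    using periodic_point [OF _ \<Phi>_S] by metis
  \<comment> \<open>The periodic orbit indexed by all integers, since heights may be negative;
    reduction modulo the period \<open>m\<close> makes \<open>v (z + 1) = \<Phi> (v z)\<close> hold
    everywhere.\<close>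
  define v where "v z = (\<Phi> ^^ nat (z mod int m)) u0" for z
  have v_S: "v z \<in> S" for z
  proof -
    have "(\<Phi> ^^ k) u0 \<in> S" for k
      using u0(1) \<Phi>_S by (induction k) auto
    then show ?thesis
      by (simp add: v_def)
  qed
  have v_Suc: "v (z + 1) = \<Phi> (v z)" for z
  proof -
    have z: "(z + 1) mod int m = (z mod int m + 1) mod int m" "0 \<le> z mod int m" "z mod int m < int m"
      using u0(2) by (simp_all add: mod_add_left_eq)
    show ?thesis
    proof (cases "z mod int m + 1 = int m")
      case True
      then have "Suc (nat (z mod int m)) = m"
        using z by linarith
      then have "\<Phi> (v z) = (\<Phi> ^^ m) u0"
        unfolding v_def by (metis funpow.simps(2) o_apply)
      then show ?thesis
        using True z by (simp add: v_def u0(3))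
    next
      case False
      then have "(z + 1) mod int m = z mod int m + 1"
        using z by simp
      then have "nat ((z + 1) mod int m) = Suc (nat (z mod int m))"
        using z by simp
      then show ?thesis
        by (simp add: v_def)
    qed
  qed
  \<comment> \<open>The kernel of the height modulo \<open>m\<close> has finite index; over
    \<open>N \<inter> K\<close> a function may depend on the height of a variable modulo the
    period.\<close>
  have "\<exists>K\<in>finite_index_normal G. \<forall>x y. cl K x = cl K y \<longrightarrow> ht (rr x) mod int m = ht (rr y) mod int m"
  proof (rule finite_congruence)
    have "(\<lambda>x. ht x mod int m) ` carrier G \<subseteq> {0..<int m}"
      using u0(2) by auto
    then show "finite ((\<lambda>x. ht x mod int m) ` carrier G)"
      using finite_subset by blast
    show "ht (g \<odot> x \<odot> h) mod int m = ht (g \<odot> y \<odot> h) mod int m"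
      if "ht x mod int m = ht y mod int m" for x y g h
      unfolding ht_mul using that by (metis mod_add_cong)
  qed
  then obtain K where K: "K \<in> finite_index_normal G"
    and ht_K: "\<And>x y. cl K x = cl K y \<Longrightarrow> ht x mod int m = ht y mod int m"
    by auto
  let ?N = "N \<inter> K"
  have NK: "?N \<in> finite_index_normal G"
    by (rule finite_index_normal_Int [OF N K])
  note subs = finite_index_normal_subgroup [OF N] finite_index_normal_subgroup [OF NK]
    finite_index_normal_subgroup [OF K]
  \<comment> \<open>The height of the first function variable selects the member of the orbit.
    Translation by \<open>p\<close> changes this height by \<open>ht p\<close>, so a single lift
    carries all members of the orbit.\<close>
  define \<kappa> where "\<kappa> x ys = ext (v (ht (hd ys))) x ys" for x ys
  have \<kappa>: "\<kappa> x \<in> fm A q ?N" for x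
  proof (rule fmI)
    have *: "ext (v z) x \<in> ?B" for z
      by (rule ext_B [OF v_S])
    show "\<kappa> x ys = 0" if "length ys \<noteq> q" for ys
      unfolding \<kappa>_def by (rule fm_supp [OF * that])
    show "\<kappa> x ys \<in> A" for ys
      unfolding \<kappa>_def by (rule fm_A [OF *])
    show "\<kappa> x ys = \<kappa> x ys'" if eq: "map (cl ?N) ys = map (cl ?N) ys'" for ys ys'
    proof (cases "ys = []")
      case True
      then show ?thesis
        using eq by simp
    next
      case False
      then have "cl ?N (hd ys) = cl ?N (hd ys')"
        using eq by (metis Nil_is_map_conv hd_map)
      then have "ht (hd ys) mod int m = ht (hd ys') mod int m"
        by (intro ht_K) (rule cl_mono [OF subs(2,3) Int_lower2])
      then have "v (ht (hd ys)) = v (ht (hd ys'))"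
        by (simp add: v_def)
      moreover have "ext (v (ht (hd ys'))) x ys = ext (v (ht (hd ys'))) x ys'"
        by (rule fm_cl [OF *], rule map_cl_mono [OF subs(2,1) Int_lower1 eq])
      ultimately show ?thesis
        by (simp add: \<kappa>_def)
    qed
  qed
  have c': "coch (fm A q ?N) (actf act) 3 c"
    by (rule coch_fm_mono [OF subs(1,2) Int_lower1 c(1)])
  have gm: "gmod G (fm A q ?N) (actf act)"
    by (rule gmod_fm [OF finite_index_normal_normal [OF NK]])
  interpret M: gmod G "fm A q ?N" "actf act"
    by (rule gm)
  have "\<exists>h. coch (fm A q ?N) (actf act) 2 h \<and> del h = c"
  proof (rule coboundary_if_cells [OF gm c' c(2) \<kappa>])
    fix i
    assume i: "i < n"
    have "cb (\<lambda>p x. actf act p (\<kappa> x)) \<one> i ys = \<rho> i ys" for ys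
    proof (cases "length ys = q")
      case False
      have "cb (\<lambda>p x. actf act p (\<kappa> x)) \<one> i \<in> fm A q ?N"
        by (intro cb_closed M.A_zero M.A_diff M.act_closed \<kappa>)
      then show ?thesis
        using fm_supp [OF _ False] fm_supp [OF \<rho> False] by metis
    next
      case True
      then have ys: "ys \<noteq> []"
        using q by auto
      define z where "z = ht (hd ys)"
      have shift: "actf act p (\<kappa> x) ys = actf act p (ext (v (z - ht p)) x) ys" for p x
        using hd_map [OF ys, of "(\<odot>) (iv p)"] by (simp add: actf_def \<kappa>_def z_def ht_mul ht_iv)
      have none: "ext w None = 0" for w
        by (simp add: ext_def)
      \<comment> \<open>Every vertex of this path has height 1, hence all its lifts are taken from
        \<open>v (z - 1)\<close>, while the edge \<open>x_i\<close> at the identity uses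
        \<open>v z\<close>. The relation becomes the recursion from \<open>z - 1\<close> to
        \<open>z\<close>.\<close>
      have "psum (\<lambda>p x. actf act p (\<kappa> x) ys) (a None) (W i) =
          psum (\<lambda>p x. actf act p (ext (v (z - 1)) x) ys) (a None) (W i)"
        by (rule psum_W_cong [of 1]) (simp_all add: shift W_words [OF i] ht_a)
      also have "\<dots> = T (v (z - 1)) i ys"
        by (simp only: T_def psum_apply)
      finally have "psum (\<lambda>p x. actf act p (\<kappa> x)) (a None) (W i) ys = T (v (z - 1)) i ys"
        by (simp only: psum_apply)
      then have "cb (\<lambda>p x. actf act p (\<kappa> x)) \<one> i ys =
          actf act \<one> (ext (v z) (Some i)) ys - T (v (z - 1)) i ys"
        unfolding cb_def by (simp add: shift none)
      also have "actf act \<one> (ext (v z) (Some i)) = v z i"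
        unfolding B.act_one [OF ext_B [OF v_S]] by (simp add: ext_def i)
      also have "v z i = \<rho> i + T (v (z - 1)) i"
        using v_Suc [of "z - 1"] i by (simp add: \<Phi>_def)
      finally show ?thesis
        by simp
    qed
    then show "cb (\<lambda>p x. actf act p (\<kappa> x)) \<one> i = cb (\<lambda>p x. c [\<one>, p, p \<odot> a x]) \<one> i"
      unfolding \<rho>_def by (rule ext)
  qed
  with NK show ?thesis
    by blast
qed

text \<open>\<open>m\<close> variables mean degree \<open>m - 1\<close>. For
  \<open>m \<ge> 4\<close> the module \<open>fm A q N\<close> itself serves as coefficients and
  \<open>N\<close> is kept; in degrees 1 and 2 it shrinks.\<close>

lemma coinduced_exact:
  fixes A :: "'m::ab_group_add set" and act :: "'g \<Rightarrow> 'm \<Rightarrow> 'm"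
  assumes "gmod G A act" and "finite A" and N: "N \<in> finite_index_normal G" and "q \<ge> 1" "m \<ge> 2"
    and c: "coch (fm A q N) (actf act) m c" "del c = 0"
  shows "\<exists>N'\<in>finite_index_normal G. \<exists>H. coch (fm A q N') (actf act) (m - 1) H \<and> del H = c"
proof -
  interpret gmod G A act by fact
  consider "m = 2" | "m = 3" | "m \<ge> 4"
    using \<open>m \<ge> 2\<close> by linarith
  then show ?thesis
  proof cases
    case 1
    then show ?thesis
      using coinduced_exact_1 [OF assms(2-4)] c by simp
  next
    case 2
    then show ?thesis
      using coinduced_exact_2 [OF assms(1-4)] c by simp
  next
    case 3
    then show ?thesis
      using vanishing_ge_3 [OF gmod_fm [OF finite_index_normal_normal [OF N]] c 3] N by blast
  qed
qed

end

text \<open>The shift with \<open>m0 = 1\<close>: it descends to degree 0, where every cochain with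
  values in \<open>fm A q N\<close> is locally constant. The column exactness of \<open>K\<close> is
  \<open>coinduced_exact\<close>; that of \<open>L\<close> is the copying of variables, which local
  constancy permits.\<close>

lemma (in hnn) locally_constant_representative:
  fixes A :: "'m::ab_group_add set" and act :: "'g \<Rightarrow> 'm \<Rightarrow> 'm"
  assumes "gmod G A act" and fin: "finite A" and F: "coch A act m F" and m: "m \<ge> 2"
    and dF: "\<exists>N\<in>finite_index_normal G. factors_through (map (cl N)) (del F)"
  shows "\<exists>H. coch A act (m - 1) H \<and>
    (\<exists>N\<in>finite_index_normal G. factors_through (map (cl N)) (F - del H))"
proof -
  interpret gmod G A act by fact
  note sub = finite_index_normal_subgroup and nor = finite_index_normal_normal
  have gm: "gmod G (fm A q N) (actf act)" if "N \<in> finite_index_normal G" for q N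
    by (rule gmod_fm [OF nor [OF that]])
  \<comment> \<open>Both complexes are unions over all \<open>N\<close> of finite index, so
    \<open>N\<close> may shrink from step to step. In \<open>K\<close> only the function variables
    are seen through \<open>N\<close>, in \<open>L\<close> the group variables as well.\<close>
  define K where "K m q F \<longleftrightarrow> (\<exists>N\<in>finite_index_normal G. coch (fm A q N) (actf act) m F) \<and>
    (m = 0 \<longrightarrow> F = 0)" for m q F
  define L where "L m q F \<longleftrightarrow> (\<exists>N\<in>finite_index_normal G. coch (fm A q N) (actf act) m F \<and>
    factors_through (map (cl N)) F) \<and> (m = 0 \<longrightarrow> F = 0)" for m q F
  have KI: "K m q F" if "N \<in> finite_index_normal G" "coch (fm A q N) (actf act) m F" "m = 0 \<Longrightarrow> F = 0"
    for m q N F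
    unfolding K_def using that by (intro conjI impI bexI [of _ N])
  have LI: "L m q F" if "N \<in> finite_index_normal G" "coch (fm A q N) (actf act) m F"
      "factors_through (map (cl N)) F" "m = 0 \<Longrightarrow> F = 0"
    for m q N F
    unfolding L_def using that by (intro conjI impI bexI [of _ N])
  have KD: "\<exists>N. N \<in> finite_index_normal G \<and> coch (fm A q N) (actf act) m F" if "K m q F" for m q F
    using that unfolding K_def by (elim conjE bexE) (intro exI conjI)
  have LD: "\<exists>N. N \<in> finite_index_normal G \<and> coch (fm A q N) (actf act) m F \<and>
      factors_through (map (cl N)) F" if "L m q F" for m q F
    using that unfolding L_def by (elim conjE bexE) (intro exI conjI)
  have K0: "m = 0 \<Longrightarrow> F = 0" if "K m q F" for m q F
    using that unfolding K_def by (elim conjE impE)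
  have L0: "m = 0 \<Longrightarrow> F = 0" if "L m q F" for m q F
    using that unfolding L_def by (elim conjE impE)
  have "\<exists>H. K (m - 1) 1 H \<and> bd H = 0 \<and> L m 1 (const1 F - del H)"
  proof (rule double_complex_shift [of L K 1])
    show "K m q F" if "L m q F" for m q F
      using LD [OF that] L0 [OF that] by (elim exE conjE) (rule KI)
    show "K m q (F - H)" if FH: "K m q F" "K m q H" for m q F H
    proof -
      obtain N N' where N: "N \<in> finite_index_normal G" "coch (fm A q N) (actf act) m F"
        and N': "N' \<in> finite_index_normal G" "coch (fm A q N') (actf act) m H"
        using KD [OF FH(1)] KD [OF FH(2)] by blast
      note NN = finite_index_normal_Int [OF N(1) N'(1)]
      have "coch (fm A q (N \<inter> N')) (actf act) m (F - H)"
        by (intro gmod.coch_diff [OF gm [OF NN]] coch_fm_mono [OF sub [OF N(1)] sub [OF NN] _ N(2)]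
            coch_fm_mono [OF sub [OF N'(1)] sub [OF NN] _ N'(2)]) auto
      then show ?thesis
        by (rule KI [OF NN]) (simp add: K0 [OF FH(1)] K0 [OF FH(2)])
    qed
    show "L m q (F - H)" if FH: "L m q F" "L m q H" for m q F H
    proof -
      obtain N N' where N: "N \<in> finite_index_normal G" "coch (fm A q N) (actf act) m F"
          "factors_through (map (cl N)) F"
        and N': "N' \<in> finite_index_normal G" "coch (fm A q N') (actf act) m H"
          "factors_through (map (cl N')) H"
        using LD [OF FH(1)] LD [OF FH(2)] by blast
      note NN = finite_index_normal_Int [OF N(1) N'(1)]
      have "coch (fm A q (N \<inter> N')) (actf act) m (F - H)"
        by (intro gmod.coch_diff [OF gm [OF NN]] coch_fm_mono [OF sub [OF N(1)] sub [OF NN] _ N(2)]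
            coch_fm_mono [OF sub [OF N'(1)] sub [OF NN] _ N'(2)]) auto
      moreover have "factors_through (map (cl (N \<inter> N'))) (F - H)"
      proof (rule factors_throughI)
        fix xs ys
        assume *: "map (cl (N \<inter> N')) xs = map (cl (N \<inter> N')) ys"
        have "F xs = F ys"
          by (rule factors_throughD [OF N(3) map_cl_mono [OF sub [OF NN] sub [OF N(1)] Int_lower1 *]])
        moreover have "H xs = H ys"
          by (rule factors_throughD [OF N'(3) map_cl_mono [OF sub [OF NN] sub [OF N'(1)] Int_lower2 *]])
        ultimately show "(F - H) xs = (F - H) ys"
          by simp
      qed
      ultimately show ?thesis
        by (rule LI [OF NN]) (simp add: L0 [OF FH(1)] L0 [OF FH(2)])
    qed
    show "L m q 0" for m q
    proof -
      have "coch (fm A q (carrier G)) (actf act) m 0"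
        by (rule gmod.coch_0 [OF gm [OF finite_index_normal_UNIV]])
      moreover have "factors_through (map (cl (carrier G))) 0"
        by (rule factors_throughI) simp
      ultimately show ?thesis
        by (rule LI [OF finite_index_normal_UNIV]) (rule HOL.refl)
    qed
    show "K (Suc m) q (del F)" if KF: "K m q F" for m q F
    proof -
      obtain N where N: "N \<in> finite_index_normal G" "coch (fm A q N) (actf act) m F"
        using KD [OF KF] by blast
      show ?thesis
        by (rule KI [OF N(1) gmod.coch_del [OF gm [OF N(1)] N(2)]]) simp
    qed
    show "L (Suc m) q (del F)" if LF: "L m q F" for m q F
    proof -
      obtain N where N: "N \<in> finite_index_normal G" "coch (fm A q N) (actf act) m F"
          "factors_through (map (cl N)) F"
        using LD [OF LF] by blast
      have "factors_through (map (cl N)) (del F)"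
        by (rule factors_throughI, rule del_map_cong, rule factors_throughD [OF N(3)])
      then show ?thesis
        by (rule LI [OF N(1) gmod.coch_del [OF gm [OF N(1)] N(2)]]) simp
    qed
    show "K m (Suc q) (bd F)" if KF: "K m q F" for m q F
    proof -
      obtain N where N: "N \<in> finite_index_normal G" "coch (fm A q N) (actf act) m F"
        using KD [OF KF] by blast
      show ?thesis
        by (rule KI [OF N(1) coch_bd [OF N(2)]]) (simp add: K0 [OF KF] bd_zero)
    qed
    show "L m (Suc q) (bd F)" if LF: "L m q F" for m q F
    proof -
      obtain N where N: "N \<in> finite_index_normal G" "coch (fm A q N) (actf act) m F"
          "factors_through (map (cl N)) F"
        using LD [OF LF] by blast
      have "factors_through (map (cl N)) (bd F)"
        unfolding bd_def
        by (rule factors_throughI, rule arg_cong [where f = del], rule factors_throughD [OF N(3)])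
      then show ?thesis
        by (rule LI [OF N(1) coch_bd [OF N(2)]]) (simp add: L0 [OF LF] bd_zero)
    qed
    show "\<exists>H. K m q H \<and> bd H = F" if F: "K m (Suc q) F" "bd F = 0" for m q F
    proof -
      obtain N where N: "N \<in> finite_index_normal G" "coch (fm A (Suc q) N) (actf act) m F"
        using KD [OF F(1)] by blast
      have "coch (fm A q N) (actf act) m (\<lambda>gs ys. F gs (hd gs # ys))"
        by (rule coch_insert_y [OF N(2) nor [OF N(1)] K0 [OF F(1)]])
      then have "K m q (\<lambda>gs ys. F gs (hd gs # ys))"
        by (rule KI [OF N(1)]) (simp add: K0 [OF F(1)] fun_eq_iff)
      then show ?thesis
        using bd_insert_y [OF F(2)] by (intro exI [where x = "\<lambda>gs ys. F gs (hd gs # ys)"] conjI)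
    qed
    show "\<exists>H. L m q H \<and> bd H = F" if F: "L m (Suc q) F" "bd F = 0" for m q F
    proof -
      obtain N where N: "N \<in> finite_index_normal G" "coch (fm A (Suc q) N) (actf act) m F"
          "factors_through (map (cl N)) F"
        using LD [OF F(1)] by blast
      have "coch (fm A q N) (actf act) m (\<lambda>gs ys. F gs (hd gs # ys))"
        by (rule coch_insert_y [OF N(2) nor [OF N(1)] L0 [OF F(1)]])
      moreover have "factors_through (map (cl N)) (\<lambda>gs ys. F gs (hd gs # ys))"
      proof (rule factors_throughI)
        fix xs xs'
        assume *: "map (cl N) xs = map (cl N) xs'"
        then have "F xs = F xs'"
          by (rule factors_throughD [OF N(3)])
        moreover have "F xs' (hd xs # ys) = F xs' (hd xs' # ys)" for ys
        proof (cases "xs = []")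
          case True
          with * show ?thesis
            by simp
        next
          case False
          then have "cl N (hd xs) = cl N (hd xs')"
            using * by (metis Nil_is_map_conv hd_map)
          then show ?thesis
            by (intro fm_cl [OF coch_A [OF N(2)]]) simp
        qed
        ultimately show "(\<lambda>ys. F xs (hd xs # ys)) = (\<lambda>ys. F xs' (hd xs' # ys))"
          by simp
      qed
      ultimately have "L m q (\<lambda>gs ys. F gs (hd gs # ys))"
        by (rule LI [OF N(1)]) (simp add: L0 [OF F(1)] fun_eq_iff)
      then show ?thesis
        using bd_insert_y [OF F(2)] by (intro exI [where x = "\<lambda>gs ys. F gs (hd gs # ys)"] conjI)
    qed
    show "\<exists>H. L m q H \<and> del H = F" if q: "q \<ge> 1" "m \<ge> 1" and F: "L (Suc m) q F" "del F = 0" for m q F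
    proof -
      obtain N where N: "N \<in> finite_index_normal G" "coch (fm A q N) (actf act) (Suc m) F"
          "factors_through (map (cl N)) F"
        using LD [OF F(1)] by blast
      have "coch (fm A q N) (actf act) m (\<lambda>gs ys. F (hd ys # gs) ys)"
      proof (rule coch_insert_g [OF N(2) q(1) nor [OF N(1)] sub [OF N(1)] subset_refl])
        show "F (y # gs) = F (y' # gs)" if "cl N y = cl N y'" for y y' gs
          by (rule factors_throughD [OF N(3)]) (simp add: that)
      qed
      moreover have "factors_through (map (cl N)) (\<lambda>gs ys. F (hd ys # gs) ys)"
      proof (rule factors_throughI)
        fix xs xs'
        assume *: "map (cl N) xs = map (cl N) xs'"
        have "F (y # xs) = F (y # xs')" for y
          by (rule factors_throughD [OF N(3)]) (simp add: *)
        then show "(\<lambda>ys. F (hd ys # xs) ys) = (\<lambda>ys. F (hd ys # xs') ys)"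
          by simp
      qed
      ultimately have "L m q (\<lambda>gs ys. F (hd ys # gs) ys)"
        by (rule LI [OF N(1)]) (use q(2) in simp)
      then show ?thesis
        using del_insert_g [OF N(2) F(2)]
        by (intro exI [where x = "\<lambda>gs ys. F (hd ys # gs) ys"] conjI)
    qed
    show "\<exists>H. K (m - 1) q H \<and> del H = F" if "q \<ge> 1" "m > 1" and F: "K m q F" "del F = 0" for m q F
    proof -
      obtain N where N: "N \<in> finite_index_normal G" "coch (fm A q N) (actf act) m F"
        using KD [OF F(1)] by blast
      have "m \<ge> 2"
        using \<open>m > 1\<close> by simp
      from coinduced_exact [OF \<open>gmod G A act\<close> fin N(1) \<open>q \<ge> 1\<close> this N(2) F(2)]
      obtain N' H where H: "N' \<in> finite_index_normal G" "coch (fm A q N') (actf act) (m - 1) H" "del H = F"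
        by (elim bexE exE conjE)
      have "K (m - 1) q H"
        by (rule KI [OF H(1,2)]) (use \<open>m > 1\<close> in simp)
      then show ?thesis
        using H(3) by (intro exI conjI)
    qed
    \<comment> \<open>In degree 0 equivariance gives \<open>F [x] = x F [\<one>]\<close>. The
      function \<open>F [\<one>]\<close> factors through \<open>N\<close> and the finite module is
      acted on through the quotient by \<open>N0\<close>, so \<open>F\<close> itself lies in
      \<open>L\<close> and no correction is made.\<close>
    show "\<exists>H. K (1 - 1) q H \<and> bd H = 0 \<and> L 1 q (F - del H)" if F: "K 1 q F" for q F
    proof -
      obtain N where N: "N \<in> finite_index_normal G" "coch (fm A q N) (actf act) 1 F"
        using KD [OF F(1)] by blast
      obtain N0 where N0: "N0 \<in> finite_index_normal G"
        and act_cl: "\<And>g h a. cl N0 g = cl N0 h \<Longrightarrow> a \<in> A \<Longrightarrow> act g a = act h a"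
        using finite_action_kernel [OF fin] by blast
      note NN = finite_index_normal_Int [OF N(1) N0]
      have F_one: "F [x] ys = act x (F [\<one>] (map ((\<odot>) (iv x)) ys))" for x ys
      proof -
        have "F [x] = F (map ((\<odot>) x) [\<one>])"
          by (rule gmod.coch_cong [OF gm [OF N(1)] N(2)]) simp
        also have "\<dots> = actf act x (F [\<one>])"
          by (rule coch_equiv [OF N(2)])
        finally show ?thesis
          by (simp add: actf_def)
      qed
      have F_cl: "F [x] = F [x']" if "cl (N \<inter> N0) x = cl (N \<inter> N0) x'" for x x'
      proof
        fix ys
        have "cl N x = cl N x'"
          by (rule cl_mono [OF sub [OF NN] sub [OF N(1)] Int_lower1 that])
        then have "F [\<one>] (map ((\<odot>) (iv x)) ys) = F [\<one>] (map ((\<odot>) (iv x')) ys)"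
          by (intro fm_cl [OF coch_A [OF N(2)]] map_cl_mul [OF nor [OF N(1)] HOL.refl] cl_iv [OF nor [OF N(1)]])
        moreover have "cl N0 x = cl N0 x'"
          by (rule cl_mono [OF sub [OF NN] sub [OF N0] Int_lower2 that])
        then have "act x b = act x' b" if "b \<in> A" for b
          using that by (rule act_cl)
        ultimately have "act x (F [\<one>] (map ((\<odot>) (iv x)) ys)) = act x' (F [\<one>] (map ((\<odot>) (iv x')) ys))"
          using fm_A [OF coch_A [OF N(2)]] by simp
        then show "F [x] ys = F [x'] ys"
          unfolding F_one [of x] F_one [of x'] .
      qed
      have "factors_through (map (cl (N \<inter> N0))) F"
      proof (rule factors_throughI)
        fix xs xs'
        assume *: "map (cl (N \<inter> N0)) xs = map (cl (N \<inter> N0)) xs'"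
        then have len: "length xs = length xs'"
          by (rule map_eq_imp_length_eq)
        show "F xs = F xs'"
        proof (cases "length xs = 1")
          case True
          then obtain x x' where xs: "xs = [x]" "xs' = [x']"
            using len by (auto simp: length_Suc_conv)
          have "cl (N \<inter> N0) x = cl (N \<inter> N0) x'"
            using * by (simp add: xs)
          then show ?thesis
            unfolding xs by (rule F_cl)
        next
          case False
          then show ?thesis
            using len coch_supp [OF N(2)] by simp
        qed
      qed
      then have "L 1 q F"
        by (rule LI [OF NN coch_fm_mono [OF sub [OF N(1)] sub [OF NN] Int_lower1 N(2)]]) simp
      moreover have "K 0 q 0"
        by (rule KI [OF NN gmod.coch_0 [OF gm [OF NN]]]) (rule HOL.refl)
      ultimately show ?thesis
        by (intro exI [of _ 0]) (simp add: bd_zero del_fun_zero)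
    qed
    show "K m 1 (const1 F)"
      by (rule KI [OF finite_index_normal_UNIV coch_const1 [OF F]]) (use m in simp)
    obtain N where N: "N \<in> finite_index_normal G" "factors_through (map (cl N)) (del F)"
      using dF by blast
    have *: "del (const1 F) = const1 (del F)"
    proof (intro ext)
      show "del (const1 F) gs ys = const1 (del F) gs ys" for gs ys
        by (cases "length ys = 1") (simp_all add: del_apply [of "const1 F"] const1_def del_zero)
    qed
    have "factors_through (map (cl N)) (const1 (del F))"
    proof (rule factors_throughI)
      fix xs xs'
      assume "map (cl N) xs = map (cl N) xs'"
      then have "del F xs = del F xs'"
        by (rule factors_throughD [OF N(2)])
      then show "const1 (del F) xs = const1 (del F) xs'"
        by (simp add: const1_def fun_eq_iff)
    qed
    then show "L (Suc m) 1 (del (const1 F))"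
      unfolding * by (rule LI [OF N(1) coch_const1 [OF coch_del [OF F]]]) simp
  qed (use m in \<open>simp_all add: bd_const1\<close>)
  then obtain H where H: "K (m - 1) 1 H" "bd H = 0" "L m 1 (const1 F - del H)"
    by (elim exE conjE)
  obtain N where N: "coch (fm A 1 N) (actf act) (m - 1) H"
    using KD [OF H(1)] by blast
  obtain N' where N': "N' \<in> finite_index_normal G" "factors_through (map (cl N')) (const1 F - del H)"
    using LD [OF H(3)] by blast
  \<comment> \<open>As \<open>H\<close> is constant in the function variable, evaluation at
    \<open>[\<one>]\<close> brings the decomposition back to coefficients in
    \<open>A\<close>.\<close>
  have "factors_through (map (cl N')) (F - del (\<lambda>gs. H gs [\<one>]))"
  proof (rule factors_throughI)
    fix xs xs'
    assume "map (cl N') xs = map (cl N') xs'"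
    then have "(const1 F - del H) xs = (const1 F - del H) xs'"
      by (rule factors_throughD [OF N'(2)])
    then have "(const1 F - del H) xs [\<one>] = (const1 F - del H) xs' [\<one>]"
      by (rule fun_cong)
    then show "(F - del (\<lambda>gs. H gs [\<one>])) xs = (F - del (\<lambda>gs. H gs [\<one>])) xs'"
      by (simp add: del_eval const1_def)
  qed
  then show ?thesis
    using coch_eval [OF N H(2)] N'(1) by blast
qed

section \<open>Words and presentations\<close>

lemma words_Nil: "[] \<in> words X"
  and words_Cons: "l # w \<in> words X \<longleftrightarrow> fst l \<in> X \<and> w \<in> words X"
  and words_append_iff: "u @ v \<in> words X \<longleftrightarrow> u \<in> words X \<and> v \<in> words X"
  by (auto simp: words_def mem_Times_iff)

lemma word_inv_words: "w \<in> words X \<Longrightarrow> word_inv w \<in> words X"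
  by (induction w) (auto simp: word_inv_def words_def)

lemma word_inv_word_inv: "word_inv (word_inv w) = w"
  by (simp add: word_inv_def rev_map o_def split_beta)

lemma word_eq_words:
  assumes "R \<subseteq> words X" "word_eq X R u v"
  shows "u \<in> words X \<and> v \<in> words X"
  using assms(2,1) by induction (auto simp: words_Nil words_Cons words_append_iff)

lemma word_eq_context:
  assumes "word_eq X R u v" "p \<in> words X" "q \<in> words X"
  shows "word_eq X R (p @ u @ q) (p @ v @ q)"
  using assms
proof induction
  case (refl u)
  then show ?case by (intro word_eq.refl) (simp add: words_append_iff)
next
  case (sym u v)
  then show ?case by (blast intro: word_eq.sym)
next
  case (trans u v w)
  then show ?case by (blast intro: word_eq.trans)
next
  case (cancel u v x b)
  then have "word_eq X R ((p @ u) @ [(x, b), (x, \<not> b)] @ (v @ q)) ((p @ u) @ (v @ q))"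
    by (intro word_eq.cancel) (simp_all add: words_append_iff)
  then show ?case by simp
next
  case (relator u v r)
  then have "word_eq X R ((p @ u) @ r @ (v @ q)) ((p @ u) @ (v @ q))"
    by (intro word_eq.relator) (simp_all add: words_append_iff)
  then show ?case by simp
qed

lemma word_eq_append:
  assumes R: "R \<subseteq> words X" and "word_eq X R u u'" "word_eq X R v v'"
  shows "word_eq X R (u @ v) (u' @ v')"
proof -
  have "word_eq X R ([] @ u @ v) ([] @ u' @ v)"
    using word_eq_words [OF R assms(3)] by (intro word_eq_context assms(2) words_Nil) simp
  moreover have "word_eq X R (u' @ v @ []) (u' @ v' @ [])"
    using word_eq_words [OF R assms(2)] by (intro word_eq_context assms(3) words_Nil) simp
  ultimately show ?thesis
    using word_eq.trans by fastforce
qed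

lemma word_class_eq_iff:
  assumes "v \<in> words X"
  shows "word_class X R u = word_class X R v \<longleftrightarrow> word_eq X R u v"
proof
  assume *: "word_class X R u = word_class X R v"
  have "v \<in> word_class X R v"
    unfolding word_class_def using word_eq.refl [OF assms] by simp
  then show "word_eq X R u v"
    unfolding * [symmetric] by (simp add: word_class_def)
next
  assume *: "word_eq X R u v"
  show "word_class X R u = word_class X R v"
    unfolding word_class_def using word_eq.trans word_eq.sym [OF *] * by blast
qed

lemma presented_group_mult:
  assumes R: "R \<subseteq> words X" and uv: "u \<in> words X" "v \<in> words X"
  shows "word_class X R u \<otimes>\<^bsub>presented_group X R\<^esub> word_class X R v = word_class X R (u @ v)"
proof -
  have *: "word_class X R (u' @ v') = word_class X R (u @ v)"
    if "u' \<in> word_class X R u" "v' \<in> word_class X R v" for u' v'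
  proof -
    have "word_eq X R (u' @ v') (u @ v)"
      using that by (intro word_eq_append [OF R]) (simp_all add: word_class_def word_eq.sym)
    then show ?thesis
      using uv by (subst word_class_eq_iff) (simp_all add: words_append_iff)
  qed
  have "u \<in> word_class X R u" "v \<in> word_class X R v"
    using uv by (simp_all add: word_class_def word_eq.refl)
  then have "(\<Union>u'\<in>word_class X R u. \<Union>v'\<in>word_class X R v. word_class X R (u' @ v')) =
      word_class X R (u @ v)"
    by (intro UN_constant_eq ballI *)
  then show ?thesis
    by (simp add: presented_group_def)
qed

lemma words_map_Some: "w \<in> words Y \<Longrightarrow> map (map_prod Some id) w \<in> words (Some ` Y)"
  by (induction w) (auto simp: words_def)

lemma word_eq_map_Some:
  assumes "word_eq Y {} u v"
  shows "word_eq (insert None (Some ` Y)) {} (map (map_prod Some id) u) (map (map_prod Some id) v)"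
proof -
  have w: "map (map_prod Some id) w \<in> words (insert None (Some ` Y))" if "w \<in> words Y" for w
    using words_map_Some [OF that] by (auto simp: words_def)
  show ?thesis
    using assms
  proof induction
    case (cancel u v x b)
    then show ?case
      using word_eq.cancel [OF w w, of u v "Some x" "{}" b] by (simp add: id_def)
  next
    case (refl u)
    show ?case
      by (rule word_eq.refl, rule w, rule refl)
  next
    case (sym u v)
    show ?case
      by (rule word_eq.sym, rule sym)
  next
    case (trans u v w)
    show ?case
      by (rule word_eq.trans, rule trans, rule trans)
  qed simp
qed

text \<open>One representing word is fixed for each image of a generator. The isomorphism turns
  surjectivity onto the classes of words into \<open>gen\<close> and equality of classes into
  \<open>complete\<close>, after which only walks in the Cayley graph are used.\<close>

lemma ascending_HNN_hnn:
  assumes "group \<Gamma>" and \<phi>: "\<phi> \<in> hom (free_group {..<n}) (free_group {..<n})"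
    and iso: "\<Gamma> \<cong> ascending_HNN n \<phi>"
  shows "\<exists>a W R. hnn \<Gamma> a n W R"
proof -
  interpret group \<Gamma> by fact
  define X where "X = insert None (Some ` {..<n})"
  define R where "R = {[(None, False), (Some i, True), (None, True)] @ word_inv (map (map_prod Some id) w) | i w.
         i < n \<and> w \<in> \<phi> (free_generator {..<n} i)}"
  define P where "P = presented_group X R"
  have P: "ascending_HNN n \<phi> = P"
    by (simp add: ascending_HNN_def P_def X_def R_def)
  have "\<exists>v \<in> words {..<n}. \<phi> (free_generator {..<n} i) = word_class {..<n} {} v" if "i < n" for i
  proof -
    have "free_generator {..<n} i \<in> carrier (free_group {..<n})"
      using that by (auto simp: free_generator_def free_group_def presented_group_def words_def)
    then have "\<phi> (free_generator {..<n} i) \<in> carrier (free_group {..<n})"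
      using \<phi> by (auto simp: hom_def)
    then show ?thesis
      by (auto simp: free_group_def presented_group_def)
  qed
  then obtain w where w: "\<And>i. i < n \<Longrightarrow> w i \<in> words {..<n}"
    and \<phi>_w: "\<And>i. i < n \<Longrightarrow> \<phi> (free_generator {..<n} i) = word_class {..<n} {} (w i)"
    by metis
  define W where "W i = map (map_prod Some id) (w i)" for i
  have R_in: "[(None, False), (Some i, True), (None, True)] @ word_inv (W i) \<in> R" if "i < n" for i
    unfolding R_def W_def using that w word_eq.refl by (fastforce simp: \<phi>_w word_class_def)
  have R_form: "\<exists>i v. i < n \<and> r = [(None, False), (Some i, True), (None, True)] @ word_inv v \<and>
      word_eq X {} v (W i) \<and> v \<in> words X" if "r \<in> R" for r
  proof -
    obtain i v where i: "i < n" and r: "r = [(None, False), (Some i, True), (None, True)] @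
        word_inv (map (map_prod Some id) v)" and v: "word_eq {..<n} {} (w i) v"
      using \<open>r \<in> R\<close> \<phi>_w by (auto simp: R_def word_class_def)
    have "word_eq X {} (map (map_prod Some id) v) (W i)"
      unfolding W_def X_def by (rule word_eq_map_Some, rule word_eq.sym, rule v)
    moreover from this have "map (map_prod Some id) v \<in> words X"
      using word_eq_words [OF empty_subsetI] by blast
    ultimately show ?thesis
      using i r by blast
  qed
  have R: "R \<subseteq> words X"
  proof
    fix r assume "r \<in> R"
    from R_form [OF this] show "r \<in> words X"
      using word_inv_words by (auto simp: words_Cons words_Nil X_def)
  qed
  obtain h where hom: "h \<in> hom \<Gamma> P" and bij: "bij_betw h (carrier \<Gamma>) (carrier P)"
    using iso by (auto simp: is_iso_def iso_def P)
  have inj: "x = y" if "h x = h y" "x \<in> carrier \<Gamma>" "y \<in> carrier \<Gamma>" for x y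
    using bij that by (auto simp: bij_betw_def inj_on_def)
  let ?c = "word_class X R"
  have ex: "\<exists>x \<in> carrier \<Gamma>. h x = ?c u" if "u \<in> words X" for u
  proof -
    have "?c u \<in> carrier P"
      using that by (simp add: P_def presented_group_def)
    then have "?c u \<in> h ` carrier \<Gamma>"
      using bij by (simp add: bij_betw_def)
    then obtain x where "?c u = h x" "x \<in> carrier \<Gamma>"
      by (rule imageE)
    then show ?thesis
      by (intro bexI [of _ x]) simp_all
  qed
  have h_mult: "h (x \<otimes>\<^bsub>\<Gamma>\<^esub> y) = ?c (u @ v)"
    if "x \<in> carrier \<Gamma>" "y \<in> carrier \<Gamma>" "h x = ?c u" "h y = ?c v" "u \<in> words X" "v \<in> words X" for x y u v
    using hom that presented_group_mult [OF R, of u v] by (simp add: hom_def P_def)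
  have h_one: "h \<one>\<^bsub>\<Gamma>\<^esub> = ?c []"
  proof -
    obtain e where e: "e \<in> carrier \<Gamma>" "h e = ?c []"
      using ex [OF words_Nil] by blast
    have "h (e \<otimes>\<^bsub>\<Gamma>\<^esub> e) = h e"
      using h_mult [OF e(1) e(1) e(2) e(2) words_Nil words_Nil] e by simp
    then have "e \<otimes>\<^bsub>\<Gamma>\<^esub> e = e"
      using e by (intro inj) auto
    then have "e = \<one>\<^bsub>\<Gamma>\<^esub>"
      using e by simp
    then show ?thesis
      using e by simp
  qed
  \<comment> \<open>The locale wants a value in the group for every index of the type, hence the
    identity for indices that are no generators.\<close>
  define a where "a x = (if x \<in> X then SOME g. g \<in> carrier \<Gamma> \<and> h g = ?c [(x, True)] else \<one>\<^bsub>\<Gamma>\<^esub>)" for x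
  have a: "a x \<in> carrier \<Gamma> \<and> h (a x) = ?c [(x, True)]" if "x \<in> X" for x
    unfolding a_def if_P [OF that]
    by (rule someI_ex) (use ex [of "[(x, True)]"] that in \<open>auto simp: words_Cons words_Nil\<close>)
  have a_closed: "a x \<in> carrier \<Gamma>" for x
    using a by (cases "x \<in> X") (auto simp: a_def)
  have a_inv: "h (inv\<^bsub>\<Gamma>\<^esub> a x) = ?c [(x, False)]" if x: "x \<in> X" for x
  proof -
    have xw: "[(x, b)] \<in> words X" for b
      using x by (simp add: words_Cons words_Nil)
    obtain b where b: "b \<in> carrier \<Gamma>" "h b = ?c [(x, False)]"
      using ex [OF xw, of False] by blast
    have "h (a x \<otimes>\<^bsub>\<Gamma>\<^esub> b) = ?c ([(x, True)] @ [(x, False)])"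
      using a [OF x] b xw by (intro h_mult) auto
    also have "\<dots> = ?c []"
      using word_eq.cancel [OF words_Nil words_Nil x, of R True] by (subst word_class_eq_iff) (simp_all add: words_Nil)
    finally have "h (a x \<otimes>\<^bsub>\<Gamma>\<^esub> b) = h \<one>\<^bsub>\<Gamma>\<^esub>"
      by (simp add: h_one)
    then have "a x \<otimes>\<^bsub>\<Gamma>\<^esub> b = \<one>\<^bsub>\<Gamma>\<^esub>"
      using a_closed b by (intro inj) auto
    then have "inv\<^bsub>\<Gamma>\<^esub> a x = b"
      using a_closed b inv_equality inv_comm by metis
    then show ?thesis
      using b by simp
  qed
  interpret gens \<Gamma> a
    by unfold_locales (rule a_closed)
  have h_walk: "h (walk p v) = ?c (u @ v)"
    if "p \<in> carrier \<Gamma>" "h p = ?c u" "u \<in> words X" "v \<in> words X" for p u v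
    using that
  proof (induction v arbitrary: p u)
    case (Cons l v)
    obtain x b where l: "l = (x, b)"
      by (cases l)
    have x: "x \<in> X" and v: "v \<in> words X"
      using Cons.prems by (auto simp: words_Cons l)
    have xw: "[(x, b)] \<in> words X"
      using x by (simp add: words_Cons words_Nil)
    have "h (step p l) = ?c (u @ [l])"
      using h_mult [of p "a x" u "[(x, True)]"] h_mult [of p "inv\<^bsub>\<Gamma>\<^esub> a x" u "[(x, False)]"]
        a [OF x] a_inv [OF x] Cons.prems xw
      by (cases b) (simp_all add: l step_def mul_def iv_def words_Cons)
    then show ?case
      using Cons.IH [of "step p l" "u @ [l]"] Cons.prems(3) v xw
      by (simp add: words_append_iff l)
  qed simp
  have h_walk_one: "h (walk \<one>\<^bsub>\<Gamma>\<^esub> v) = ?c v" if "v \<in> words X" for v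
    using h_walk [OF _ h_one words_Nil that] by simp
  have "hnn \<Gamma> a n W R"
  proof
    show "W i \<in> words (Some ` {..<n})" if "i < n" for i
      unfolding W_def by (rule words_map_Some, rule w [OF that])
    show "\<exists>i v. i < n \<and> r = [(None, False), (Some i, True), (None, True)] @ word_inv v \<and>
        word_eq (insert None (Some ` {..<n})) {} v (W i)" if "r \<in> R" for r
      using R_form [OF that] by (auto simp: X_def)
    show "\<exists>w\<in>words (insert None (Some ` {..<n})). walk \<one>\<^bsub>\<Gamma>\<^esub> w = p" if p: "p \<in> carrier \<Gamma>" for p
    proof -
      have "h p \<in> carrier P"
        using bij p by (auto simp: bij_betw_def)
      then obtain v where v: "v \<in> words X" "h p = ?c v"
        by (auto simp: P_def presented_group_def)
      then have "walk \<one>\<^bsub>\<Gamma>\<^esub> v = p"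
        using p by (intro inj) (simp_all add: h_walk_one)
      then show ?thesis
        using v by (auto simp: X_def)
    qed
    show "word_eq (insert None (Some ` {..<n})) R u v"
      if "u \<in> words (insert None (Some ` {..<n}))" "v \<in> words (insert None (Some ` {..<n}))"
        "walk \<one>\<^bsub>\<Gamma>\<^esub> u = walk \<one>\<^bsub>\<Gamma>\<^esub> v" for u v
      using h_walk_one [of u] h_walk_one [of v] that word_class_eq_iff [of v X R u] by (simp add: X_def)
    show "mul (a (Some i)) (a None) = mul (a None) (walk \<one>\<^bsub>\<Gamma>\<^esub> (W i))" if i: "i < n" for i
    proof -
      let ?r = "[(None, False), (Some i, True), (None, True)] @ word_inv (W i)"
      let ?q = "mul (mul (iv (a None)) (a (Some i))) (a None)"
      have r: "?r \<in> R"
        by (rule R_in [OF i])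
      have "?c ?r = ?c []"
        using word_eq.relator [OF words_Nil words_Nil r] by (subst word_class_eq_iff) (simp_all add: words_Nil)
      then have "h (walk \<one>\<^bsub>\<Gamma>\<^esub> ?r) = h \<one>\<^bsub>\<Gamma>\<^esub>"
        using h_walk_one [of ?r] r R h_one by auto
      then have "walk \<one>\<^bsub>\<Gamma>\<^esub> ?r = \<one>\<^bsub>\<Gamma>\<^esub>"
        by (intro inj) simp_all
      \<comment> \<open>The first three letters of the relator lead to \<open>?q\<close> and the
        inverse of \<open>W i\<close> leads back. Reversing this last stretch shows that
        \<open>W i\<close> leads from the identity to \<open>?q\<close>.\<close>
      then have "walk ?q (word_inv (W i)) = \<one>\<^bsub>\<Gamma>\<^esub>"
        by (simp add: step_def mul_assoc)
      then have "walk \<one>\<^bsub>\<Gamma>\<^esub> (W i) = ?q"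
        using walk_inv [of ?q "word_inv (W i)"] by (simp add: word_inv_word_inv)
      then show ?thesis
        by (simp add: mul_assoc)
    qed
  qed
  then show ?thesis
    by blast
qed

section \<open>Inhomogeneous cochains\<close>

text \<open>A type of class \<open>ab_group_add\<close> that contains every abelian group carried by \<open>'m\<close> as a factor: the
  product of all of them.\<close>

typedef 'm all_ab_groups =
  "{\<phi> :: 'm monoid \<Rightarrow> 'm. \<forall>M. if comm_group M then \<phi> M \<in> carrier M else \<phi> M = undefined}"
proof
  show "(\<lambda>M. if comm_group M then \<one>\<^bsub>M\<^esub> else undefined) \<in>
      {\<phi> :: 'm monoid \<Rightarrow> 'm. \<forall>M. if comm_group M then \<phi> M \<in> carrier M else \<phi> M = undefined}"
    by (simp add: comm_group_def group_def monoid.one_closed)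
qed

setup_lifting type_definition_all_ab_groups

instantiation all_ab_groups :: (type) ab_group_add
begin

lift_definition zero_all_ab_groups :: "'a all_ab_groups"
  is "\<lambda>M. if comm_group M then \<one>\<^bsub>M\<^esub> else undefined"
  by (simp add: comm_group_def group_def monoid.one_closed)

lift_definition plus_all_ab_groups :: "'a all_ab_groups \<Rightarrow> 'a all_ab_groups \<Rightarrow> 'a all_ab_groups"
  is "\<lambda>\<phi> \<psi> M. if comm_group M then \<phi> M \<otimes>\<^bsub>M\<^esub> \<psi> M else undefined"
  by (simp add: comm_group_def group_def monoid.m_closed)

lift_definition uminus_all_ab_groups :: "'a all_ab_groups \<Rightarrow> 'a all_ab_groups"
  is "\<lambda>\<phi> M. if comm_group M then inv\<^bsub>M\<^esub> \<phi> M else undefined"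
  by (simp add: comm_group_def group.inv_closed)

definition minus_all_ab_groups :: "'a all_ab_groups \<Rightarrow> 'a all_ab_groups \<Rightarrow> 'a all_ab_groups"
  where "minus_all_ab_groups x y = x + (- y)"

instance
proof
  fix x y z :: "'a all_ab_groups"
  note group_facts = comm_group.axioms(2) group.is_monoid monoid.m_assoc monoid.l_one group.r_inv
    comm_monoid.m_comm comm_group.axioms(1)
  show "x + y + z = x + (y + z)"
    by transfer (auto simp: fun_eq_iff group_facts)
  show "x + y = y + x"
    by transfer (auto simp: fun_eq_iff group_facts)
  show "0 + x = x"
  proof transfer
    fix x :: "'a monoid \<Rightarrow> 'a"
    assume x: "\<forall>M. if comm_group M then x M \<in> carrier M else x M = undefined"
    show "(\<lambda>M. if comm_group M then (if comm_group M then \<one>\<^bsub>M\<^esub> else undefined) \<otimes>\<^bsub>M\<^esub> x M else undefined) = x"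
    proof
      show "(if comm_group M then (if comm_group M then \<one>\<^bsub>M\<^esub> else undefined) \<otimes>\<^bsub>M\<^esub> x M else undefined) = x M"
        for M
        using spec [OF x, of M] by (simp add: group_facts split: if_splits)
    qed
  qed
  show "- x + x = 0"
    by transfer (auto simp: fun_eq_iff group_facts)
  show "x - y = x + - y"
    by (rule minus_all_ab_groups_def)
qed

end

lift_definition emb :: "'m monoid \<Rightarrow> 'm \<Rightarrow> 'm all_ab_groups"
  is "\<lambda>M m M'. if comm_group M' then (if M' = M \<and> m \<in> carrier M then m else \<one>\<^bsub>M'\<^esub>) else undefined"
  by (simp add: comm_group_def group_def monoid.one_closed)

lift_definition prj :: "'m monoid \<Rightarrow> 'm all_ab_groups \<Rightarrow> 'm" is "\<lambda>M \<phi>. \<phi> M" .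

lemma prj_emb: "comm_group M \<Longrightarrow> m \<in> carrier M \<Longrightarrow> prj M (emb M m) = m"
  by transfer simp

lemma prj_closed: "comm_group M \<Longrightarrow> prj M x \<in> carrier M"
  by transfer (meson)

lemma prj_add: "comm_group M \<Longrightarrow> prj M (x + y) = prj M x \<otimes>\<^bsub>M\<^esub> prj M y"
  by transfer simp

lemma emb_mult: "comm_group M \<Longrightarrow> m \<in> carrier M \<Longrightarrow> m' \<in> carrier M \<Longrightarrow>
    emb M (m \<otimes>\<^bsub>M\<^esub> m') = emb M m + emb M m'"
  by transfer (auto simp: fun_eq_iff comm_group_def group_def monoid.l_one monoid.one_closed monoid.m_closed)

lemma emb_one: "comm_group M \<Longrightarrow> emb M \<one>\<^bsub>M\<^esub> = 0"
  by transfer (auto simp: fun_eq_iff)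

lemma emb_inv:
  assumes "comm_group M" "m \<in> carrier M"
  shows "emb M (inv\<^bsub>M\<^esub> m) = - emb M m"
proof -
  interpret comm_group M by fact
  have "emb M (inv\<^bsub>M\<^esub> m) + emb M m = 0"
    using assms by (simp add: emb_mult [symmetric] emb_one)
  then show ?thesis
    by (simp add: add_eq_0_iff2)
qed

text \<open>The closed form of the recursion, needed to match its terms with those of the
  inhomogeneous differential.\<close>

lemma del_sum:
  "del F xs = (\<Sum>i<length xs. if even i then F (take i xs @ drop (Suc i) xs)
    else - F (take i xs @ drop (Suc i) xs))"
proof (induction xs arbitrary: F)
  case (Cons x xs)
  have "(\<Sum>i<length xs. if even (Suc i) then F (x # take i xs @ drop (Suc i) xs)
      else - F (x # take i xs @ drop (Suc i) xs)) = - del (\<lambda>z. F (x # z)) xs"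
    unfolding Cons.IH sum_negf [symmetric] by (rule sum.cong) auto
  then show ?case
    by (simp add: del_Cons sum.lessThan_Suc_shift del: sum.lessThan_Suc cong: if_cong)
qed simp

section \<open>Passing from a module record to additive notation\<close>

locale coefficients = group G for G :: "('g, 'r) monoid_scheme" (structure) +
  fixes M :: "'m monoid" and \<alpha> :: "'g \<Rightarrow> 'm \<Rightarrow> 'm"
  assumes module: "group_module G M \<alpha>"
begin

sublocale M: comm_group M
  using module by (simp add: group_module_def)

lemma comm_group_M: "comm_group M"
  by (rule M.comm_group_axioms)

lemma \<alpha>_hom: "g \<in> carrier G \<Longrightarrow> \<alpha> g \<in> hom M M"
  using module by (auto simp: group_module_def hom_def AutoGroup_def auto_def)

lemma \<alpha>_closed [simp]: "g \<in> carrier G \<Longrightarrow> m \<in> carrier M \<Longrightarrow> \<alpha> g m \<in> carrier M"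
  using \<alpha>_hom by (auto simp: hom_def)

lemma \<alpha>_mult: "g \<in> carrier G \<Longrightarrow> m \<in> carrier M \<Longrightarrow> m' \<in> carrier M \<Longrightarrow>
    \<alpha> g (m \<otimes>\<^bsub>M\<^esub> m') = \<alpha> g m \<otimes>\<^bsub>M\<^esub> \<alpha> g m'"
  using \<alpha>_hom by (auto simp: hom_def)

lemma \<alpha>_comp: "g \<in> carrier G \<Longrightarrow> h \<in> carrier G \<Longrightarrow> m \<in> carrier M \<Longrightarrow> \<alpha> (g \<otimes> h) m = \<alpha> g (\<alpha> h m)"
  using module by (auto simp: group_module_def hom_def AutoGroup_def BijGroup_def auto_def compose_def)

lemma \<alpha>_one: "m \<in> carrier M \<Longrightarrow> \<alpha> \<one> m = m"
proof -
  have "\<alpha> \<in> hom G (AutoGroup M)"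
    using module by (simp add: group_module_def)
  then have "\<alpha> \<one> = \<one>\<^bsub>AutoGroup M\<^esub>"
    by (rule hom_one [OF _ is_group M.AutoGroup])
  then show "m \<in> carrier M \<Longrightarrow> \<alpha> \<one> m = m"
    by (simp add: AutoGroup_def BijGroup_def)
qed

definition A :: "'m all_ab_groups set" where
  "A = emb M ` carrier M"

text \<open>Projecting first makes this additive and multiplicative in \<open>g\<close> on the whole
  type; on \<open>A\<close> it is the given action.\<close>

definition act :: "'g \<Rightarrow> 'm all_ab_groups \<Rightarrow> 'm all_ab_groups" where
  "act g x = emb M (\<alpha> (rr g) (prj M x))"

lemma emb_A [simp]: "m \<in> carrier M \<Longrightarrow> emb M m \<in> A"
  by (simp add: A_def)

lemma prj_M [simp]: "prj M x \<in> carrier M"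
  by (rule prj_closed [OF comm_group_M])

lemma prj_emb_M [simp]: "m \<in> carrier M \<Longrightarrow> prj M (emb M m) = m"
  by (rule prj_emb [OF comm_group_M])

lemma emb_prj: "x \<in> A \<Longrightarrow> emb M (prj M x) = x"
  by (auto simp: A_def)

lemma gmod: "gmod G A act"
proof (intro gmod.intro gmod_axioms.intro group_axioms)
  have add: "act g (x + y) = act g x + act g y" for g x y
    by (simp add: act_def prj_add [OF comm_group_M] \<alpha>_mult emb_mult [OF comm_group_M])
  show "act g (x - y) = act g x - act g y" for g x y
    using add [of g "x - y" y] by simp
  show "0 \<in> A"
    unfolding A_def using emb_one [OF comm_group_M] by (metis M.one_closed image_eqI)
  show "x - y \<in> A" if xy: "x \<in> A" "y \<in> A" for x y
  proof -
    obtain m m' where m: "m \<in> carrier M" "x = emb M m" "m' \<in> carrier M" "y = emb M m'"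
      using xy by (auto simp: A_def)
    then have "x - y = emb M (m \<otimes>\<^bsub>M\<^esub> inv\<^bsub>M\<^esub> m')"
      by (simp add: emb_mult [OF comm_group_M] emb_inv [OF comm_group_M])
    then show ?thesis
      using m by simp
  qed
  show "act g x \<in> A" for g x
    by (simp add: act_def)
  show "act (g \<odot> h) x = act g (act h x)" for g h x
    by (simp add: act_def mul_def \<alpha>_comp)
  show "act \<one> x = x" if "x \<in> A" for x
    using emb_prj [OF that] by (simp add: act_def \<alpha>_one)
qed

sublocale gmod G A act
  by (rule gmod)

lemma finite_A: "finite (carrier M) \<Longrightarrow> finite A"
  by (simp add: A_def)

section \<open>Homogeneous and inhomogeneous cochains\<close>

definition steps :: "nat \<Rightarrow> 'g list \<Rightarrow> nat \<Rightarrow> 'g" where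
  "steps n xs = (\<lambda>j\<in>{..<n}. iv (xs ! j) \<odot> xs ! Suc j)"

primrec pprod :: "(nat \<Rightarrow> 'g) \<Rightarrow> nat \<Rightarrow> 'g" where
  "pprod g 0 = \<one>"
| "pprod g (Suc k) = pprod g k \<odot> g k"

definition partials :: "nat \<Rightarrow> (nat \<Rightarrow> 'g) \<Rightarrow> 'g list" where
  "partials n g = map (pprod g) [0..<Suc n]"

text \<open>The usual dictionary: an inhomogeneous cochain is evaluated on the successive quotients
  of the vertices, and the first vertex acts on the result. Degree \<open>n\<close> corresponds to
  \<open>n + 1\<close> variables.\<close>

definition homogenize :: "nat \<Rightarrow> ((nat \<Rightarrow> 'g) \<Rightarrow> 'm) \<Rightarrow> 'g list \<Rightarrow> 'm all_ab_groups" where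
  "homogenize n f xs = (if length xs = Suc n then emb M (\<alpha> (rr (hd xs)) (f (steps n xs))) else 0)"

lemma tuples_iff: "g \<in> tuples n (carrier G) \<longleftrightarrow> (\<forall>j<n. g j \<in> carrier G) \<and> g \<in> extensional {..<n}"
  by (auto simp: tuples_def PiE_def Pi_def)

lemma steps_tuples [simp]: "steps n xs \<in> tuples n (carrier G)"
  by (simp add: steps_def tuples_iff)

lemma cochains_iff: "f \<in> cochains G M n \<longleftrightarrow> f \<in> tuples n (carrier G) \<rightarrow>\<^sub>E carrier M"
  by (simp add: cochains_def cochain_group_def)

lemma cochain_closed: "f \<in> cochains G M n \<Longrightarrow> g \<in> tuples n (carrier G) \<Longrightarrow> f g \<in> carrier M"
  by (auto simp: cochains_iff)

lemma length_partials [simp]: "length (partials n g) = Suc n"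
  by (simp add: partials_def)

lemma nth_partials: "k \<le> n \<Longrightarrow> partials n g ! k = pprod g k"
  by (simp add: partials_def del: upt_Suc)

lemma hd_partials [simp]: "hd (partials n g) = \<one>"
  using nth_partials [of 0 n g] by (simp add: hd_conv_nth partials_def)

lemma steps_partials:
  assumes "g \<in> tuples n (carrier G)"
  shows "steps n (partials n g) = g"
proof
  fix j
  show "steps n (partials n g) j = g j"
    using assms by (cases "j < n")
      (auto simp: steps_def nth_partials tuples_iff extensional_def)
qed

lemma homogenize_partials:
  assumes "f \<in> cochains G M n" "g \<in> tuples n (carrier G)"
  shows "prj M (homogenize n f (partials n g)) = f g"
  using cochain_closed [OF assms] by (simp add: homogenize_def steps_partials [OF assms(2)] \<alpha>_one)

text \<open>A list of vertices is recovered from its first vertex and its quotients; hence a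
  homogeneous cochain is determined by its values on the lists \<open>partials n g\<close>, which
  start at the identity.\<close>

lemma partials_steps:
  assumes "length xs = Suc n"
  shows "map ((\<odot>) (hd xs)) (partials n (steps n xs)) = map rr xs"
proof (rule nth_equalityI)
  have *: "hd xs \<odot> pprod (steps n xs) k = rr (xs ! k)" if "k \<le> n" for k
    using that
  proof (induction k)
    case 0
    then show ?case
      using assms by (cases xs) simp_all
  next
    case (Suc k)
    then show ?case
      by (simp add: mul_assoc [symmetric] steps_def)
  qed
  show "map ((\<odot>) (hd xs)) (partials n (steps n xs)) ! k = map rr xs ! k"
    if "k < length (map ((\<odot>) (hd xs)) (partials n (steps n xs)))" for k
    using that assms * [of k] by (simp add: nth_partials)
qed (simp add: assms)

lemma homogenize_coch:
  assumes "f \<in> cochains G M n"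
  shows "coch A act (Suc n) (homogenize n f)"
  unfolding coch_def
proof (intro conjI allI impI)
  show "homogenize n f xs = 0" if "length xs \<noteq> Suc n" for xs
    using that by (simp add: homogenize_def)
  show "homogenize n f xs \<in> A" for xs
    using cochain_closed [OF assms] by (simp add: homogenize_def)
  show "homogenize n f (map ((\<odot>) g) xs) = act g (homogenize n f xs)" for g xs
  proof (cases "length xs = Suc n")
    case True
    then have "steps n (map ((\<odot>) g) xs) = steps n xs"
      by (auto simp: steps_def iv_mul mul_assoc fun_eq_iff restrict_def)
    moreover have "hd (map ((\<odot>) g) xs) = g \<odot> hd xs"
      using True by (cases xs) simp_all
    ultimately show ?thesis
      using True cochain_closed [OF assms, of "steps n xs"]
      by (simp add: homogenize_def act_def mul_def \<alpha>_comp)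
  qed (simp add: homogenize_def)
qed

lemma homogenize_inj:
  assumes "f \<in> cochains G M n" "f' \<in> cochains G M n" "homogenize n f = homogenize n f'"
  shows "f = f'"
proof (rule PiE_ext)
  show "f \<in> tuples n (carrier G) \<rightarrow>\<^sub>E carrier M" "f' \<in> tuples n (carrier G) \<rightarrow>\<^sub>E carrier M"
    using assms by (simp_all add: cochains_iff)
  show "f g = f' g" if "g \<in> tuples n (carrier G)" for g
    using homogenize_partials [OF assms(1) that] homogenize_partials [OF assms(2) that] by (simp add: assms(3))
qed

lemma homogenize_surj:
  assumes "coch A act (Suc n) F"
  shows "\<exists>f\<in>cochains G M n. homogenize n f = F"
proof
  define f where "f = (\<lambda>g\<in>tuples n (carrier G). prj M (F (partials n g)))"
  show f: "f \<in> cochains G M n"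
    by (simp add: f_def cochains_iff)
  show "homogenize n f = F"
  proof (rule coch_eqI [OF homogenize_coch [OF f] assms])
    fix xs :: "'g list"
    assume len: "length xs = Suc n"
    have "homogenize n f xs = act (hd xs) (F (partials n (steps n xs)))"
      by (simp add: homogenize_def len f_def act_def)
    also have "\<dots> = F (map ((\<odot>) (hd xs)) (partials n (steps n xs)))"
      by (rule coch_equiv [OF assms, symmetric])
    also have "\<dots> = F xs"
      unfolding partials_steps [OF len] by (rule coch_rr [OF assms])
    finally show "homogenize n f xs = F xs" .
  qed
qed

lemma homogenize_mult:
  assumes "f \<in> cochains G M n" "f' \<in> cochains G M n"
  shows "homogenize n (f \<otimes>\<^bsub>cochain_group G M n\<^esub> f') = homogenize n f + homogenize n f'"
proof
  fix xs
  show "homogenize n (f \<otimes>\<^bsub>cochain_group G M n\<^esub> f') xs = (homogenize n f + homogenize n f') xs"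
    using cochain_closed [OF assms(1), of "steps n xs"] cochain_closed [OF assms(2), of "steps n xs"]
    by (simp add: homogenize_def cochain_group_def \<alpha>_mult emb_mult [OF comm_group_M])
qed

lemma \<alpha>_M_one: "g \<in> carrier G \<Longrightarrow> \<alpha> g \<one>\<^bsub>M\<^esub> = \<one>\<^bsub>M\<^esub>"
  using hom_one [OF \<alpha>_hom M.is_group M.is_group] by simp

lemma homogenize_one: "homogenize n \<one>\<^bsub>cochain_group G M n\<^esub> = 0"
  by (simp add: fun_eq_iff homogenize_def cochain_group_def \<alpha>_M_one emb_one [OF comm_group_M])

lemma differential_cochains:
  assumes "f \<in> cochains G M n"
  shows "differential G M \<alpha> n f \<in> cochains G M (Suc n)"
proof -
  have "(\<lambda>j\<in>{..<n}. g (Suc j)) \<in> tuples n (carrier G)" "merge G n i g \<in> tuples n (carrier G)"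
    "restrict g {..<n} \<in> tuples n (carrier G)" if "g \<in> tuples (Suc n) (carrier G)" "i < n" for g i
    using that by (auto simp: tuples_iff merge_def)
  moreover have "(\<lambda>j\<in>{..<n}. g (Suc j)) \<in> tuples n (carrier G)"
    "restrict g {..<n} \<in> tuples n (carrier G)" if "g \<in> tuples (Suc n) (carrier G)" for g
    using that by (auto simp: tuples_iff)
  ultimately show ?thesis
    unfolding cochains_iff differential_def
    by (intro restrict_PiE_iff [THEN iffD2] ballI M.m_closed \<alpha>_closed M.finprod_closed Pi_I M.int_pow_closed
        cochain_closed [OF assms]) (auto simp: tuples_iff)
qed

lemma emb_sum:
  assumes "finite I" "\<And>i. i \<in> I \<Longrightarrow> m i \<in> carrier M"
  shows "emb M (\<Otimes>\<^bsub>M\<^esub>i\<in>I. m i) = (\<Sum>i\<in>I. emb M (m i))"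
  using assms
proof (induction I)
  case (insert i I)
  then have "m \<in> I \<rightarrow> carrier M" "m i \<in> carrier M"
    by auto
  with insert show ?case
    by (simp add: emb_mult [OF comm_group_M] M.finprod_closed)
qed (simp add: emb_one [OF comm_group_M])

lemma \<alpha>_finprod:
  assumes "finite I" "\<And>i. i \<in> I \<Longrightarrow> m i \<in> carrier M" "g \<in> carrier G"
  shows "\<alpha> g (\<Otimes>\<^bsub>M\<^esub>i\<in>I. m i) = (\<Otimes>\<^bsub>M\<^esub>i\<in>I. \<alpha> g (m i))"
  using assms
proof (induction I)
  case (insert i I)
  then have "m \<in> I \<rightarrow> carrier M" "m i \<in> carrier M" "(\<lambda>i. \<alpha> g (m i)) \<in> I \<rightarrow> carrier M"
    by auto
  with insert show ?case
    by (simp add: \<alpha>_mult M.finprod_closed)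
qed (simp add: \<alpha>_M_one)

lemma emb_sign:
  assumes "m \<in> carrier M" "g \<in> carrier G"
  shows "emb M (\<alpha> g (m [^]\<^bsub>M\<^esub> ((- 1) ^ k :: int))) = (if even k then emb M (\<alpha> g m) else - emb M (\<alpha> g m))"
proof (cases "even k")
  case False
  have "\<alpha> g (inv\<^bsub>M\<^esub> m) = inv\<^bsub>M\<^esub> (\<alpha> g m)"
    using assms by (intro group_hom.hom_inv group_hom.intro group_hom_axioms.intro M.is_group \<alpha>_hom)
  then show ?thesis
    using False assms emb_inv [OF comm_group_M] by (simp add: M.int_pow_neg)
qed (use assms in simp)

text \<open>The terms correspond one to one. Deleting an inner vertex multiplies the two adjacent
  quotients, which is \<open>merge\<close>; deleting the last vertex drops a quotient; deleting the
  first one moves the base vertex by \<open>g 0\<close>, which produces the action of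
  \<open>g 0\<close>.\<close>

lemma homogenize_differential:
  assumes f: "f \<in> cochains G M n"
  shows "homogenize (Suc n) (differential G M \<alpha> n f) = del (homogenize n f)"
proof (rule coch_eqI [OF homogenize_coch [OF differential_cochains [OF f]] coch_del [OF homogenize_coch [OF f]]])
  fix xs :: "'g list"
  assume len: "length xs = Suc (Suc n)"
  define g where "g = steps (Suc n) xs"
  define x0 where "x0 = rr (hd xs)"
  have x0: "x0 \<in> carrier G"
    by (simp add: x0_def)
  have g: "g \<in> tuples (Suc n) (carrier G)"
    by (simp add: g_def)
  have g_nth: "g j = iv (xs ! j) \<odot> xs ! Suc j" if "j \<le> n" for j
    using that by (simp add: g_def steps_def)
  define F where "F i = homogenize n f (take i xs @ drop (Suc i) xs)" for i
  let ?E = "\<lambda>m. emb M (\<alpha> x0 m)"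
  have tl: "(\<lambda>j\<in>{..<n}. g (Suc j)) \<in> tuples n (carrier G)" and re: "restrict g {..<n} \<in> tuples n (carrier G)"
    using g by (auto simp: tuples_iff)
  have me: "merge G n i g \<in> tuples n (carrier G)" if "i < n" for i
    using g that by (auto simp: tuples_iff merge_def)
  note cl = cochain_closed [OF f]
  have F_first: "F 0 = ?E (\<alpha> (g 0) (f (\<lambda>j\<in>{..<n}. g (Suc j))))"
  proof -
    obtain x y zs where xs: "xs = x # y # zs"
      using len by (auto simp: length_Suc_conv)
    have s: "steps n (y # zs) = (\<lambda>j\<in>{..<n}. g (Suc j))"
      by (auto simp: steps_def g_def xs fun_eq_iff restrict_def)
    have "rr y = x0 \<otimes> g 0"
      using g_nth [of 0] mul_iv_cancel(2) [of x y] by (simp add: x0_def xs mul_def)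
    then show ?thesis
      using len cl [OF tl] g by (simp add: F_def homogenize_def xs s \<alpha>_comp x0 tuples_iff)
  qed
  have F_mid: "F (Suc i) = ?E (f (merge G n i g))" if i: "i < n" for i
  proof -
    let ?ys = "take (Suc i) xs @ drop (Suc (Suc i)) xs"
    have "steps n ?ys = merge G n i g"
    proof
      fix j
      have nth: "?ys ! k = (if k \<le> i then xs ! k else xs ! Suc k)" if "k \<le> n" for k
        using len i that by (auto simp: nth_append min_def)
      show "steps n ?ys j = merge G n i g j"
      proof (cases "j < n")
        case True
        consider "j < i" | "j = i" | "j > i"
          by linarith
        then show ?thesis
        proof cases
          case 1
          then show ?thesis
            using True by (simp add: steps_def merge_def nth g_nth del: take_Suc)
        next
          case 2
          have "g i \<otimes> g (Suc i) = g i \<odot> g (Suc i)"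
            using g i by (simp add: tuples_iff mul_def)
          also have "\<dots> = iv (xs ! i) \<odot> xs ! Suc (Suc i)"
            using i by (simp add: g_nth mul_assoc)
          finally show ?thesis
            using 2 True by (simp add: steps_def merge_def nth)
        next
          case 3
          then show ?thesis
            using True by (simp add: steps_def merge_def nth g_nth)
        qed
      qed (simp add: steps_def merge_def)
    qed
    moreover have "hd ?ys = hd xs"
      using len by (cases xs) simp_all
    moreover have "length ?ys = Suc n"
      using len i by simp
    ultimately show ?thesis
      by (simp only: F_def homogenize_def x0_def if_True simp_thms)
  qed
  have F_last: "F (Suc n) = ?E (f (restrict g {..<n}))"
  proof -
    have "steps n (take (Suc n) xs) = restrict g {..<n}"
      by (auto simp: steps_def g_def fun_eq_iff restrict_def len)
    moreover have "hd (take (Suc n) xs) = hd xs"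
      using len by (cases xs) simp_all
    ultimately show ?thesis
      using len by (simp add: F_def homogenize_def x0_def)
  qed
  let ?s = "\<lambda>i m. if even i then m else - m"
  let ?m = "\<lambda>i. f (merge G n i g) [^]\<^bsub>M\<^esub> ((- 1) ^ Suc i :: int)"
  have m: "?m \<in> {..<n} \<rightarrow> carrier M"
    using me cl by auto
  have split: "(\<Sum>i<Suc (Suc n). T i) = T 0 + (\<Sum>i<n. T (Suc i)) + T (Suc n)"
    for T :: "nat \<Rightarrow> 'm all_ab_groups"
    by (subst sum.lessThan_Suc_shift) (simp add: add.assoc)
  have "del (homogenize n f) xs = (\<Sum>i<Suc (Suc n). ?s i (F i))"
    by (simp only: del_sum len F_def)
  also have "\<dots> = F 0 + (\<Sum>i<n. ?s (Suc i) (F (Suc i))) + ?s (Suc n) (F (Suc n))"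
    by (subst split) simp
  also have "(\<Sum>i<n. ?s (Suc i) (F (Suc i))) = (\<Sum>i<n. ?E (?m i))"
    using me cl by (intro sum.cong) (simp_all only: F_mid emb_sign x0 lessThan_iff)
  also have "\<dots> = ?E (\<Otimes>\<^bsub>M\<^esub>i\<in>{..<n}. ?m i)"
  proof -
    have m': "?m i \<in> carrier M" if "i \<in> {..<n}" for i
      using m that by (rule funcset_mem)
    have "emb M (\<Otimes>\<^bsub>M\<^esub>i\<in>{..<n}. \<alpha> x0 (?m i)) = (\<Sum>i<n. ?E (?m i))"
      by (rule emb_sum) (simp_all only: finite_lessThan \<alpha>_closed [OF x0 m'])
    moreover have "\<alpha> x0 (\<Otimes>\<^bsub>M\<^esub>i\<in>{..<n}. ?m i) = (\<Otimes>\<^bsub>M\<^esub>i\<in>{..<n}. \<alpha> x0 (?m i))"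
      using m' x0 by (intro \<alpha>_finprod finite_lessThan)
    ultimately show ?thesis
      by (simp only:)
  qed
  also have "?s (Suc n) (F (Suc n)) = ?E (f (restrict g {..<n}) [^]\<^bsub>M\<^esub> ((- 1) ^ Suc n :: int))"
    by (simp only: F_last emb_sign [OF cl [OF re] x0])
  also have "F 0 + ?E (\<Otimes>\<^bsub>M\<^esub>i\<in>{..<n}. ?m i) + ?E (f (restrict g {..<n}) [^]\<^bsub>M\<^esub> ((- 1) ^ Suc n :: int)) =
      ?E (differential G M \<alpha> n f g)"
    unfolding F_first differential_def restrict_apply'[OF g]
    using m x0 cl [OF tl] cl [OF re] g
    by (simp add: \<alpha>_mult emb_mult [OF comm_group_M] M.finprod_closed tuples_iff del: power_Suc)
  finally have eq: "del (homogenize n f) xs = ?E (differential G M \<alpha> n f g)" .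
  show "homogenize (Suc n) (differential G M \<alpha> n f) xs = del (homogenize n f) xs"
    unfolding eq by (simp add: homogenize_def len g_def x0_def)
qed

end

lemma comm_group_cochain_group:
  assumes "comm_group M"
  shows "comm_group (cochain_group H M n)"
proof -
  interpret M: comm_group M by fact
  interpret C: group "cochain_group H M n"
    unfolding cochain_group_def by (rule product_group) (rule M.is_group)
  show ?thesis
  proof (rule C.group_comm_groupI)
    show "x \<otimes>\<^bsub>cochain_group H M n\<^esub> y = y \<otimes>\<^bsub>cochain_group H M n\<^esub> x"
      if "x \<in> carrier (cochain_group H M n)" "y \<in> carrier (cochain_group H M n)" for x y
      using that by (auto simp: cochain_group_def fun_eq_iff restrict_def PiE_def Pi_def M.m_comm)
  qed
qed

context coefficients
begin

definition locally_constant :: "nat \<Rightarrow> ((nat \<Rightarrow> 'g) \<Rightarrow> 'm) \<Rightarrow> bool" where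
  "locally_constant n f \<longleftrightarrow> (\<exists>N\<in>finite_index_normal G. \<forall>g\<in>tuples n (carrier G). \<forall>g'\<in>tuples n (carrier G).
     (\<forall>j<n. cl N (g j) = cl N (g' j)) \<longrightarrow> f g = f g')"

lemma cl_pprod:
  assumes "N \<lhd> G" "\<forall>j<n. cl N (g j) = cl N (g' j)" "k \<le> n"
  shows "cl N (pprod g k) = cl N (pprod g' k)"
  using assms(3)
proof (induction k)
  case (Suc k)
  then have "cl N (pprod g k) = cl N (pprod g' k)" "cl N (g k) = cl N (g' k)"
    using assms(2) by simp_all
  then show ?case
    unfolding pprod.simps by (rule cl_mul [OF assms(1)])
qed simp

text \<open>Homogenizing brings in the action of the first vertex, so in that direction
  \<open>N\<close> is intersected with a subgroup of finite index that acts trivially; finiteness of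
  the module provides it.\<close>

lemma locally_constant_homogenize:
  assumes f: "f \<in> cochains G M n" and fin: "finite (carrier M)"
  shows "locally_constant n f \<longleftrightarrow>
    (\<exists>N\<in>finite_index_normal G. factors_through (map (cl N)) (homogenize n f))"
proof
  assume "\<exists>N\<in>finite_index_normal G. factors_through (map (cl N)) (homogenize n f)"
  then obtain N where N: "N \<in> finite_index_normal G" "factors_through (map (cl N)) (homogenize n f)"
    by blast
  have "f g = f g'" if g: "g \<in> tuples n (carrier G)" "g' \<in> tuples n (carrier G)"
    and eq: "\<forall>j<n. cl N (g j) = cl N (g' j)" for g g'
  proof -
    have "map (cl N) (partials n g) = map (cl N) (partials n g')"
      using cl_pprod [OF finite_index_normal_normal [OF N(1)] eq]
      by (simp add: partials_def del: upt_Suc)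
    then have "homogenize n f (partials n g) = homogenize n f (partials n g')"
      by (rule factors_throughD [OF N(2)])
    then show ?thesis
      using homogenize_partials [OF f g(1)] homogenize_partials [OF f g(2)] by simp
  qed
  then show "locally_constant n f"
    unfolding locally_constant_def using N(1) by (intro bexI [of _ N] ballI impI)
next
  assume "locally_constant n f"
  then obtain N where N: "N \<in> finite_index_normal G"
    and f_cl: "\<And>g g'. g \<in> tuples n (carrier G) \<Longrightarrow> g' \<in> tuples n (carrier G) \<Longrightarrow>
      \<forall>j<n. cl N (g j) = cl N (g' j) \<Longrightarrow> f g = f g'"
    unfolding locally_constant_def by blast
  obtain K where K: "K \<in> finite_index_normal G"
    and act_K: "\<And>g h x. cl K g = cl K h \<Longrightarrow> x \<in> A \<Longrightarrow> act g x = act h x"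
    using finite_action_kernel [OF finite_A [OF fin]] by blast
  note NK = finite_index_normal_Int [OF N K]
  note sub = finite_index_normal_subgroup
  have "factors_through (map (cl (N \<inter> K))) (homogenize n f)"
  proof (rule factors_throughI)
    fix xs ys
    assume eq: "map (cl (N \<inter> K)) xs = map (cl (N \<inter> K)) ys"
    then have len: "length xs = length ys"
      by (rule map_eq_imp_length_eq)
    show "homogenize n f xs = homogenize n f ys"
    proof (cases "length xs = Suc n")
      case True
      have nth: "cl (N \<inter> K) (xs ! j) = cl (N \<inter> K) (ys ! j)" if "j \<le> n" for j
        using arg_cong [OF eq, of "\<lambda>l. l ! j"] that True len by simp
      have nthN: "cl N (xs ! j) = cl N (ys ! j)" if "j \<le> n" for j
        by (rule cl_mono [OF sub [OF NK] sub [OF N] Int_lower1 nth [OF that]])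
      have "f (steps n xs) = f (steps n ys)"
      proof (rule f_cl)
        show "\<forall>j<n. cl N (steps n xs j) = cl N (steps n ys j)"
        proof (intro allI impI)
          fix j
          assume j: "j < n"
          have "cl N (iv (xs ! j) \<odot> xs ! Suc j) = cl N (iv (ys ! j) \<odot> ys ! Suc j)"
            using j finite_index_normal_normal [OF N] by (intro cl_mul cl_iv nthN) simp_all
          then show "cl N (steps n xs j) = cl N (steps n ys j)"
            using j by (simp add: steps_def)
        qed
      qed simp_all
      moreover have "act (xs ! 0) (emb M (f (steps n ys))) = act (ys ! 0) (emb M (f (steps n ys)))"
        by (rule act_K, rule cl_mono [OF sub [OF NK] sub [OF K] Int_lower2 nth])
          (simp_all add: cochain_closed [OF f])
      moreover have "hd xs = xs ! 0" "hd ys = ys ! 0"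
        using True len by (auto intro: hd_conv_nth)
      ultimately show ?thesis
        using True len by (simp add: homogenize_def act_def cochain_closed [OF f])
    qed (simp add: homogenize_def len)
  qed
  then show "\<exists>N\<in>finite_index_normal G. factors_through (map (cl N)) (homogenize n f)"
    using NK by blast
qed

lemma comm_group_cochains: "comm_group (cochain_group G M n)"
  by (rule comm_group_cochain_group [OF comm_group_M])

lemma carrier_cochain_group: "carrier (cochain_group G M n) = cochains G M n"
  by (simp add: cochains_def)

text \<open>Transported from \<open>del\<close> along the injective map \<open>homogenize\<close>,
  which avoids computing with the product formula.\<close>

lemma differential_mult:
  assumes "f \<in> cochains G M n" "f' \<in> cochains G M n"
  shows "differential G M \<alpha> n (f \<otimes>\<^bsub>cochain_group G M n\<^esub> f') =
    differential G M \<alpha> n f \<otimes>\<^bsub>cochain_group G M (Suc n)\<^esub> differential G M \<alpha> n f'"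
proof -
  interpret C: comm_group "cochain_group G M n"
    by (rule comm_group_cochains)
  interpret C': comm_group "cochain_group G M (Suc n)"
    by (rule comm_group_cochains)
  have "f \<otimes>\<^bsub>cochain_group G M n\<^esub> f' \<in> cochains G M n"
    using C.m_closed assms by (simp add: carrier_cochain_group)
  moreover have "differential G M \<alpha> n f \<otimes>\<^bsub>cochain_group G M (Suc n)\<^esub> differential G M \<alpha> n f' \<in> cochains G M (Suc n)"
    using C'.m_closed differential_cochains assms by (simp add: carrier_cochain_group)
  ultimately show ?thesis
    by (intro homogenize_inj [of _ "Suc n"] differential_cochains)
      (simp_all add: homogenize_differential homogenize_mult assms differential_cochains del_fun_add)
qed

lemma differential_differential:
  assumes "f \<in> cochains G M n"
  shows "differential G M \<alpha> (Suc n) (differential G M \<alpha> n f) = \<one>\<^bsub>cochain_group G M (Suc (Suc n))\<^esub>"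
proof -
  interpret C: comm_group "cochain_group G M (Suc (Suc n))"
    by (rule comm_group_cochains)
  have "\<one>\<^bsub>cochain_group G M (Suc (Suc n))\<^esub> \<in> cochains G M (Suc (Suc n))"
    using C.one_closed by (simp add: carrier_cochain_group)
  then show ?thesis
    using assms by (intro homogenize_inj [of _ "Suc (Suc n)"] differential_cochains)
      (simp_all add: homogenize_differential differential_cochains homogenize_one del_fun_del)
qed

lemma locally_constant_0: "locally_constant 0 f"
proof -
  have "g = g'" if "g \<in> tuples 0 (carrier G)" "g' \<in> tuples 0 (carrier G)" for g g'
    using that by (simp add: tuples_def)
  then show ?thesis
    unfolding locally_constant_def using finite_index_normal_UNIV by metis
qed

end

text \<open>The inhomogeneous form of \<open>locally_constant_representative\<close>. Both halves of
  goodness rest on it: applied to cocycles it gives surjectivity, applied to cochains with locally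
  constant differential it gives injectivity.\<close>

lemma (in hnn) cochain_locally_constant:
  assumes module: "group_module G M \<alpha>" and fin: "finite (carrier M)"
    and f: "f \<in> cochains G M (Suc k)"
    and df: "coefficients.locally_constant G (Suc (Suc k)) (differential G M \<alpha> (Suc k) f)"
  shows "\<exists>h\<in>cochains G M k. \<exists>l\<in>cochains G M (Suc k). coefficients.locally_constant G (Suc k) l \<and>
    f = l \<otimes>\<^bsub>cochain_group G M (Suc k)\<^esub> differential G M \<alpha> k h"
proof -
  interpret coefficients G M \<alpha>
    by unfold_locales (rule module)
  interpret C: comm_group "cochain_group G M (Suc k)"
    by (rule comm_group_cochains)
  have "\<exists>N\<in>finite_index_normal G. factors_through (map (cl N)) (del (homogenize (Suc k) f))"
    using df unfolding locally_constant_homogenize [OF differential_cochains [OF f] fin]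
      homogenize_differential [OF f] .
  from locally_constant_representative [OF gmod finite_A [OF fin] homogenize_coch [OF f] _ this]
  obtain H where H: "coch A act (Suc k) H"
    and lc: "\<exists>N\<in>finite_index_normal G. factors_through (map (cl N)) (homogenize (Suc k) f - del H)"
    by auto
  obtain h where h: "h \<in> cochains G M k" "homogenize k h = H"
    using homogenize_surj [OF H] by blast
  obtain l where l: "l \<in> cochains G M (Suc k)" "homogenize (Suc k) l = homogenize (Suc k) f - del H"
    using homogenize_surj [OF coch_diff [OF homogenize_coch [OF f] coch_del [OF H]]] by blast
  have dh: "differential G M \<alpha> k h \<in> cochains G M (Suc k)"
    by (rule differential_cochains [OF h(1)])
  have "f = l \<otimes>\<^bsub>cochain_group G M (Suc k)\<^esub> differential G M \<alpha> k h"
  proof (rule homogenize_inj [OF f])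
    show "l \<otimes>\<^bsub>cochain_group G M (Suc k)\<^esub> differential G M \<alpha> k h \<in> cochains G M (Suc k)"
      using C.m_closed l(1) dh by (simp add: carrier_cochain_group)
    show "homogenize (Suc k) f = homogenize (Suc k) (l \<otimes>\<^bsub>cochain_group G M (Suc k)\<^esub> differential G M \<alpha> k h)"
      unfolding homogenize_mult [OF l(1) dh] homogenize_differential [OF h(1)] l(2) h(2) by simp
  qed
  moreover have "locally_constant (Suc k) l"
    using lc unfolding locally_constant_homogenize [OF l(1) fin] l(2) .
  ultimately show ?thesis
    using h(1) l(1) by blast
qed

section \<open>Isomorphisms of quotients\<close>

lemma (in comm_group) subgroup_comm_group:
  assumes "subgroup H G"
  shows "comm_group (G\<lparr>carrier := H\<rparr>)"
proof (rule group.group_comm_groupI [OF subgroup.subgroup_is_group [OF assms is_group]])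
  show "x \<otimes>\<^bsub>G\<lparr>carrier := H\<rparr>\<^esub> y = y \<otimes>\<^bsub>G\<lparr>carrier := H\<rparr>\<^esub> x"
    if "x \<in> carrier (G\<lparr>carrier := H\<rparr>)" "y \<in> carrier (G\<lparr>carrier := H\<rparr>)" for x y
    using that subgroup.mem_carrier [OF assms] by (simp add: m_comm)
qed

text \<open>Since the subgroups of \<open>S\<close> are the full preimages of \<open>Z\<close> and
  \<open>B\<close>, the induced map on quotients is automatically injective; \<open>surj\<close> is
  exactly its surjectivity.\<close>

lemma quotient_iso:
  fixes C1 :: "('a, 'r) monoid_scheme" and C2 :: "('b, 's) monoid_scheme"
  assumes "comm_group C1" "comm_group C2" and S: "subgroup S C1"
    and P: "\<And>x. x \<in> S \<Longrightarrow> P x \<in> carrier C2"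
    and P_mult: "\<And>x y. x \<in> S \<Longrightarrow> y \<in> S \<Longrightarrow> P (x \<otimes>\<^bsub>C1\<^esub> y) = P x \<otimes>\<^bsub>C2\<^esub> P y"
    and Z: "subgroup Z C2" and B: "subgroup B C2" "B \<subseteq> Z"
    and surj: "\<And>z. z \<in> Z \<Longrightarrow> \<exists>x\<in>S. \<exists>b\<in>B. z = P x \<otimes>\<^bsub>C2\<^esub> b"
  shows "(\<lambda>c. B <#>\<^bsub>C2\<^esub> P ` c) \<in>
    iso (C1\<lparr>carrier := {x \<in> S. P x \<in> Z}\<rparr> Mod {x \<in> S. P x \<in> B}) (C2\<lparr>carrier := Z\<rparr> Mod B)"
proof -
  interpret C1: comm_group C1 by fact
  interpret C2: comm_group C2 by fact
  interpret S: group "C1\<lparr>carrier := S\<rparr>"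
    by (rule subgroup.subgroup_is_group [OF S C1.is_group])
  interpret P: group_hom "C1\<lparr>carrier := S\<rparr>" C2 P
    using P P_mult by unfold_locales (auto simp: hom_def)
  have preimage: "subgroup {x \<in> S. P x \<in> H} C1" if H: "subgroup H C2" for H
  proof (rule C1.incl_subgroup [OF S])
    show "subgroup {x \<in> S. P x \<in> H} (C1\<lparr>carrier := S\<rparr>)"
    proof (rule S.subgroupI)
      show "{x \<in> S. P x \<in> H} \<noteq> {}"
        using P.hom_one S.one_closed subgroup.one_closed [OF H] by auto
      show "inv\<^bsub>C1\<lparr>carrier := S\<rparr>\<^esub> x \<in> {x \<in> S. P x \<in> H}" if "x \<in> {x \<in> S. P x \<in> H}" for x
        using that S.inv_closed [of x] P.hom_inv [of x] subgroup.m_inv_closed [OF H] by simp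
      show "x \<otimes>\<^bsub>C1\<lparr>carrier := S\<rparr>\<^esub> y \<in> {x \<in> S. P x \<in> H}"
        if "x \<in> {x \<in> S. P x \<in> H}" "y \<in> {x \<in> S. P x \<in> H}" for x y
        using that S.m_closed [of x y] subgroup.m_closed [OF H] by (simp add: P_mult)
    qed auto
  qed
  define Z1 where "Z1 = {x \<in> S. P x \<in> Z}"
  define B1 where "B1 = {x \<in> S. P x \<in> B}"
  have sub: "subgroup Z1 C1" "subgroup B1 C1" "B1 \<subseteq> Z1"
    using preimage [OF Z] preimage [OF B(1)] B(2) by (auto simp: Z1_def B1_def)
  let ?H1 = "C1\<lparr>carrier := Z1\<rparr>" and ?H2 = "C2\<lparr>carrier := Z\<rparr>"
  interpret H1: comm_group ?H1
    by (rule C1.subgroup_comm_group [OF sub(1)])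
  interpret H2: comm_group ?H2
    by (rule C2.subgroup_comm_group [OF Z])
  interpret N1: normal B1 ?H1
    by (intro H1.subgroup_imp_normal C1.subgroup_incl sub)
  interpret N2: normal B ?H2
    by (intro H2.subgroup_imp_normal C2.subgroup_incl Z B)
  have PZ: "P x \<in> Z" "x \<in> S" if "x \<in> Z1" for x
    using that by (simp_all add: Z1_def)
  \<comment> \<open>The image of a coset of \<open>B1\<close> lies in one coset of \<open>B\<close>
    but need not exhaust it; multiplication by \<open>B\<close> fills it up.\<close>
  have coset: "B <#>\<^bsub>C2\<^esub> P ` (B1 #>\<^bsub>C1\<^esub> x) = B #>\<^bsub>C2\<^esub> P x" if x: "x \<in> Z1" for x
  proof -
    have B_carrier: "b \<in> carrier C2" if "b \<in> B" for b
      using that subgroup.mem_carrier [OF B(1)] by blast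
    have Px: "P x \<in> carrier C2"
      using PZ [OF x] P by simp
    show ?thesis
    proof
      show "B <#>\<^bsub>C2\<^esub> P ` (B1 #>\<^bsub>C1\<^esub> x) \<subseteq> B #>\<^bsub>C2\<^esub> P x"
      proof
        fix z
        assume "z \<in> B <#>\<^bsub>C2\<^esub> P ` (B1 #>\<^bsub>C1\<^esub> x)"
        then obtain b b1 where b: "b \<in> B" "b1 \<in> B1" "z = b \<otimes>\<^bsub>C2\<^esub> P (b1 \<otimes>\<^bsub>C1\<^esub> x)"
          by (auto simp: set_mult_def r_coset_def)
        then have "z = (b \<otimes>\<^bsub>C2\<^esub> P b1) \<otimes>\<^bsub>C2\<^esub> P x"
          using B_carrier Px P PZ [OF x] by (simp add: B1_def P_mult C2.m_assoc)
        moreover have "b \<otimes>\<^bsub>C2\<^esub> P b1 \<in> B"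
          using b subgroup.m_closed [OF B(1)] by (simp add: B1_def)
        ultimately show "z \<in> B #>\<^bsub>C2\<^esub> P x"
          by (auto simp: r_coset_def)
      qed
      show "B #>\<^bsub>C2\<^esub> P x \<subseteq> B <#>\<^bsub>C2\<^esub> P ` (B1 #>\<^bsub>C1\<^esub> x)"
      proof
        fix z
        assume "z \<in> B #>\<^bsub>C2\<^esub> P x"
        then obtain b where b: "b \<in> B" "z = b \<otimes>\<^bsub>C2\<^esub> P x"
          by (auto simp: r_coset_def)
        have "x \<in> B1 #>\<^bsub>C1\<^esub> x"
          using H1.rcos_self [of x B1] N1.subgroup_axioms x by simp
        with b show "z \<in> B <#>\<^bsub>C2\<^esub> P ` (B1 #>\<^bsub>C1\<^esub> x)"
          by (auto simp: set_mult_def)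
      qed
    qed
  qed
  have cosets1: "\<exists>x\<in>Z1. c = B1 #>\<^bsub>C1\<^esub> x" if "c \<in> carrier (?H1 Mod B1)" for c
    using that by (auto simp: FactGroup_def RCOSETS_def)
  have cosets2: "\<exists>z\<in>Z. c = B #>\<^bsub>C2\<^esub> z" if "c \<in> carrier (?H2 Mod B)" for c
    using that by (auto simp: FactGroup_def RCOSETS_def)
  have mult1: "U \<otimes>\<^bsub>?H1 Mod B1\<^esub> V = U <#>\<^bsub>C1\<^esub> V" for U V
    by (simp add: FactGroup_def set_mult_def)
  have mult2: "U \<otimes>\<^bsub>?H2 Mod B\<^esub> V = U <#>\<^bsub>C2\<^esub> V" for U V
    by (simp add: FactGroup_def set_mult_def)
  have sum1: "(B1 #>\<^bsub>C1\<^esub> x) <#>\<^bsub>C1\<^esub> (B1 #>\<^bsub>C1\<^esub> y) = B1 #>\<^bsub>C1\<^esub> (x \<otimes>\<^bsub>C1\<^esub> y)"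
    if "x \<in> Z1" "y \<in> Z1" for x y
    using N1.rcos_sum [of x y] that by (simp add: set_mult_def)
  have sum2: "(B #>\<^bsub>C2\<^esub> x) <#>\<^bsub>C2\<^esub> (B #>\<^bsub>C2\<^esub> y) = B #>\<^bsub>C2\<^esub> (x \<otimes>\<^bsub>C2\<^esub> y)"
    if "x \<in> Z" "y \<in> Z" for x y
    using N2.rcos_sum [of x y] that by (simp add: set_mult_def)
  let ?h = "\<lambda>c. B <#>\<^bsub>C2\<^esub> P ` c"
  have "?h \<in> hom (?H1 Mod B1) (?H2 Mod B)"
  proof (rule homI)
    fix c
    assume "c \<in> carrier (?H1 Mod B1)"
    then obtain x where x: "x \<in> Z1" "c = B1 #>\<^bsub>C1\<^esub> x"
      using cosets1 by blast
    show "?h c \<in> carrier (?H2 Mod B)"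
      unfolding x(2) coset [OF x(1)] using PZ [OF x(1)] by (auto simp: FactGroup_def RCOSETS_def)
  next
    fix c d
    assume cd: "c \<in> carrier (?H1 Mod B1)" "d \<in> carrier (?H1 Mod B1)"
    obtain x y where xy: "x \<in> Z1" "y \<in> Z1" "c = B1 #>\<^bsub>C1\<^esub> x" "d = B1 #>\<^bsub>C1\<^esub> y"
      using cosets1 [OF cd(1)] cosets1 [OF cd(2)] by blast
    have xy_Z1: "x \<otimes>\<^bsub>C1\<^esub> y \<in> Z1"
      by (rule subgroup.m_closed [OF sub(1) xy(1,2)])
    show "?h (c \<otimes>\<^bsub>?H1 Mod B1\<^esub> d) = ?h c \<otimes>\<^bsub>?H2 Mod B\<^esub> ?h d"
      unfolding mult1 mult2 xy(3,4) sum1 [OF xy(1,2)] coset [OF xy(1)] coset [OF xy(2)] coset [OF xy_Z1]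
        P_mult [OF PZ(2) [OF xy(1)] PZ(2) [OF xy(2)]] sum2 [OF PZ(1) [OF xy(1)] PZ(1) [OF xy(2)]] ..
  qed
  moreover have "bij_betw ?h (carrier (?H1 Mod B1)) (carrier (?H2 Mod B))"
  proof (rule bij_betw_imageI)
    show "inj_on ?h (carrier (?H1 Mod B1))"
    proof (rule inj_onI)
      fix c d
      assume cd: "c \<in> carrier (?H1 Mod B1)" "d \<in> carrier (?H1 Mod B1)" and eq: "?h c = ?h d"
      obtain x y where xy: "x \<in> Z1" "y \<in> Z1" "c = B1 #>\<^bsub>C1\<^esub> x" "d = B1 #>\<^bsub>C1\<^esub> y"
        using cosets1 [OF cd(1)] cosets1 [OF cd(2)] by blast
      have "B #>\<^bsub>C2\<^esub> P x = B #>\<^bsub>C2\<^esub> P y"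
        using eq unfolding xy(3,4) coset [OF xy(1)] coset [OF xy(2)] .
      moreover have "P x \<in> B #>\<^bsub>C2\<^esub> P x"
        using H2.rcos_self [of "P x" B] N2.subgroup_axioms PZ [OF xy(1)] by simp
      ultimately have "P x \<in> B #>\<^bsub>C2\<^esub> P y"
        by (simp only:)
      then obtain b where b: "b \<in> B" "P x = b \<otimes>\<^bsub>C2\<^esub> P y"
        by (auto simp: r_coset_def)
      let ?w = "x \<otimes>\<^bsub>C1\<^esub> inv\<^bsub>C1\<^esub> y"
      have iy: "inv\<^bsub>C1\<^esub> y \<in> Z1"
        using subgroup.m_inv_closed [OF sub(1) xy(2)] .
      have carr: "x \<in> carrier C1" "y \<in> carrier C1"
        using xy subgroup.mem_carrier [OF sub(1)] by blast+
      have w: "?w \<in> Z1"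
        using subgroup.m_closed [OF sub(1) xy(1) iy] .
      have "P ?w \<otimes>\<^bsub>C2\<^esub> P y = P x"
        using P_mult [OF PZ(2) [OF w] PZ(2) [OF xy(2)]] carr by (simp add: C1.m_assoc)
      then have "P ?w \<otimes>\<^bsub>C2\<^esub> P y = b \<otimes>\<^bsub>C2\<^esub> P y"
        unfolding b(2) .
      then have "P ?w = b"
        using P [OF PZ(2) [OF xy(2)]] P [OF PZ(2) [OF w]] subgroup.mem_carrier [OF B(1) b(1)]
        by (simp only: C2.right_cancel)
      then have "?w \<in> B1"
        using b PZ(2) [OF w] by (simp add: B1_def)
      moreover have "x = ?w \<otimes>\<^bsub>C1\<^esub> y"
        using carr by (simp add: C1.m_assoc)
      ultimately have "x \<in> B1 #>\<^bsub>C1\<^esub> y"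
        by (auto simp: r_coset_def)
      then show "c = d"
        using H1.repr_independence [of x B1 y] N1.subgroup_axioms xy by simp
    qed
    show "?h ` carrier (?H1 Mod B1) = carrier (?H2 Mod B)"
    proof
      show "?h ` carrier (?H1 Mod B1) \<subseteq> carrier (?H2 Mod B)"
        using \<open>?h \<in> hom (?H1 Mod B1) (?H2 Mod B)\<close> by (auto simp: hom_def)
      show "carrier (?H2 Mod B) \<subseteq> ?h ` carrier (?H1 Mod B1)"
      proof
        fix c
        assume "c \<in> carrier (?H2 Mod B)"
        then obtain z where z: "z \<in> Z" "c = B #>\<^bsub>C2\<^esub> z"
          using cosets2 by blast
        obtain x b where x: "x \<in> S" "b \<in> B" "z = P x \<otimes>\<^bsub>C2\<^esub> b"
          using surj [OF z(1)] by blast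
        have carr: "b \<in> carrier C2" "P x \<in> carrier C2"
          using x P subgroup.mem_carrier [OF B(1)] by auto
        have "inv\<^bsub>C2\<^esub> b \<in> Z"
          using subgroup.m_inv_closed [OF B(1) x(2)] B(2) by blast
        then have "z \<otimes>\<^bsub>C2\<^esub> inv\<^bsub>C2\<^esub> b \<in> Z"
          using subgroup.m_closed [OF Z z(1)] by blast
        then have Px: "P x \<in> Z"
          using carr by (simp add: x(3) C2.m_assoc)
        then have "x \<in> Z1"
          using x by (simp add: Z1_def)
        have "z = b \<otimes>\<^bsub>?H2\<^esub> P x"
          using x(3) carr C2.m_comm by simp
        then have "z \<in> B #>\<^bsub>C2\<^esub> P x"
          using x(2) by (auto simp: r_coset_def)
        then have "c = B #>\<^bsub>C2\<^esub> P x"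
          using H2.repr_independence [of z B "P x"] N2.subgroup_axioms Px z by simp
        then have "c = ?h (B1 #>\<^bsub>C1\<^esub> x)"
          using coset [OF \<open>x \<in> Z1\<close>] by simp
        moreover have "B1 #>\<^bsub>C1\<^esub> x \<in> carrier (?H1 Mod B1)"
          using \<open>x \<in> Z1\<close> by (auto simp: FactGroup_def RCOSETS_def)
        ultimately show "c \<in> ?h ` carrier (?H1 Mod B1)"
          by (rule image_eqI)
      qed
    qed
  qed
  ultimately show ?thesis
    by (simp add: iso_def Z1_def B1_def)
qed

section \<open>The profinite completion\<close>

context group
begin

abbreviation Ghat :: "('a set \<Rightarrow> 'a set) monoid" where
  "Ghat \<equiv> profinite_completion G"

abbreviation fin_normal :: "'a set set" where
  "fin_normal \<equiv> finite_index_normal G"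

lemma carrier_Ghat:
  "x \<in> carrier Ghat \<longleftrightarrow> x \<in> (\<Pi>\<^sub>E N\<in>fin_normal. carrier (G Mod N)) \<and>
    (\<forall>N\<in>fin_normal. \<forall>K\<in>fin_normal. N \<subseteq> K \<longrightarrow> x N \<subseteq> x K)"
  by (simp add: profinite_completion_def)

lemma Ghat_compatible:
  "x \<in> carrier Ghat \<Longrightarrow> N \<in> fin_normal \<Longrightarrow> K \<in> fin_normal \<Longrightarrow> N \<subseteq> K \<Longrightarrow> x N \<subseteq> x K"
  unfolding carrier_Ghat by blast

lemma Ghat_PiE: "x \<in> carrier Ghat \<Longrightarrow> x \<in> (\<Pi>\<^sub>E N\<in>fin_normal. carrier (G Mod N))"
  unfolding carrier_Ghat by blast

text \<open>One group element serves all \<open>K\<close> above \<open>N\<close> at once: a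
  representative of the coset at \<open>N\<close> lies in the coset at \<open>K\<close> by
  compatibility. Elements of the completion can thus be replaced by group elements at a given
  level.\<close>

lemma Ghat_representative:
  assumes "x \<in> carrier Ghat" "N \<in> fin_normal"
  shows "\<exists>g\<in>carrier G. \<forall>K\<in>fin_normal. N \<subseteq> K \<longrightarrow> x K = cl K g"
proof -
  have coset: "\<exists>g\<in>carrier G. x K = K #> g" if "K \<in> fin_normal" for K
  proof -
    have "x K \<in> carrier (G Mod K)"
      using Ghat_PiE [OF assms(1)] that by (rule PiE_mem)
    then show ?thesis
      by (auto simp: FactGroup_def RCOSETS_def)
  qed
  obtain g where g: "g \<in> carrier G" "x N = N #> g"
    using coset [OF assms(2)] by blast
  have "x K = cl K g" if K: "K \<in> fin_normal" "N \<subseteq> K" for K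
  proof -
    obtain k where k: "k \<in> carrier G" "x K = K #> k"
      using coset [OF K(1)] by blast
    have "g \<in> x N"
      using g rcos_self [OF g(1) finite_index_normal_subgroup [OF assms(2)]] by simp
    then have "g \<in> K #> k"
      using Ghat_compatible [OF assms K] unfolding k(2) by (rule subsetD [rotated])
    then have "K #> k = K #> g"
      by (rule repr_independence [OF _ k(1) finite_index_normal_subgroup [OF K(1)]])
    then show ?thesis
      using k(2) g(1) by (simp add: cl_def)
  qed
  with g(1) show ?thesis
    by blast
qed

definition approx :: "'a set \<Rightarrow> ('a set \<Rightarrow> 'a set) \<Rightarrow> 'a" where
  "approx N x = (SOME g. g \<in> carrier G \<and> (\<forall>K\<in>fin_normal. N \<subseteq> K \<longrightarrow> x K = cl K g))"

lemma approx:
  assumes "x \<in> carrier Ghat" "N \<in> fin_normal"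
  shows "approx N x \<in> carrier G" "\<And>K. K \<in> fin_normal \<Longrightarrow> N \<subseteq> K \<Longrightarrow> x K = cl K (approx N x)"
proof -
  have *: "approx N x \<in> carrier G \<and> (\<forall>K\<in>fin_normal. N \<subseteq> K \<longrightarrow> x K = cl K (approx N x))"
    unfolding approx_def by (rule someI_ex) (rule Ghat_representative [OF assms, unfolded Bex_def])
  then show "approx N x \<in> carrier G"
    by (rule conjunct1)
  show "x K = cl K (approx N x)" if "K \<in> fin_normal" "N \<subseteq> K" for K
    using bspec [OF conjunct2 [OF *] that(1)] that(2) by (rule mp)
qed

lemma Ghat_mono:
  assumes "x \<in> carrier Ghat" "y \<in> carrier Ghat" "N \<in> fin_normal" "K \<in> fin_normal" "N \<subseteq> K" "x N = y N"
  shows "x K = y K"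
proof -
  have "cl N (approx N x) = cl N (approx N y)"
    using approx(2) [OF assms(1,3,3) subset_refl] approx(2) [OF assms(2,3,3) subset_refl] assms(6) by simp
  then have "cl K (approx N x) = cl K (approx N y)"
    by (rule cl_mono [OF finite_index_normal_subgroup [OF assms(3)] finite_index_normal_subgroup [OF assms(4)] assms(5)])
  then show ?thesis
    using approx(2) [OF assms(1,3,4,5)] approx(2) [OF assms(2,3,4,5)] by simp
qed

lemma to_completion_apply: "g \<in> carrier G \<Longrightarrow> N \<in> fin_normal \<Longrightarrow> to_completion G g N = cl N g"
  by (simp add: to_completion_def cl_def)

lemma to_completion_closed:
  assumes "g \<in> carrier G"
  shows "to_completion G g \<in> carrier Ghat"
  unfolding carrier_Ghat
proof (intro conjI ballI impI)
  show "to_completion G g \<in> (\<Pi>\<^sub>E N\<in>fin_normal. carrier (G Mod N))"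
    using assms by (auto simp: to_completion_def FactGroup_def RCOSETS_def)
  show "to_completion G g N \<subseteq> to_completion G g K" if "N \<in> fin_normal" "K \<in> fin_normal" "N \<subseteq> K" for N K
    using that by (auto simp: to_completion_def r_coset_def)
qed

lemma Ghat_mult: "N \<in> fin_normal \<Longrightarrow> (x \<otimes>\<^bsub>Ghat\<^esub> y) N = x N <#> y N"
  by (simp add: profinite_completion_def FactGroup_def)

lemma cl_set_mult: "N \<lhd> G \<Longrightarrow> cl N g <#> cl N h = cl N (g \<odot> h)"
  by (simp add: cl_def mul_def normal.rcos_sum)

lemma Ghat_mult_closed:
  assumes "x \<in> carrier Ghat" "y \<in> carrier Ghat"
  shows "x \<otimes>\<^bsub>Ghat\<^esub> y \<in> carrier Ghat"
  unfolding carrier_Ghat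
proof (intro conjI ballI impI)
  have cl_xy: "(x \<otimes>\<^bsub>Ghat\<^esub> y) K = cl K (approx N x \<odot> approx N y)"
    if "N \<in> fin_normal" "K \<in> fin_normal" "N \<subseteq> K" for N K
    by (simp add: Ghat_mult that approx(2) [OF assms(1) that] approx(2) [OF assms(2) that]
        cl_set_mult finite_index_normal_normal)
  show "x \<otimes>\<^bsub>Ghat\<^esub> y \<in> (\<Pi>\<^sub>E N\<in>fin_normal. carrier (G Mod N))"
  proof (rule PiE_I)
    show "(x \<otimes>\<^bsub>Ghat\<^esub> y) N \<in> carrier (G Mod N)" if "N \<in> fin_normal" for N
      unfolding cl_xy [OF that that subset_refl]
      by (auto simp: FactGroup_def RCOSETS_def cl_def intro: bexI [OF _ rr_closed])
    show "(x \<otimes>\<^bsub>Ghat\<^esub> y) N = undefined" if "N \<notin> fin_normal" for N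
      using that by (simp add: profinite_completion_def)
  qed
  show "(x \<otimes>\<^bsub>Ghat\<^esub> y) N \<subseteq> (x \<otimes>\<^bsub>Ghat\<^esub> y) K" if "N \<in> fin_normal" "K \<in> fin_normal" "N \<subseteq> K" for N K
    using that(3) unfolding cl_xy [OF that] cl_xy [OF that(1,1) subset_refl] by (auto simp: cl_def r_coset_def)
qed

lemma finite_index_normal_Inter:
  assumes "finite F" "F \<subseteq> fin_normal"
  shows "\<exists>N\<in>fin_normal. \<forall>K\<in>F. N \<subseteq> K"
  using assms
proof induction
  case empty
  then show ?case
    using finite_index_normal_UNIV by blast
next
  case (insert K F)
  then obtain N where "N \<in> fin_normal" "\<forall>K\<in>F. N \<subseteq> K"
    by auto
  then show ?case
    using insert.prems finite_index_normal_Int [of N K] by (intro bexI [of _ "N \<inter> K"]) auto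
qed

abbreviation prod_top :: "('a set \<Rightarrow> 'a set) topology" where
  "prod_top \<equiv> product_topology (\<lambda>N. discrete_topology (carrier (G Mod N))) fin_normal"

abbreviation Ghat_top :: "('a set \<Rightarrow> 'a set) topology" where
  "Ghat_top \<equiv> profinite_topology G"

lemma topspace_Ghat: "topspace Ghat_top = carrier Ghat"
  using Ghat_PiE by (auto simp: profinite_topology_def)

lemma openin_coordinate: "N \<in> fin_normal \<Longrightarrow> openin prod_top {x \<in> topspace prod_top. x N = v}"
proof -
  assume N: "N \<in> fin_normal"
  have "openin prod_top {x \<in> topspace prod_top. x N \<in> {v} \<inter> carrier (G Mod N)}"
    by (rule openin_continuous_map_preimage [OF continuous_map_product_projection [OF N]]) simp
  moreover have "{x \<in> topspace prod_top. x N \<in> {v} \<inter> carrier (G Mod N)} = {x \<in> topspace prod_top. x N = v}"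
    using N by auto
  ultimately show ?thesis
    by simp
qed

lemma compact_Ghat: "compact_space Ghat_top"
proof -
  \<comment> \<open>A violation of compatibility is visible in two coordinates, so the complement is
    open and the completion is closed in a product of finite discrete spaces.\<close>
  have "openin prod_top (topspace prod_top - carrier Ghat)"
  proof (subst openin_subopen, intro ballI)
    fix x
    assume x: "x \<in> topspace prod_top - carrier Ghat"
    then obtain N K where NK: "N \<in> fin_normal" "K \<in> fin_normal" "N \<subseteq> K" "\<not> x N \<subseteq> x K"
      by (auto simp: carrier_Ghat)
    let ?U = "{y \<in> topspace prod_top. y N = x N} \<inter> {y \<in> topspace prod_top. y K = x K}"
    have "openin prod_top ?U"
      by (intro openin_Int openin_coordinate NK)
    moreover have "?U \<subseteq> topspace prod_top - carrier Ghat"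
    proof
      fix y
      assume y: "y \<in> ?U"
      then have "\<not> y N \<subseteq> y K"
        using NK(4) by simp
      then have "y \<notin> carrier Ghat"
        using Ghat_compatible NK(1,2,3) by blast
      then show "y \<in> topspace prod_top - carrier Ghat"
        using y by simp
    qed
    ultimately show "\<exists>U. openin prod_top U \<and> x \<in> U \<and> U \<subseteq> topspace prod_top - carrier Ghat"
      using x by (intro exI [of _ ?U] conjI) simp_all
  qed
  then have "closedin prod_top (carrier Ghat)"
    unfolding closedin_def by (simp add: subsetI Ghat_PiE)
  moreover have "compact_space (discrete_topology (carrier (G Mod N)))" if "N \<in> fin_normal" for N
    using that by (simp add: finite_index_normal_def compact_space_discrete_topology)
  then have "compact_space prod_top"
    by (simp only: compact_space_product_topology) blast
  ultimately show ?thesis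
    unfolding profinite_topology_def by (intro compact_space_subtopology closedin_compact_space)
qed

text \<open>A basic open set restricts only finitely many coordinates, and on the completion these
  are all determined by the coordinate at one common smaller subgroup.\<close>

lemma Ghat_neighbourhood:
  assumes "openin Ghat_top U" "x \<in> U"
  shows "\<exists>N\<in>fin_normal. \<forall>y\<in>carrier Ghat. y N = x N \<longrightarrow> y \<in> U"
proof -
  obtain V where V: "openin prod_top V" "U = V \<inter> carrier Ghat"
    using assms(1) by (auto simp: profinite_topology_def openin_subtopology)
  have "\<exists>W. finite {N \<in> fin_normal. W N \<noteq> topspace (discrete_topology (carrier (G Mod N)))} \<and>
      (\<forall>N\<in>fin_normal. openin (discrete_topology (carrier (G Mod N))) (W N)) \<and>
      x \<in> PiE fin_normal W \<and> PiE fin_normal W \<subseteq> V"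
    using assms(2) unfolding V(2) by (intro bspec [OF iffD1 [OF openin_product_topology_alt V(1)]]) simp
  then obtain W where W: "finite {N \<in> fin_normal. W N \<noteq> carrier (G Mod N)}"
    "x \<in> PiE fin_normal W" "PiE fin_normal W \<subseteq> V"
    by auto
  obtain N where N: "N \<in> fin_normal" "\<And>K. K \<in> fin_normal \<Longrightarrow> W K \<noteq> carrier (G Mod K) \<Longrightarrow> N \<subseteq> K"
    using finite_index_normal_Inter [OF W(1)] by auto
  have x: "x \<in> carrier Ghat"
    using assms(2) V(2) by blast
  have "y \<in> U" if y: "y \<in> carrier Ghat" "y N = x N" for y
  proof -
    have "y \<in> PiE fin_normal W"
    proof (rule PiE_I)
      show "y K \<in> W K" if K: "K \<in> fin_normal" for K
      proof (cases "W K = carrier (G Mod K)")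
        case True
        then show ?thesis
          using PiE_mem [OF Ghat_PiE [OF y(1)] K] by simp
      next
        case False
        have "y K = x K"
          by (rule Ghat_mono [OF y(1) x N(1) K N(2) [OF K False] y(2)])
        then show ?thesis
          using W(2) K by auto
      qed
      show "y K = undefined" if "K \<notin> fin_normal" for K
        by (rule PiE_arb [OF Ghat_PiE [OF y(1)] that])
    qed
    then show ?thesis
      using W(3) V(2) y(1) by blast
  qed
  with N(1) show ?thesis
    by blast
qed

text \<open>The nontrivial direction is compactness: continuity gives a level for each point,
  finitely many of the resulting cylinders cover, and a subgroup below their levels works
  uniformly.\<close>

lemma continuous_iff_factors:
  assumes f: "f \<in> tuples n (carrier Ghat) \<rightarrow> S"
  shows "continuous_map (product_topology (\<lambda>_. Ghat_top) {..<n}) (discrete_topology S) f \<longleftrightarrow>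
    (\<exists>N\<in>fin_normal. \<forall>x\<in>tuples n (carrier Ghat). \<forall>y\<in>tuples n (carrier Ghat).
      (\<forall>j<n. x j N = y j N) \<longrightarrow> f x = f y)"
    (is "?cont \<longleftrightarrow> ?fac")
proof -
  let ?X = "product_topology (\<lambda>_. Ghat_top) {..<n}"
  let ?T = "tuples n (carrier Ghat)"
  let ?U = "\<lambda>N x. {y \<in> ?T. \<forall>j<n. y j N = x j N}"
  have top: "topspace ?X = ?T"
    by (simp add: topspace_Ghat tuples_def)
  have mem: "x j \<in> carrier Ghat" if "x \<in> ?T" "j < n" for x j
    using that by (auto simp: tuples_def)
  have open_U: "openin ?X (?U N x)" if N: "N \<in> fin_normal" for N x
  proof -
    have *: "openin Ghat_top {z \<in> carrier Ghat. z N = v}" for v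
    proof -
      have "{z \<in> carrier Ghat. z N = v} = {z \<in> topspace prod_top. z N = v} \<inter> carrier Ghat"
        using Ghat_PiE by auto
      then show ?thesis
        unfolding profinite_topology_def openin_subtopology using openin_coordinate [OF N] by blast
    qed
    have "?U N x = (\<Pi>\<^sub>E j\<in>{..<n}. {z \<in> carrier Ghat. z N = x j N})"
      by (auto simp: tuples_def PiE_def Pi_def)
    then show ?thesis
      by (simp add: openin_PiE *)
  qed
  show ?thesis
  proof
    assume ?fac
    then obtain N where N: "N \<in> fin_normal"
      "\<And>x y. x \<in> ?T \<Longrightarrow> y \<in> ?T \<Longrightarrow> \<forall>j<n. x j N = y j N \<Longrightarrow> f x = f y"
      by blast
    have "openin ?X {x \<in> ?T. f x \<in> V}" for V
    proof (subst openin_subopen, intro ballI)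
      fix x
      assume x: "x \<in> {x \<in> ?T. f x \<in> V}"
      have "?U N x \<subseteq> {x \<in> ?T. f x \<in> V}"
      proof
        fix y
        assume y: "y \<in> ?U N x"
        then have "f y = f x"
          using x by (intro N(2)) auto
        then show "y \<in> {x \<in> ?T. f x \<in> V}"
          using x y by simp
      qed
      then show "\<exists>U. openin ?X U \<and> x \<in> U \<and> U \<subseteq> {x \<in> ?T. f x \<in> V}"
        using open_U [OF N(1), of x] x by (intro exI [of _ "?U N x"]) auto
    qed
    then show ?cont
      unfolding continuous_map_def top using f by simp
  next
    assume cont: ?cont
    have "\<exists>N\<in>fin_normal. \<forall>y\<in>?U N x. f y = f x" if x: "x \<in> ?T" for x
    proof -
      have "f x \<in> S"
        using f x by blast
      then have "openin ?X {y \<in> ?T. f y \<in> {f x}}"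
        unfolding top [symmetric] by (intro openin_continuous_map_preimage [OF cont]) simp
      then have "\<exists>V. finite {j \<in> {..<n}. V j \<noteq> topspace Ghat_top} \<and> (\<forall>j\<in>{..<n}. openin Ghat_top (V j)) \<and>
          x \<in> PiE {..<n} V \<and> PiE {..<n} V \<subseteq> {y \<in> ?T. f y \<in> {f x}}"
        by (rule bspec [OF iffD1 [OF openin_product_topology_alt]]) (simp add: x)
      then obtain V where V_open: "\<forall>j\<in>{..<n}. openin Ghat_top (V j)" and V: "x \<in> PiE {..<n} V"
        "PiE {..<n} V \<subseteq> {y \<in> ?T. f y \<in> {f x}}"
        by (elim exE conjE)
      have "\<exists>N\<in>fin_normal. \<forall>z\<in>carrier Ghat. z N = x j N \<longrightarrow> z \<in> V j" if "j < n" for j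
        using bspec [OF V_open, of j] PiE_mem [OF V(1), of j] that by (intro Ghat_neighbourhood) simp_all
      then obtain N where N: "\<And>j. j < n \<Longrightarrow> N j \<in> fin_normal"
        "\<And>j z. j < n \<Longrightarrow> z \<in> carrier Ghat \<Longrightarrow> z (N j) = x j (N j) \<Longrightarrow> z \<in> V j"
        by metis
      obtain K where K: "K \<in> fin_normal" "\<And>j. j < n \<Longrightarrow> K \<subseteq> N j"
      proof -
        have "N ` {..<n} \<subseteq> fin_normal"
          using N(1) by blast
        then obtain K where "K \<in> fin_normal" "\<forall>L\<in>N ` {..<n}. K \<subseteq> L"
          using finite_index_normal_Inter [of "N ` {..<n}"] by blast
        then show thesis
          by (intro that [of K]) blast+
      qed
      have "f y = f x" if y: "y \<in> ?U K x" for y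
      proof -
        have "y \<in> PiE {..<n} V"
        proof (rule PiE_I)
          fix j
          assume "j \<in> {..<n}"
          then have j: "j < n"
            by simp
          have yj: "y j \<in> carrier Ghat" "y j K = x j K"
            using y j mem by auto
          have "y j (N j) = x j (N j)"
            by (rule Ghat_mono [OF yj(1) mem [OF x j] K(1) N(1) [OF j] K(2) [OF j] yj(2)])
          then show "y j \<in> V j"
            by (rule N(2) [OF j yj(1)])
        next
          show "y j = undefined" if "j \<notin> {..<n}" for j
            using y that by (auto simp: tuples_def)
        qed
        then show ?thesis
          using V(2) by blast
      qed
      with K(1) show ?thesis
        by blast
    qed
    then have "\<forall>x\<in>?T. \<exists>N. N \<in> fin_normal \<and> (\<forall>y\<in>?U N x. f y = f x)"
      by blast
    from bchoice [OF this] obtain N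
      where N_all: "\<forall>x\<in>?T. N x \<in> fin_normal \<and> (\<forall>y\<in>?U (N x) x. f y = f x)"
      by (elim exE)
    have N: "N x \<in> fin_normal" "y \<in> ?U (N x) x \<Longrightarrow> f y = f x" if "x \<in> ?T" for x y
    proof -
      show "N x \<in> fin_normal"
        by (rule conjunct1 [OF bspec [OF N_all that]])
      show "f y = f x" if "y \<in> ?U (N x) x"
        by (rule bspec [OF conjunct2 [OF bspec [OF N_all \<open>x \<in> ?T\<close>]] that])
    qed
    have "compact_space ?X"
      by (simp add: compact_space_product_topology compact_Ghat)
    then have "compactin ?X ?T"
      unfolding compact_space_def top .
    then have "\<exists>F. finite F \<and> F \<subseteq> (\<lambda>x. ?U (N x) x) ` ?T \<and> ?T \<subseteq> \<Union>F"
    proof (rule compactinD)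
      show "openin ?X V" if "V \<in> (\<lambda>x. ?U (N x) x) ` ?T" for V
        using that open_U N(1) by blast
      show "?T \<subseteq> \<Union> ((\<lambda>x. ?U (N x) x) ` ?T)"
        by auto
    qed
    then obtain F where F: "finite F" "F \<subseteq> ?T" "?T \<subseteq> (\<Union>x\<in>F. ?U (N x) x)"
      by (metis (no_types, lifting) finite_subset_image)
    obtain K where K: "K \<in> fin_normal" "\<And>x. x \<in> F \<Longrightarrow> K \<subseteq> N x"
    proof -
      have "N ` F \<subseteq> fin_normal"
        using F(2) N(1) by blast
      then obtain K where "K \<in> fin_normal" "\<forall>L\<in>N ` F. K \<subseteq> L"
        using finite_index_normal_Inter [of "N ` F"] F(1) by blast
      then show thesis
        by (intro that [of K]) blast+
    qed
    have "f x = f y" if xy: "x \<in> ?T" "y \<in> ?T" and eq: "\<forall>j<n. x j K = y j K" for x y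
    proof -
      obtain z where z: "z \<in> F" "x \<in> ?U (N z) z"
        using F(3) xy(1) by blast
      have zT: "z \<in> ?T"
        using z(1) F(2) by blast
      have "y j (N z) = z j (N z)" if j: "j < n" for j
      proof -
        have "x j K = y j K"
          using eq j by simp
        then have "x j (N z) = y j (N z)"
          by (rule Ghat_mono [OF mem [OF xy(1) j] mem [OF xy(2) j] K(1) N(1) [OF zT] K(2) [OF z(1)]])
        then show ?thesis
          using z(2) j by simp
      qed
      then have "y \<in> ?U (N z) z"
        using xy(2) by simp
      then show ?thesis
        using N(2) [OF zT z(2)] N(2) [OF zT, of y] by simp
    qed
    with K(1) show ?fac
      by blast
  qed
qed

end

section \<open>Comparison of the cohomology groups\<close>

context coefficients
begin

abbreviation continuous :: "nat \<Rightarrow> ((nat \<Rightarrow> 'g set \<Rightarrow> 'g set) \<Rightarrow> 'm) set" where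
  "continuous \<equiv> continuous_cochains Ghat_top Ghat M"

abbreviation pullback :: "nat \<Rightarrow> ((nat \<Rightarrow> 'g set \<Rightarrow> 'g set) \<Rightarrow> 'm) \<Rightarrow> (nat \<Rightarrow> 'g) \<Rightarrow> 'm" where
  "pullback \<equiv> cochain_pullback G (to_completion G)"

text \<open>\<open>f\<close> on the completion and \<open>l\<close> on the group take the same value
  whenever their arguments have the same cosets modulo \<open>N\<close>. Working with this relation
  treats pullback and extension simultaneously, so each operation on cochains is checked only
  once.\<close>

definition agree :: "nat \<Rightarrow> 'g set \<Rightarrow> ((nat \<Rightarrow> 'g) \<Rightarrow> 'm) \<Rightarrow> ((nat \<Rightarrow> 'g set \<Rightarrow> 'g set) \<Rightarrow> 'm) \<Rightarrow> bool" where
  "agree n N l f \<longleftrightarrow> (\<forall>x\<in>tuples n (carrier Ghat). \<forall>g\<in>tuples n (carrier G).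
    (\<forall>j<n. x j N = cl N (g j)) \<longrightarrow> f x = l g)"

definition extends :: "nat \<Rightarrow> ((nat \<Rightarrow> 'g) \<Rightarrow> 'm) \<Rightarrow> ((nat \<Rightarrow> 'g set \<Rightarrow> 'g set) \<Rightarrow> 'm) \<Rightarrow> bool" where
  "extends n l f \<longleftrightarrow> l \<in> cochains G M n \<and> f \<in> extensional (tuples n (carrier Ghat)) \<and>
    (\<exists>N\<in>fin_normal. agree n N l f)"

lemma agreeD:
  assumes "agree n N l f" "x \<in> tuples n (carrier Ghat)" "g \<in> tuples n (carrier G)"
    "\<And>j. j < n \<Longrightarrow> x j N = cl N (g j)"
  shows "f x = l g"
proof -
  have "\<forall>j<n. x j N = cl N (g j)"
    using assms(4) by blast
  then show ?thesis
    by (rule mp [OF bspec [OF bspec [OF assms(1) [unfolded agree_def] assms(2)] assms(3)]])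
qed

lemma agree_mono:
  assumes "agree n N l f" "N \<in> fin_normal" "K \<in> fin_normal" "K \<subseteq> N"
  shows "agree n K l f"
  unfolding agree_def
proof (intro ballI impI)
  fix x g
  assume xg: "x \<in> tuples n (carrier Ghat)" "g \<in> tuples n (carrier G)" and eq: "\<forall>j<n. x j K = cl K (g j)"
  show "f x = l g"
  proof (rule agreeD [OF assms(1) xg])
    fix j
    assume j: "j < n"
    have x: "x j \<in> carrier Ghat" and g: "g j \<in> carrier G"
      using xg j by (auto simp: tuples_def)
    have "x j K = to_completion G (g j) K"
      using mp [OF spec [OF eq] j] to_completion_apply [OF g assms(3)] by simp
    then have "x j N = to_completion G (g j) N"
      by (rule Ghat_mono [OF x to_completion_closed [OF g] assms(3,2,4)])
    then show "x j N = cl N (g j)"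
      using to_completion_apply [OF g assms(2)] by simp
  qed
qed

lemma extendsI:
  assumes "l \<in> cochains G M n" "f \<in> extensional (tuples n (carrier Ghat))" "N \<in> fin_normal"
    "\<And>x g. x \<in> tuples n (carrier Ghat) \<Longrightarrow> g \<in> tuples n (carrier G) \<Longrightarrow>
      (\<And>j. j < n \<Longrightarrow> x j N = cl N (g j)) \<Longrightarrow> f x = l g"
  shows "extends n l f"
proof -
  have "agree n N l f"
    unfolding agree_def using assms(4) by blast
  with assms(1-3) show ?thesis
    unfolding extends_def by blast
qed

lemma extends_agree: "extends n l f \<Longrightarrow> \<exists>N\<in>fin_normal. agree n N l f"
  by (simp add: extends_def)

lemma extends_cochain: "extends n l f \<Longrightarrow> l \<in> cochains G M n"
  and extends_extensional: "extends n l f \<Longrightarrow> f \<in> extensional (tuples n (carrier Ghat))"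
  by (simp_all add: extends_def)

lemma approx_tuples:
  assumes "x \<in> tuples n (carrier Ghat)" "N \<in> fin_normal"
  shows "(\<lambda>j\<in>{..<n}. approx N (x j)) \<in> tuples n (carrier G)"
    "\<And>j. j < n \<Longrightarrow> x j N = cl N ((\<lambda>j\<in>{..<n}. approx N (x j)) j)"
proof -
  have x: "x j \<in> carrier Ghat" if "j < n" for j
    using assms(1) that by (auto simp: tuples_def)
  show "(\<lambda>j\<in>{..<n}. approx N (x j)) \<in> tuples n (carrier G)"
    using approx(1) [OF x assms(2)] by (simp add: tuples_iff)
  show "x j N = cl N ((\<lambda>j\<in>{..<n}. approx N (x j)) j)" if "j < n" for j
    using approx(2) [OF x [OF that] assms(2,2) subset_refl] that by simp
qed

lemma to_completion_tuples:
  assumes "g \<in> tuples n (carrier G)"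
  shows "(\<lambda>j\<in>{..<n}. to_completion G (g j)) \<in> tuples n (carrier Ghat)"
    "\<And>j N. N \<in> fin_normal \<Longrightarrow> j < n \<Longrightarrow> (\<lambda>j\<in>{..<n}. to_completion G (g j)) j N = cl N (g j)"
proof -
  show "(\<lambda>j\<in>{..<n}. to_completion G (g j)) \<in> tuples n (carrier Ghat)"
    using assms to_completion_closed by (auto simp: tuples_def PiE_def Pi_def)
  show "(\<lambda>j\<in>{..<n}. to_completion G (g j)) j N = cl N (g j)" if "N \<in> fin_normal" "j < n" for j N
    using that assms to_completion_apply by (simp add: tuples_iff)
qed

lemma extends_value:
  assumes "extends n l f" "x \<in> tuples n (carrier Ghat)"
  shows "f x \<in> carrier M"
proof -
  obtain N where N: "N \<in> fin_normal" "agree n N l f"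
    using extends_agree [OF assms(1)] by blast
  have "f x = l (\<lambda>j\<in>{..<n}. approx N (x j))"
    by (rule agreeD [OF N(2) assms(2) approx_tuples [OF assms(2) N(1)]])
  then show ?thesis
    using cochain_closed [OF extends_cochain [OF assms(1)] approx_tuples(1) [OF assms(2) N(1)]] by simp
qed

lemma extends_cochain_Ghat:
  assumes "extends n l f"
  shows "f \<in> cochains Ghat M n"
  using extends_value [OF assms] extends_extensional [OF assms]
  by (simp add: cochains_def cochain_group_def PiE_def Pi_def)

text \<open>Density of the group in the completion: modulo a common level, every tuple of the
  completion is a tuple of group elements.\<close>

lemma extends_unique:
  assumes "extends n l f" "extends n l f'"
  shows "f = f'"
proof (rule extensionalityI [OF extends_extensional [OF assms(1)] extends_extensional [OF assms(2)]])
  fix x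
  assume x: "x \<in> tuples n (carrier Ghat)"
  obtain N where N: "N \<in> fin_normal" "agree n N l f"
    using extends_agree [OF assms(1)] by blast
  obtain N' where N': "N' \<in> fin_normal" "agree n N' l f'"
    using extends_agree [OF assms(2)] by blast
  note K = finite_index_normal_Int [OF N(1) N'(1)]
  note ap = approx_tuples [OF x K]
  show "f x = f' x"
    by (rule HOL.trans [OF agreeD [OF agree_mono [OF N(2,1) K Int_lower1] x ap] HOL.sym [OF agreeD [OF agree_mono [OF N'(2,1) K Int_lower2] x ap]]])
qed

lemma continuous_extends:
  assumes "f \<in> continuous n"
  shows "extends n (pullback n f) f"
proof -
  have f: "f \<in> tuples n (carrier Ghat) \<rightarrow>\<^sub>E carrier M"
    and cont: "continuous_map (product_topology (\<lambda>_. Ghat_top) {..<n}) (discrete_topology (carrier M)) f"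
    using assms by (simp_all add: continuous_cochains_def cochains_def cochain_group_def)
  then have f_Pi: "f \<in> tuples n (carrier Ghat) \<rightarrow> carrier M"
    by (simp add: PiE_def)
  obtain N where N: "N \<in> fin_normal"
    "\<forall>x\<in>tuples n (carrier Ghat). \<forall>y\<in>tuples n (carrier Ghat). (\<forall>j<n. x j N = y j N) \<longrightarrow> f x = f y"
    using iffD1 [OF continuous_iff_factors [OF f_Pi] cont] by (rule bexE)
  show ?thesis
  proof (rule extendsI [OF _ _ N(1)])
    show "pullback n f \<in> cochains G M n"
      using f_Pi to_completion_tuples(1) by (auto simp: cochains_iff cochain_pullback_def)
    show "f \<in> extensional (tuples n (carrier Ghat))"
      using f by (simp add: PiE_def)
    show "f x = pullback n f g" if x: "x \<in> tuples n (carrier Ghat)" and g: "g \<in> tuples n (carrier G)"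
      and eq: "\<And>j. j < n \<Longrightarrow> x j N = cl N (g j)" for x g
    proof -
      have "\<forall>j<n. x j N = (\<lambda>j\<in>{..<n}. to_completion G (g j)) j N"
        by (intro allI impI) (simp only: eq to_completion_tuples(2) [OF g N(1)])
      then have "f x = f (\<lambda>j\<in>{..<n}. to_completion G (g j))"
        by (rule mp [OF bspec [OF bspec [OF N(2) x] to_completion_tuples(1) [OF g]]])
      then show ?thesis
        using g by (simp add: cochain_pullback_def)
    qed
  qed
qed

lemma extends_continuous:
  assumes "extends n l f"
  shows "f \<in> continuous n" "pullback n f = l"
proof -
  obtain N where N: "N \<in> fin_normal" "agree n N l f"
    using extends_agree [OF assms(1)] by blast
  have f: "f \<in> tuples n (carrier Ghat) \<rightarrow> carrier M"
    using extends_value [OF assms] by blast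
  have "f x = f y" if xy: "x \<in> tuples n (carrier Ghat)" "y \<in> tuples n (carrier Ghat)"
    and eq: "\<forall>j<n. x j N = y j N" for x y
  proof -
    note ap = approx_tuples [OF xy(1) N(1)]
    have "f x = l (\<lambda>j\<in>{..<n}. approx N (x j))"
      by (rule agreeD [OF N(2) xy(1) ap])
    moreover have "y j N = cl N ((\<lambda>j\<in>{..<n}. approx N (x j)) j)" if "j < n" for j
      using ap(2) [OF that] eq that by (simp only:)
    then have "f y = l (\<lambda>j\<in>{..<n}. approx N (x j))"
      by (rule agreeD [OF N(2) xy(2) ap(1)])
    ultimately show ?thesis
      by simp
  qed
  then have "\<exists>N\<in>fin_normal. \<forall>x\<in>tuples n (carrier Ghat). \<forall>y\<in>tuples n (carrier Ghat).
      (\<forall>j<n. x j N = y j N) \<longrightarrow> f x = f y"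
    by (intro bexI [OF _ N(1)] ballI impI)
  then show "f \<in> continuous n"
    unfolding continuous_cochains_def continuous_iff_factors [OF f, symmetric]
    using extends_cochain_Ghat [OF assms] by simp
  show "pullback n f = l"
  proof (rule extensionalityI [where A = "tuples n (carrier G)"])
    show "pullback n f \<in> extensional (tuples n (carrier G))"
      by (simp add: cochain_pullback_def)
    show "l \<in> extensional (tuples n (carrier G))"
      using extends_cochain [OF assms] by (simp add: cochains_iff PiE_def)
    fix g
    assume g: "g \<in> tuples n (carrier G)"
    have "f (\<lambda>j\<in>{..<n}. to_completion G (g j)) = l g"
      by (rule agreeD [OF N(2) to_completion_tuples(1) [OF g] g to_completion_tuples(2) [OF g N(1)]])
    then show "pullback n f g = l g"
      using g by (simp add: cochain_pullback_def)
  qed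
qed

lemma locally_constant_extends:
  assumes "l \<in> cochains G M n" "locally_constant n l"
  shows "\<exists>f. extends n l f"
proof -
  obtain N where N: "N \<in> fin_normal"
    "\<forall>g\<in>tuples n (carrier G). \<forall>g'\<in>tuples n (carrier G). (\<forall>j<n. cl N (g j) = cl N (g' j)) \<longrightarrow> l g = l g'"
    using assms(2) unfolding locally_constant_def by (elim bexE) (rule that)
  have "extends n l (\<lambda>x\<in>tuples n (carrier Ghat). l (\<lambda>j\<in>{..<n}. approx N (x j)))"
  proof (rule extendsI [OF assms(1) _ N(1)])
    fix x g
    assume x: "x \<in> tuples n (carrier Ghat)" and g: "g \<in> tuples n (carrier G)"
      and eq: "\<And>j. j < n \<Longrightarrow> x j N = cl N (g j)"
    note ap = approx_tuples [OF x N(1)]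
    have "\<forall>j<n. cl N ((\<lambda>j\<in>{..<n}. approx N (x j)) j) = cl N (g j)"
      by (intro allI impI) (simp only: ap(2) [symmetric] eq)
    then have "l (\<lambda>j\<in>{..<n}. approx N (x j)) = l g"
      by (rule mp [OF bspec [OF bspec [OF N(2) ap(1)] g]])
    then show "(\<lambda>x\<in>tuples n (carrier Ghat). l (\<lambda>j\<in>{..<n}. approx N (x j))) x = l g"
      using x by simp
  qed simp
  then show ?thesis
    by blast
qed

lemma extends_locally_constant:
  assumes "extends n l f"
  shows "locally_constant n l"
proof -
  obtain N where N: "N \<in> fin_normal" "agree n N l f"
    using extends_agree [OF assms(1)] by blast
  have "l g = l g'" if g: "g \<in> tuples n (carrier G)" "g' \<in> tuples n (carrier G)"
    and eq: "\<forall>j<n. cl N (g j) = cl N (g' j)" for g g'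
  proof -
    let ?x = "\<lambda>j\<in>{..<n}. to_completion G (g j)"
    note x = to_completion_tuples [OF g(1)]
    have "?x j N = cl N (g' j)" if "j < n" for j
      unfolding x(2) [OF N(1) that] using eq that by blast
    then have "f ?x = l g'"
      by (rule agreeD [OF N(2) x(1) g(2)])
    moreover have "f ?x = l g"
      by (rule agreeD [OF N(2) x(1) g(1) x(2) [OF N(1)]])
    ultimately show ?thesis
      by simp
  qed
  then show ?thesis
    unfolding locally_constant_def by (intro bexI [OF _ N(1)] ballI impI)
qed

lemma extends_one: "extends n \<one>\<^bsub>cochain_group G M n\<^esub> \<one>\<^bsub>cochain_group Ghat M n\<^esub>"
  by (rule extendsI [OF _ _ finite_index_normal_UNIV]) (auto simp: cochains_iff cochain_group_def)

lemma extends_mult: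
  assumes "extends n l f" "extends n l' f'"
  shows "extends n (l \<otimes>\<^bsub>cochain_group G M n\<^esub> l') (f \<otimes>\<^bsub>cochain_group Ghat M n\<^esub> f')"
proof -
  obtain N where N: "N \<in> fin_normal" "agree n N l f"
    using extends_agree [OF assms(1)] by blast
  obtain N' where N': "N' \<in> fin_normal" "agree n N' l' f'"
    using extends_agree [OF assms(2)] by blast
  note K = finite_index_normal_Int [OF N(1) N'(1)]
  show ?thesis
  proof (rule extendsI [OF _ _ K])
    show "l \<otimes>\<^bsub>cochain_group G M n\<^esub> l' \<in> cochains G M n"
      using extends_cochain [OF assms(1)] extends_cochain [OF assms(2)]
      by (auto simp: cochains_iff cochain_group_def PiE_def Pi_def)
    show "f \<otimes>\<^bsub>cochain_group Ghat M n\<^esub> f' \<in> extensional (tuples n (carrier Ghat))"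
      by (simp add: cochain_group_def)
    fix x g
    assume x: "x \<in> tuples n (carrier Ghat)" and g: "g \<in> tuples n (carrier G)"
      and eq: "\<And>j. j < n \<Longrightarrow> x j (N \<inter> N') = cl (N \<inter> N') (g j)"
    show "(f \<otimes>\<^bsub>cochain_group Ghat M n\<^esub> f') x = (l \<otimes>\<^bsub>cochain_group G M n\<^esub> l') g"
      using agreeD [OF agree_mono [OF N(2,1) K Int_lower1] x g eq] agreeD [OF agree_mono [OF N'(2,1) K Int_lower2] x g eq] x g
      by (simp add: cochain_group_def)
  qed
qed

lemma extends_inv:
  assumes "extends n l f"
  shows "extends n (inv\<^bsub>cochain_group G M n\<^esub> l) (inv\<^bsub>cochain_group Ghat M n\<^esub> f)"
proof -
  obtain N where N: "N \<in> fin_normal" "agree n N l f"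
    using extends_agree [OF assms(1)] by blast
  have l: "inv\<^bsub>cochain_group G M n\<^esub> l = (\<lambda>g\<in>tuples n (carrier G). inv\<^bsub>M\<^esub> l g)"
    using extends_cochain [OF assms] unfolding cochain_group_def cochains_iff
    by (rule inv_product_group) (rule M.is_group)
  have f: "inv\<^bsub>cochain_group Ghat M n\<^esub> f = (\<lambda>x\<in>tuples n (carrier Ghat). inv\<^bsub>M\<^esub> f x)"
    using extends_cochain_Ghat [OF assms] unfolding cochain_group_def cochains_def carrier_product_group
    by (rule inv_product_group) (rule M.is_group)
  show ?thesis
    unfolding l f
  proof (rule extendsI [OF _ _ N(1)])
    show "(\<lambda>g\<in>tuples n (carrier G). inv\<^bsub>M\<^esub> l g) \<in> cochains G M n"
      using extends_cochain [OF assms] by (auto simp: cochains_iff)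
    fix x g
    assume x: "x \<in> tuples n (carrier Ghat)" and g: "g \<in> tuples n (carrier G)"
      and eq: "\<And>j. j < n \<Longrightarrow> x j N = cl N (g j)"
    show "(\<lambda>x\<in>tuples n (carrier Ghat). inv\<^bsub>M\<^esub> f x) x = (\<lambda>g\<in>tuples n (carrier G). inv\<^bsub>M\<^esub> l g) g"
      using agreeD [OF N(2) x g eq] x g by simp
  qed simp
qed

lemma comm_group_cochains_Ghat: "comm_group (cochain_group Ghat M n)"
  by (rule comm_group_cochain_group [OF comm_group_M])

lemma subgroup_continuous: "subgroup (continuous n) (cochain_group Ghat M n)"
proof -
  interpret C: comm_group "cochain_group Ghat M n"
    by (rule comm_group_cochains_Ghat)
  show ?thesis
  proof (rule C.subgroupI)
    show "continuous n \<subseteq> carrier (cochain_group Ghat M n)"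
      by (auto simp: continuous_cochains_def cochains_def)
    show "continuous n \<noteq> {}"
      using extends_continuous(1) [OF extends_one] by blast
    show "inv\<^bsub>cochain_group Ghat M n\<^esub> f \<in> continuous n" if "f \<in> continuous n" for f
      by (rule extends_continuous(1) [OF extends_inv [OF continuous_extends [OF that]]])
    show "f \<otimes>\<^bsub>cochain_group Ghat M n\<^esub> f' \<in> continuous n" if "f \<in> continuous n" "f' \<in> continuous n" for f f'
      by (rule extends_continuous(1) [OF extends_mult [OF continuous_extends [OF that(1)] continuous_extends [OF that(2)]]])
  qed
qed

lemma pullback_mult:
  "f \<in> continuous n \<Longrightarrow> f' \<in> continuous n \<Longrightarrow>
    pullback n (f \<otimes>\<^bsub>cochain_group Ghat M n\<^esub> f') = pullback n f \<otimes>\<^bsub>cochain_group G M n\<^esub> pullback n f'"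
  by (rule extends_continuous(2) [OF extends_mult [OF continuous_extends continuous_extends]])

lemma action_kernel:
  assumes fin: "finite (carrier M)"
  shows "kernel G (AutoGroup M) \<alpha> \<in> fin_normal"
proof -
  interpret \<alpha>: group_hom G "AutoGroup M" \<alpha>
    using module by (intro group_hom.intro group_hom_axioms.intro is_group M.AutoGroup) (simp add: group_module_def)
  show ?thesis
  proof (rule finite_index_normalI [where f = \<alpha>])
    show "kernel G (AutoGroup M) \<alpha> \<lhd> G"
      by (rule \<alpha>.normal_kernel)
    have "\<alpha> g \<in> carrier M \<rightarrow>\<^sub>E carrier M" if "g \<in> carrier G" for g
      using \<alpha>.hom_closed [OF that] by (auto simp: AutoGroup_def auto_def Bij_def bij_betw_def PiE_def)
    then show "finite (\<alpha> ` carrier G)"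
      using fin by (intro finite_subset [OF _ finite_PiE [OF fin fin]]) blast
    show "g \<odot> iv h \<in> kernel G (AutoGroup M) \<alpha>" if "g \<in> carrier G" "h \<in> carrier G" "\<alpha> g = \<alpha> h" for g h
      using that by (simp add: mul_def iv_def kernel_def)
  qed
qed

text \<open>On a coset of its kernel \<alpha> takes a single value, so \<open>the_elem\<close> is
  applied to a singleton.\<close>

lemma completion_action_eq:
  assumes g: "g \<in> carrier G" and x: "x (kernel G (AutoGroup M) \<alpha>) = cl (kernel G (AutoGroup M) \<alpha>) g"
  shows "completion_action G M \<alpha> x = \<alpha> g"
proof -
  interpret \<alpha>: group_hom G "AutoGroup M" \<alpha>
    using module by (intro group_hom.intro group_hom_axioms.intro is_group M.AutoGroup) (simp add: group_module_def)
  let ?L = "kernel G (AutoGroup M) \<alpha>"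
  have "x ?L = (\<lambda>k. k \<otimes> g) ` ?L"
    using x g by (auto simp: cl_def r_coset_def)
  then have "\<alpha> ` x ?L = (\<lambda>k. \<alpha> (k \<otimes> g)) ` ?L"
    by (simp only: image_image)
  also have "\<dots> = (\<lambda>k. \<alpha> g) ` ?L"
    by (rule image_cong) (use g in \<open>simp_all add: kernel_def\<close>)
  also have "\<dots> = {\<alpha> g}"
    using subgroup.one_closed [OF \<alpha>.subgroup_kernel] by auto
  finally have "\<alpha> ` x ?L = {\<alpha> g}" .
  then show ?thesis
    by (simp add: completion_action_def)
qed

lemma merge_tuples:
  assumes "g \<in> tuples (Suc n) (carrier G)" "i < n"
  shows "merge G n i g \<in> tuples n (carrier G)"
  using assms by (auto simp: tuples_iff merge_def)

text \<open>At the level of \<open>N\<close> intersected with the kernel of the action, the coset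
  coordinates determine the action of the first entry, the products of adjacent entries and the
  values of \<open>f\<close>, hence every factor of the differential.\<close>

lemma extends_differential:
  assumes fin: "finite (carrier M)" and lf: "extends n l f"
  shows "extends (Suc n) (differential G M \<alpha> n l) (differential Ghat M (completion_action G M \<alpha>) n f)"
proof -
  obtain N where N: "N \<in> fin_normal" "agree n N l f"
    using extends_agree [OF lf] by blast
  let ?L = "kernel G (AutoGroup M) \<alpha>"
  let ?K = "N \<inter> ?L"
  note L = action_kernel [OF fin]
  note K = finite_index_normal_Int [OF N(1) L]
  show ?thesis
  proof (rule extendsI [OF differential_cochains [OF extends_cochain [OF lf]] _ K])
    show "differential Ghat M (completion_action G M \<alpha>) n f \<in> extensional (tuples (Suc n) (carrier Ghat))"
      by (simp add: differential_def)
    fix x g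
    assume x: "x \<in> tuples (Suc n) (carrier Ghat)" and g: "g \<in> tuples (Suc n) (carrier G)"
      and eq: "\<And>j. j < Suc n \<Longrightarrow> x j ?K = cl ?K (g j)"
    have xj: "x j \<in> carrier Ghat" and gj: "g j \<in> carrier G" if "j < Suc n" for j
      using x g that by (auto simp: tuples_def)
    have "x 0 ?K = to_completion G (g 0) ?K"
      using eq [of 0] to_completion_apply [OF gj K, of 0] by simp
    then have "x 0 ?L = to_completion G (g 0) ?L"
      by (intro Ghat_mono [OF xj to_completion_closed [OF gj] K L Int_lower2]) simp_all
    then have "x 0 ?L = cl ?L (g 0)"
      using to_completion_apply [OF gj L, of 0] by simp
    then have act: "completion_action G M \<alpha> (x 0) = \<alpha> (g 0)"
      by (intro completion_action_eq gj) simp_all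
    have first: "f (\<lambda>j\<in>{..<n}. x (Suc j)) = l (\<lambda>j\<in>{..<n}. g (Suc j))"
    proof (rule agreeD [OF agree_mono [OF N(2,1) K Int_lower1]])
      show "(\<lambda>j\<in>{..<n}. x (Suc j)) \<in> tuples n (carrier Ghat)"
        using xj by (auto simp: tuples_def)
      show "(\<lambda>j\<in>{..<n}. g (Suc j)) \<in> tuples n (carrier G)"
        using gj by (auto simp: tuples_def)
      show "(\<lambda>j\<in>{..<n}. x (Suc j)) j ?K = cl ?K ((\<lambda>j\<in>{..<n}. g (Suc j)) j)" if "j < n" for j
        using eq [of "Suc j"] that by simp
    qed
    have last: "f (restrict x {..<n}) = l (restrict g {..<n})"
    proof (rule agreeD [OF agree_mono [OF N(2,1) K Int_lower1]])
      show "restrict x {..<n} \<in> tuples n (carrier Ghat)"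
        using xj by (auto simp: tuples_def)
      show "restrict g {..<n} \<in> tuples n (carrier G)"
        using gj by (auto simp: tuples_def)
      show "restrict x {..<n} j ?K = cl ?K (restrict g {..<n} j)" if "j < n" for j
        using eq [of j] that by simp
    qed
    have middle: "f (merge Ghat n i x) = l (merge G n i g)" if i: "i < n" for i
    proof (rule agreeD [OF agree_mono [OF N(2,1) K Int_lower1] _ merge_tuples [OF g i]])
      show "merge Ghat n i x \<in> tuples n (carrier Ghat)"
        using xj Ghat_mult_closed i by (auto simp: tuples_def merge_def)
      have "(x i \<otimes>\<^bsub>Ghat\<^esub> x (Suc i)) ?K = cl ?K (g i \<otimes> g (Suc i))"
        using cl_set_mult [OF finite_index_normal_normal [OF K], of "g i" "g (Suc i)"] gj [of i] gj [of "Suc i"] i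
        by (simp add: Ghat_mult [OF K] eq mul_def)
      then show "merge Ghat n i x j ?K = cl ?K (merge G n i g j)" if "j < n" for j
        using eq [of j] eq [of "Suc j"] that by (simp add: merge_def)
    qed
    have prods: "(\<Otimes>\<^bsub>M\<^esub>i\<in>{..<n}. f (merge Ghat n i x) [^]\<^bsub>M\<^esub> ((- 1) ^ Suc i :: int)) =
        (\<Otimes>\<^bsub>M\<^esub>i\<in>{..<n}. l (merge G n i g) [^]\<^bsub>M\<^esub> ((- 1) ^ Suc i :: int))"
      using cochain_closed [OF extends_cochain [OF lf] merge_tuples [OF g]]
      by (intro M.finprod_cong' HOL.refl) (auto simp: middle)
    show "differential Ghat M (completion_action G M \<alpha>) n f x = differential G M \<alpha> n l g"
      using x g by (simp only: differential_def restrict_apply' act first last prods)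
  qed
qed

lemma differential_group_hom:
  "group_hom (cochain_group G M n) (cochain_group G M (Suc n)) (differential G M \<alpha> n)"
proof (intro group_hom.intro group_hom_axioms.intro)
  show "group (cochain_group G M n)" "group (cochain_group G M (Suc n))"
    using comm_group_cochains by (simp_all add: comm_group_def)
  show "differential G M \<alpha> n \<in> hom (cochain_group G M n) (cochain_group G M (Suc n))"
    by (rule homI) (simp_all add: carrier_cochain_group differential_cochains differential_mult)
qed

lemma subgroup_cocycles: "subgroup (cocycles G M \<alpha> (cochains G M) n) (cochain_group G M n)"
  using group_hom.subgroup_kernel [OF differential_group_hom, of n]
  by (simp add: kernel_def cocycles_def cochains_def)

lemma subgroup_coboundaries: "subgroup (coboundaries G M \<alpha> (cochains G M) n) (cochain_group G M n)"
proof (cases n)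
  case 0
  interpret C: comm_group "cochain_group G M 0"
    by (rule comm_group_cochains)
  show ?thesis
    using C.triv_subgroup by (simp add: 0 coboundaries_def)
next
  case (Suc k)
  then show ?thesis
    using group_hom.img_is_subgroup [OF differential_group_hom, of k] by (simp add: coboundaries_def cochains_def)
qed

lemma coboundaries_subset: "coboundaries G M \<alpha> (cochains G M) n \<subseteq> cocycles G M \<alpha> (cochains G M) n"
proof (cases n)
  case 0
  then show ?thesis
    using subgroup.one_closed [OF subgroup_cocycles [of 0]] by (simp add: coboundaries_def)
next
  case (Suc k)
  then show ?thesis
    by (auto simp: coboundaries_def cocycles_def differential_cochains differential_differential)
qed

text \<open>The differential of \<open>f\<close> extends that of its pullback, and extensions are
  unique, so one is trivial exactly when the other is.\<close>

lemma continuous_cocycles: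
  assumes fin: "finite (carrier M)"
  shows "cocycles Ghat M (completion_action G M \<alpha>) continuous n =
    {f \<in> continuous n. pullback n f \<in> cocycles G M \<alpha> (cochains G M) n}"
proof -
  have "differential Ghat M (completion_action G M \<alpha>) n f = \<one>\<^bsub>cochain_group Ghat M (Suc n)\<^esub> \<longleftrightarrow>
      pullback n f \<in> cocycles G M \<alpha> (cochains G M) n" if "f \<in> continuous n" for f
  proof -
    let ?d = "differential Ghat M (completion_action G M \<alpha>) n f"
    note ext = continuous_extends [OF that]
    note dext = extends_differential [OF fin ext]
    show ?thesis
    proof
      assume "?d = \<one>\<^bsub>cochain_group Ghat M (Suc n)\<^esub>"
      then have "differential G M \<alpha> n (pullback n f) = \<one>\<^bsub>cochain_group G M (Suc n)\<^esub>"
        using extends_continuous(2) [OF dext] extends_continuous(2) [OF extends_one, of "Suc n"] by simp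
      then show "pullback n f \<in> cocycles G M \<alpha> (cochains G M) n"
        using extends_cochain [OF ext] by (simp add: cocycles_def)
    next
      assume "pullback n f \<in> cocycles G M \<alpha> (cochains G M) n"
      then have "extends (Suc n) \<one>\<^bsub>cochain_group G M (Suc n)\<^esub> ?d"
        using dext by (simp add: cocycles_def)
      then show "?d = \<one>\<^bsub>cochain_group Ghat M (Suc n)\<^esub>"
        by (rule extends_unique [OF _ extends_one])
    qed
  qed
  then show ?thesis
    unfolding cocycles_def [of Ghat] by blast
qed

end

context hnn
begin

text \<open>A coboundary of \<open>G\<close> that extends to the completion is also the coboundary of a cochain that
  extends.\<close>

lemma continuous_coboundaries:
  assumes module: "group_module G M \<alpha>" and fin: "finite (carrier M)"
  shows "coboundaries Ghat M (completion_action G M \<alpha>) (continuous_cochains Ghat_top Ghat M) d =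
    {f \<in> continuous_cochains Ghat_top Ghat M d.
      cochain_pullback G (to_completion G) d f \<in> coboundaries G M \<alpha> (cochains G M) d}"
proof -
  interpret coefficients G M \<alpha>
    by unfold_locales (rule module)
  let ?d = "differential Ghat M (completion_action G M \<alpha>)"
  show ?thesis
  proof (cases d)
    case 0
    have "f \<in> continuous 0 \<and> pullback 0 f = \<one>\<^bsub>cochain_group G M 0\<^esub> \<longleftrightarrow> f = \<one>\<^bsub>cochain_group Ghat M 0\<^esub>" for f
    proof
      assume f: "f \<in> continuous 0 \<and> pullback 0 f = \<one>\<^bsub>cochain_group G M 0\<^esub>"
      then have "extends 0 \<one>\<^bsub>cochain_group G M 0\<^esub> f"
        using continuous_extends [of f 0] by simp
      then show "f = \<one>\<^bsub>cochain_group Ghat M 0\<^esub>"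
        by (rule extends_unique [OF _ extends_one])
    next
      assume "f = \<one>\<^bsub>cochain_group Ghat M 0\<^esub>"
      then show "f \<in> continuous 0 \<and> pullback 0 f = \<one>\<^bsub>cochain_group G M 0\<^esub>"
        using extends_continuous [OF extends_one, of 0] by simp
    qed
    then show ?thesis
      unfolding 0 coboundaries_def by auto
  next
    case (Suc k)
    have "f \<in> ?d k ` continuous k \<longleftrightarrow>
        f \<in> continuous (Suc k) \<and> pullback (Suc k) f \<in> differential G M \<alpha> k ` cochains G M k" for f
    proof
      assume "f \<in> ?d k ` continuous k"
      then obtain u where u: "u \<in> continuous k" "f = ?d k u"
        by blast
      note ext = continuous_extends [OF u(1)]
      show "f \<in> continuous (Suc k) \<and> pullback (Suc k) f \<in> differential G M \<alpha> k ` cochains G M k"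
        unfolding u(2) using extends_continuous [OF extends_differential [OF fin ext]] extends_cochain [OF ext]
        by blast
    next
      assume f: "f \<in> continuous (Suc k) \<and> pullback (Suc k) f \<in> differential G M \<alpha> k ` cochains G M k"
      then obtain v where v: "v \<in> cochains G M k" "pullback (Suc k) f = differential G M \<alpha> k v"
        by blast
      have ext: "extends (Suc k) (differential G M \<alpha> k v) f"
        using continuous_extends [OF conjunct1 [OF f]] unfolding v(2) .
      \<comment> \<open>In degree 0 every cochain is locally constant. Otherwise \<open>v\<close>
        differs from a locally constant \<open>l\<close> by a coboundary, which the differential
        kills.\<close>
      have "\<exists>l\<in>cochains G M k. locally_constant k l \<and> differential G M \<alpha> k l = differential G M \<alpha> k v"
      proof (cases k)
        case 0
        then show ?thesis
          using v(1) locally_constant_0 by blast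
      next
        case (Suc k')
        interpret C: comm_group "cochain_group G M (Suc (Suc k'))"
          by (rule comm_group_cochains)
        obtain h l where h: "h \<in> cochains G M k'" and l: "l \<in> cochains G M (Suc k')" "locally_constant (Suc k') l"
          and v_eq: "v = l \<otimes>\<^bsub>cochain_group G M (Suc k')\<^esub> differential G M \<alpha> k' h"
          using cochain_locally_constant [OF module fin v(1) [unfolded Suc]
              extends_locally_constant [OF ext, unfolded Suc]] by blast
        have "differential G M \<alpha> (Suc k') v = differential G M \<alpha> (Suc k') l"
          unfolding v_eq differential_mult [OF l(1) differential_cochains [OF h]] differential_differential [OF h]
          using differential_cochains [OF l(1)] by (simp add: carrier_cochain_group)
        then show ?thesis
          using l unfolding Suc by (intro bexI [of _ l]) simp_all
      qed
      then obtain l where l: "l \<in> cochains G M k" "locally_constant k l"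
        "differential G M \<alpha> k l = differential G M \<alpha> k v"
        by blast
      obtain u where u: "extends k l u"
        using locally_constant_extends [OF l(1,2)] by blast
      have "f = ?d k u"
        using extends_differential [OF fin u] unfolding l(3) by (rule extends_unique [OF ext])
      then show "f \<in> ?d k ` continuous k"
        using extends_continuous(1) [OF u] by blast
    qed
    then show ?thesis
      unfolding Suc coboundaries_def by (simp add: set_eq_iff)
  qed
qed

text \<open>Continuous cocycles and coboundaries are the full preimages of those of the group under
  pullback, so \<open>quotient_iso\<close> leaves only surjectivity: every cocycle is, up to a
  coboundary, the pullback of a continuous cochain.\<close>

lemma completion_cohomology_iso:
  assumes module: "group_module G M \<alpha>" and fin: "finite (carrier M)"
  shows "completion_cohomology_map G M \<alpha> d \<in>
    iso (continuous_cohomology Ghat_top Ghat M (completion_action G M \<alpha>) d) (group_cohomology G M \<alpha> d)"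
proof -
  interpret coefficients G M \<alpha>
    by unfold_locales (rule module)
  interpret C: comm_group "cochain_group G M d"
    by (rule comm_group_cochains)
  have "(\<lambda>c. coboundaries G M \<alpha> (cochains G M) d <#>\<^bsub>cochain_group G M d\<^esub> pullback d ` c) \<in>
    iso (cochain_group Ghat M d\<lparr>carrier := {f \<in> continuous d. pullback d f \<in> cocycles G M \<alpha> (cochains G M) d}\<rparr> Mod
        {f \<in> continuous d. pullback d f \<in> coboundaries G M \<alpha> (cochains G M) d})
      (cochain_group G M d\<lparr>carrier := cocycles G M \<alpha> (cochains G M) d\<rparr> Mod coboundaries G M \<alpha> (cochains G M) d)"
  proof (rule quotient_iso [OF comm_group_cochains_Ghat comm_group_cochains subgroup_continuous _ _
      subgroup_cocycles subgroup_coboundaries coboundaries_subset])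
    show "pullback d (f \<otimes>\<^bsub>cochain_group Ghat M d\<^esub> f') = pullback d f \<otimes>\<^bsub>cochain_group G M d\<^esub> pullback d f'"
      if "f \<in> continuous d" "f' \<in> continuous d" for f f'
      using that by (rule pullback_mult)
    show "pullback d f \<in> carrier (cochain_group G M d)" if "f \<in> continuous d" for f
      using extends_cochain [OF continuous_extends [OF that]] by (simp add: cochains_def)
    fix z
    assume z: "z \<in> cocycles G M \<alpha> (cochains G M) d"
    have "\<exists>l\<in>cochains G M d. \<exists>b\<in>coboundaries G M \<alpha> (cochains G M) d.
        locally_constant d l \<and> z = l \<otimes>\<^bsub>cochain_group G M d\<^esub> b"
    proof (cases d)
      case 0
      have "z = z \<otimes>\<^bsub>cochain_group G M d\<^esub> \<one>\<^bsub>cochain_group G M d\<^esub>"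
        using z by (simp add: cocycles_def cochains_def)
      then show ?thesis
        using z locally_constant_0 [of z] subgroup.one_closed [OF subgroup_coboundaries [of d]]
        unfolding 0 cocycles_def by blast
    next
      case (Suc k)
      \<comment> \<open>The differential of a cocycle is the trivial cochain, which extends to the
        completion and is therefore locally constant.\<close>
      have "locally_constant (Suc (Suc k)) (differential G M \<alpha> (Suc k) z)"
        using z extends_locally_constant [OF extends_one, of "Suc (Suc k)"] by (simp add: Suc cocycles_def)
      then show ?thesis
        using cochain_locally_constant [OF module fin, of z k] z
        unfolding Suc cocycles_def coboundaries_def by auto
    qed
    then obtain l b where lb: "l \<in> cochains G M d" "b \<in> coboundaries G M \<alpha> (cochains G M) d"
      "locally_constant d l" "z = l \<otimes>\<^bsub>cochain_group G M d\<^esub> b"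
      by blast
    obtain f where "extends d l f"
      using locally_constant_extends [OF lb(1,3)] by blast
    then have "f \<in> continuous d" "pullback d f = l"
      by (rule extends_continuous)+
    then show "\<exists>f\<in>continuous d. \<exists>b\<in>coboundaries G M \<alpha> (cochains G M) d. z = pullback d f \<otimes>\<^bsub>cochain_group G M d\<^esub> b"
      using lb by blast
  qed
  then show ?thesis
    unfolding continuous_cohomology_def group_cohomology_def cochain_cohomology_def
      continuous_cocycles [OF fin] continuous_coboundaries [OF module fin] completion_cohomology_map_def [abs_def] .
qed

end

theorem theorem1p8:
  fixes \<Gamma> :: "('g, 'r) monoid_scheme"
    and n :: nat
    and \<phi> :: "nat word set \<Rightarrow> nat word set"
  assumes "group \<Gamma>"
    and "\<phi> \<in> hom (free_group {..<n}) (free_group {..<n})"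
    and "\<Gamma> \<cong> ascending_HNN n \<phi>"
  shows "good TYPE('m) \<Gamma>"
proof -
  obtain a W R where "hnn \<Gamma> a n W R"
    using ascending_HNN_hnn [OF assms] by blast
  then interpret hnn \<Gamma> a n W R .
  show ?thesis
    unfolding good_def p_good_def using completion_cohomology_iso by blast
qed

end
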